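(* Let $\mu_\varepsilon$ be a probability measure on $\mathbb R$ with Lebesgue density $f_\varepsilon$, and assume that there exists $\beta>0$ such that, for every $l=0,1,2$, $$|\hat f_\varepsilon^{(l)}(t)|\le d_l(1+|t|)^{-(\beta+l)},\qquad t\in\mathbb R,$$ with $d_l>0$. For any $d\ge1$, given $\alpha,L,M>0$, let $\mathcal D_d:=\mathcal P_1(\mathbb R^d,M)\cap\mathcal S_d(\alpha,L)$ and $$\psi_n:=n^{(\alpha+1)/[2\alpha+(2\beta d\vee1)+1]}.$$ Then there exists $C>0$ such that, for any estimator $\hat\mu_n$, $$\liminf_{n\to\infty}\ \psi_n\sup_{\mu\in\mathcal D_d}\mathbb E^n_{(\mu\ast\mu_\varepsilon^{\otimes d})}W_1(\hat\mu_n,\mu)>C.$$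
   Context: $\hat f(\mathsf t)=\int e^{\imath\mathsf t\cdot\mathsf x}f(\mathsf x)\,\mathrm d\mathsf x$, and $\hat f^{(l)}$ is the $l$th derivative of $\hat f$. $\mathcal P_1(\mathbb R^d,M)$ is the set of probability measures $\mu$ on $\mathbb R^d$ with $\int|\mathsf x|\,\mu(\mathrm d\mathsf x)\le M$. $\mathcal S_d(\alpha,L)$ is the class of integrable functions $f:\mathbb R^d\to\mathbb R$ with $\sum_{j=1}^d\int_{\mathbb R^d}|\hat f(\mathsf t)|^2(1+t_j^2)^\alpha\,\mathrm d\mathsf t\le L^2$; $\mu\in\mathcal P_1(\mathbb R^d,M)\cap\mathcal S_d(\alpha,L)$ means that $\mu\in\mathcal P_1(\mathbb R^d,M)$ has a Lebesgue density belonging to $\mathcal S_d(\alpha,L)$. $\mu_\varepsilon^{\otimes d}$ is the $d$-fold product measure. An estimator $\hat\mu_n$ is a measurable function of the sample $\mathsf Y^{(n)}=(\mathsf Y_1,\dots,\mathsf Y_n)\in(\mathbb R^d)^n$ with values in the probability measures on $\mathbb R^d$; $\mathbb E^n_{(\mu\ast\mu_\varepsilon^{\otimes d})}$ is expectation when $\mathsf Y_1,\dots,\mathsf Y_n$ are i.i.d. from $\mu\ast\mu_\varepsilon^{\otimes d}$. $W_1$ is the $L^1$-Wasserstein distance for the Euclidean norm. $a\vee b=\max\{a,b\}$.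
   Formalization: The formal theorem also assumes that D_d contains two distinct measures; for small L and M the class D_d is empty, and if it has only one element a constant estimator has zero risk, so the claim fails without this. *)

theory Defs
  imports "HOL-Probability.Probability"
begin

text \<open>
  Dimension \<open>d\<close> is \<open>CARD('d)\<close>. All integrals that may be infinite (moments, Sobolev norms, transport
  costs, risks) are \<^const>\<open>nn_integral\<close>s, so that no finiteness constraint holds by default.
\<close>

definition fourier :: "('a::euclidean_space \<Rightarrow> real) \<Rightarrow> 'a \<Rightarrow> complex" where
  "fourier f t = (LINT x|lborel. exp (\<i> * complex_of_real (t \<bullet> x)) * complex_of_real (f x))"

text \<open>\<^const>\<open>deriv\<close> needs the domain and the range to be the same field, hence \<open>vector_derivative\<close>.\<close>

definition nth_deriv :: "nat \<Rightarrow> (real \<Rightarrow> complex) \<Rightarrow> real \<Rightarrow> complex" where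
  "nth_deriv l = (\<lambda>g t. vector_derivative g (at t)) ^^ l"

definition P1_class :: "real \<Rightarrow> (real ^ 'd) measure set" where
  "P1_class M = {\<mu>. prob_space \<mu> \<and> sets \<mu> = sets borel \<and> (\<integral>\<^sup>+ x. ennreal (norm x) \<partial>\<mu>) \<le> ennreal M}"

definition sobolev_class :: "real \<Rightarrow> real \<Rightarrow> (real ^ 'd \<Rightarrow> real) set" where
  "sobolev_class \<alpha> L = {f. integrable lborel f \<and>
     (\<Sum>j\<in>UNIV. \<integral>\<^sup>+ t. ennreal ((cmod (fourier f t))\<^sup>2 * (1 + (t $ j)\<^sup>2) powr \<alpha>) \<partial>lborel) \<le> ennreal (L\<^sup>2)}"

text \<open>
  The requirement \<open>0 \<le> f x\<close> is needed because \<^const>\<open>ennreal\<close> truncates negative values to \<open>0\<close>.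

  For small \<open>L\<close> and \<open>M\<close> this class is empty: a first moment at most \<open>M\<close> forces mass at least \<open>1/2\<close> into the
  ball of radius \<open>2 * M\<close>, which bounds the \<open>L\<^sup>2\<close> norm of the density, hence \<open>L\<close>, from below. If the class
  has at most one element, a constant estimator has zero maximal risk. A positive lower bound on the
  minimax risk therefore presupposes two distinct elements.
\<close>

definition D_class :: "real \<Rightarrow> real \<Rightarrow> real \<Rightarrow> (real ^ 'd) measure set" where
  "D_class \<alpha> L M = {\<mu> \<in> P1_class M.
     \<exists>f \<in> sobolev_class \<alpha> L. (\<forall>x. 0 \<le> f x) \<and> \<mu> = density lborel (\<lambda>x. ennreal (f x))}"

definition product_power :: "real measure \<Rightarrow> (real ^ 'd) measure" where
  "product_power \<nu> = distr (\<Pi>\<^sub>M i\<in>(UNIV :: 'd set). \<nu>) borel (\<lambda>w. \<chi> i. w i)"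

definition couplings ::
  "'a::euclidean_space measure \<Rightarrow> 'a measure \<Rightarrow> ('a \<times> 'a) measure set" where
  "couplings \<mu> \<nu> = {\<pi>. prob_space \<pi> \<and> sets \<pi> = sets (borel \<Otimes>\<^sub>M borel) \<and>
     distr \<pi> borel fst = \<mu> \<and> distr \<pi> borel snd = \<nu>}"

definition W1 :: "'a::euclidean_space measure \<Rightarrow> 'a measure \<Rightarrow> ennreal" where
  "W1 \<mu> \<nu> = (INF \<pi> \<in> couplings \<mu> \<nu>. \<integral>\<^sup>+ z. ennreal (dist (fst z) (snd z)) \<partial>\<pi>)"

definition sample_space :: "nat \<Rightarrow> (nat \<Rightarrow> real ^ 'd) measure" where
  "sample_space n = (\<Pi>\<^sub>M i\<in>{..<n}. borel)"

definition sample_law :: "nat \<Rightarrow> (real ^ 'd) measure \<Rightarrow> (nat \<Rightarrow> real ^ 'd) measure" where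
  "sample_law n P = (\<Pi>\<^sub>M i\<in>{..<n}. P)"

text \<open>
  On the Borel probability measures of \<open>real ^ 'd\<close>, the sigma-algebra of \<^const>\<open>prob_algebra\<close>
  (generated by the evaluations at Borel sets) is the Borel sigma-algebra of the weak topology.
\<close>

definition is_estimator :: "nat \<Rightarrow> ((nat \<Rightarrow> real ^ 'd) \<Rightarrow> (real ^ 'd) measure) \<Rightarrow> bool" where
  "is_estimator n \<mu>hat \<longleftrightarrow> \<mu>hat \<in> sample_space n \<rightarrow>\<^sub>M prob_algebra borel"

definition risk :: "nat \<Rightarrow> real measure \<Rightarrow> ((nat \<Rightarrow> real ^ 'd) \<Rightarrow> (real ^ 'd) measure) \<Rightarrow>
    (real ^ 'd) measure \<Rightarrow> ennreal" where
  "risk n \<mu>eps \<mu>hat \<mu> =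
     (\<integral>\<^sup>+ y. W1 (\<mu>hat y) \<mu> \<partial>(sample_law n (\<mu> \<star> product_power \<mu>eps)))"

definition psi :: "real \<Rightarrow> real \<Rightarrow> nat \<Rightarrow> nat \<Rightarrow> real" where
  "psi \<alpha> \<beta> d n = real n powr ((\<alpha> + 1) / (2 * \<alpha> + max (2 * \<beta> * real d) 1 + 1))"

end

theory Submission
  imports Defs "HOL-Real_Asymp.Real_Asymp"
begin

text \<open>
  Assouad's method. Strict convexity of the squared Sobolev norm makes the midpoint of two distinct
  elements of the class interior to the Sobolev ball, so that mixing in a little of a heavy-tailed product
  density of small first moment gives a base density \<open>f\<close> with room in both constraints. It is perturbed by
  \<open>A * (\<Sum>k\<in>T. \<psi> (x\<^sub>i / h - k)) * (\<Prod>j\<noteq>i. cos (x\<^sub>j / h) * exp (- x\<^sub>j\<^sup>2 / 2))\<close> with \<open>T \<subseteq> {..<m}\<close>,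
  \<open>m \<approx> 1 / h\<close> and \<open>A \<lesssim> h powr \<alpha>\<close>. In every coordinate the perturbation oscillates at
  frequency \<open>1 / h\<close>, so that convolution with the error density costs a factor \<open>h powr \<beta>\<close> per coordinate,
  and the \<open>\<chi>\<close>-square distance of two neighbouring hypotheses is at most
  \<open>A\<^sup>2 * h powr (2 * \<beta> * d + 1)\<close>; the additional factor \<open>h\<close> comes from the localisation in coordinate \<open>i\<close>.
  Each of the \<open>1 / h\<close> blocks contributes \<open>A * h\<^sup>2\<close> to the transport cost. For \<open>2 * \<beta> * d \<ge> 1\<close>
  take \<open>A \<approx> h powr \<alpha>\<close> and \<open>h = n powr (- 1 / (2 * \<alpha> + 2 * \<beta> * d + 1))\<close>; otherwise \<open>h = 1\<close>
  and \<open>A \<approx> 1 / sqrt n\<close>, which gives the parametric rate. All perturbations are built from Gaussians,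
  whose Fourier transforms are explicit, so that neither Plancherel's theorem nor an inversion theorem is needed.
\<close>

section \<open>Product measures and Fourier transforms\<close>

text \<open>The elbow at \<open>2 * \<beta> * d = 1\<close> comes from the risk
  \<open>A * h\<close>. The chi-square budget alone allows \<open>A * h\<close> of order
  \<open>h powr (1/2 - \<beta> * d) / sqrt n\<close>. For \<open>2 * \<beta> * d < 1\<close> this
  increases with \<open>h\<close>, so the coarsest scale wins; otherwise \<open>h\<close> shrinks
  until the Sobolev bound on \<open>A\<close> stops it. The obstacle is that only two derivatives of
  the transform of the errors are controlled. A smoothed perturbation is thus known to decay only
  like the inverse square, while the chi-square distance divides by the smoothed base density. All
  estimates are therefore run against one weight per coordinate,
  \<open>w x = (1 + \<bar>x\<bar>) powr (- (5/2))\<close>: the base density dominates it, the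
  perturbations are dominated by it, and Peetre's inequality carries it through convolution with the
  errors. Since \<open>L\<close> and \<open>M\<close> are given, a base density of simple shape may
  violate the constraints. The slack is extracted from two distinct elements of the class, which is
  where uniqueness of the Fourier transform enters.\<close>

lemma Basis_vec_real: "(Basis :: (real ^ 'd) set) = range (\<lambda>i. axis i 1)"
  by (auto simp: Basis_vec_def)

lemma measurable_vec_lambda_PiM [measurable]:
  "(\<lambda>w. \<chi> i. w i) \<in> (\<Pi>\<^sub>M i\<in>(UNIV :: 'd::finite set). borel) \<rightarrow>\<^sub>M (borel :: (real ^ 'd) measure)"
  by (subst borel_measurable_euclidean_space) (auto simp: Basis_vec_real inner_axis)

lemma borel_measurable_vec_nth [measurable]: "(\<lambda>x::real ^ 'd. x $ i) \<in> borel_measurable borel"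
  by (intro borel_measurable_continuous_onI continuous_intros)

context
  fixes \<nu> :: "real measure"
  assumes sfin: "sigma_finite_measure \<nu>" and sets_nu: "sets \<nu> = sets borel"
begin

lemma measurable_product_power_aux:
  "(\<lambda>w. \<chi> i. w i) \<in> (\<Pi>\<^sub>M i\<in>(UNIV :: 'd::finite set). \<nu>) \<rightarrow>\<^sub>M (borel :: (real ^ 'd) measure)"
proof -
  have "sets (\<Pi>\<^sub>M i\<in>(UNIV :: 'd set). \<nu>) = sets (\<Pi>\<^sub>M i\<in>(UNIV :: 'd set). borel)"
    by (intro sets_PiM_cong refl sets_nu)
  then show ?thesis
    using measurable_vec_lambda_PiM by (subst measurable_cong_sets[OF _ refl])
qed

lemma nn_integral_product_power_prod:
  assumes "\<And>j. f j \<in> borel_measurable borel"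
  shows "(\<integral>\<^sup>+x. (\<Prod>j\<in>UNIV. f j (x $ j)) \<partial>(product_power \<nu> :: (real ^ 'd) measure)) = (\<Prod>j\<in>UNIV. \<integral>\<^sup>+x. f j x \<partial>\<nu>)"
proof -
  interpret product_sigma_finite "\<lambda>_::'d. \<nu>" by (rule product_sigma_finite.intro) (rule sfin)
  note [measurable] = measurable_product_power_aux assms
  have "(\<integral>\<^sup>+x. (\<Prod>j\<in>UNIV. f j (x $ j)) \<partial>(product_power \<nu> :: (real ^ 'd) measure))
     = (\<integral>\<^sup>+w. (\<Prod>j\<in>UNIV. f j (w j)) \<partial>(\<Pi>\<^sub>M i\<in>(UNIV :: 'd set). \<nu>))"
    unfolding product_power_def by (subst nn_integral_distr) auto
  also have "\<dots> = (\<Prod>j\<in>UNIV. \<integral>\<^sup>+x. f j x \<partial>\<nu>)"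
    using assms by (intro product_nn_integral_prod) (auto simp: measurable_cong_sets[OF sets_nu refl])
  finally show ?thesis .
qed

text \<open>Fubini for functions that split over the coordinates. The measure stays general because
  it is instantiated twice: with \<open>lborel\<close>, to compute Lebesgue integrals on
  \<open>real ^ 'd\<close>, and with the error law, to smooth perturbations coordinate by
  coordinate.\<close>

lemma
  fixes f :: "'d::finite \<Rightarrow> real \<Rightarrow> 'b::{real_normed_field,banach,second_countable_topology}"
  assumes "\<And>j. integrable \<nu> (f j)"
  shows integrable_product_power_prod:
      "integrable (product_power \<nu> :: (real ^ 'd) measure) (\<lambda>x. \<Prod>j\<in>UNIV. f j (x $ j))" (is ?A)
    and integral_product_power_prod:
      "(LINT x|(product_power \<nu> :: (real ^ 'd) measure). (\<Prod>j\<in>UNIV. f j (x $ j))) = (\<Prod>j\<in>UNIV. LINT x|\<nu>. f j x)" (is ?B)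
proof -
  interpret product_sigma_finite "\<lambda>_::'d. \<nu>" by (rule product_sigma_finite.intro) (rule sfin)
  have [measurable]: "f j \<in> borel_measurable borel" for j
    using assms[of j, THEN borel_measurable_integrable] by (simp add: measurable_cong_sets[OF sets_nu refl])
  note [measurable] = measurable_product_power_aux
  show ?A unfolding product_power_def
    by (subst integrable_distr_eq) (auto intro!: product_integrable_prod assms)
  show ?B unfolding product_power_def
    by (subst integral_distr) (auto intro!: product_integral_prod assms)
qed

end

lemma prob_space_product_power:
  assumes "prob_space \<nu>" "sets \<nu> = sets borel"
  shows "prob_space (product_power \<nu> :: (real ^ 'd) measure)"
proof -
  interpret prob_space \<nu> by fact
  interpret product_prob_space "\<lambda>_::'d. \<nu>" by unfold_locales
  show ?thesis unfolding product_power_def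
    by (intro prob_space.prob_space_distr prob_space_PiM measurable_product_power_aux assms prob_space_imp_sigma_finite)
qed

text \<open>Lebesgue measure is determined by the volumes of boxes, and the indicator of a box is a
  product of interval indicators.\<close>

lemma product_power_lborel: "product_power lborel = (lborel :: (real ^ 'd) measure)"
proof (rule lborel_eqI[symmetric])
  fix l u :: "real ^ 'd" assume le: "\<And>b. b \<in> Basis \<Longrightarrow> l \<bullet> b \<le> u \<bullet> b"
  then have le': "l $ i \<le> u $ i" for i by (force simp: Basis_vec_real inner_axis)
  have "emeasure (product_power lborel) (box l u) = (\<integral>\<^sup>+x. (\<Prod>j\<in>UNIV. indicator {l $ j<..<u $ j} (x $ j)) \<partial>(product_power lborel :: (real ^ 'd) measure))"
  proof -
    have "indicator (box l u) x = (\<Prod>j\<in>UNIV. indicator {l $ j<..<u $ j} (x $ j) :: ennreal)" for x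
      by (auto simp: indicator_def mem_box_cart)
    then have "(\<integral>\<^sup>+x. (\<Prod>j\<in>UNIV. indicator {l $ j<..<u $ j} (x $ j)) \<partial>(product_power lborel :: (real ^ 'd) measure)) =
        (\<integral>\<^sup>+x. indicator (box l u) x \<partial>(product_power lborel :: (real ^ 'd) measure))"
      by simp
    then show ?thesis by (simp add: product_power_def)
  qed
  also have "\<dots> = (\<Prod>j\<in>UNIV. ennreal (u $ j - l $ j))"
    using le' by (subst nn_integral_product_power_prod) (auto intro!: prod.cong lborel.sigma_finite_measure_axioms)
  also have "\<dots> = ennreal (\<Prod>j\<in>UNIV. u $ j - l $ j)"
    using le' by (intro prod_ennreal) auto
  also have "(\<Prod>j\<in>UNIV. u $ j - l $ j) = (\<Prod>b\<in>Basis. (u - l) \<bullet> b)"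
    unfolding Basis_vec_real by (subst prod.reindex) (auto simp: inner_axis inj_on_def axis_eq_axis)
  finally show "emeasure (product_power lborel) (box l u) = (\<Prod>b\<in>Basis. (u - l) \<bullet> b)" .
qed (simp add: product_power_def)

lemmas nn_integral_lborel_vec_prod =
  nn_integral_product_power_prod[OF lborel.sigma_finite_measure_axioms sets_lborel, unfolded product_power_lborel]
lemmas integrable_lborel_vec_prod =
  integrable_product_power_prod[OF lborel.sigma_finite_measure_axioms sets_lborel, unfolded product_power_lborel]
lemmas integral_lborel_vec_prod =
  integral_product_power_prod[OF lborel.sigma_finite_measure_axioms sets_lborel, unfolded product_power_lborel]

section \<open>Fourier transforms of integrable functions\<close>

lemma integrable_iexp_mult:
  fixes f :: "'a::euclidean_space \<Rightarrow> real"
  assumes "integrable lborel f"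
  shows "integrable lborel (\<lambda>x. exp (\<i> * complex_of_real (t \<bullet> x)) * complex_of_real (f x))"
  by (rule Bochner_Integration.integrable_bound[OF assms])
     (use assms in \<open>auto simp: norm_mult\<close>)

text \<open>The exponential of an inner product is a product over the coordinates; this reduces the
  transforms of product densities and perturbations to the line.\<close>

lemma fourier_prod:
  fixes f :: "'d::finite \<Rightarrow> real \<Rightarrow> real"
  assumes "\<And>j. integrable lborel (f j)"
  shows "fourier (\<lambda>x::real ^ 'd. \<Prod>j\<in>UNIV. f j (x $ j)) t = (\<Prod>j\<in>UNIV. fourier (f j) (t $ j))"
proof -
  have "fourier (\<lambda>x::real ^ 'd. \<Prod>j\<in>UNIV. f j (x $ j)) t
    = (LINT x|lborel. (\<Prod>j\<in>UNIV. exp (\<i> * complex_of_real (t $ j \<bullet> x $ j)) * complex_of_real (f j (x $ j))))"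
    unfolding fourier_def
    by (simp add: prod.distrib exp_sum[symmetric] inner_vec_def sum_distrib_left)
  also have "\<dots> = (\<Prod>j\<in>UNIV. fourier (f j) (t $ j))"
    unfolding fourier_def by (intro integral_lborel_vec_prod integrable_iexp_mult assms)
  finally show ?thesis .
qed

lemma fourier_add:
  assumes "integrable lborel f" "integrable lborel g"
  shows "fourier (\<lambda>x. f x + g x) t = fourier f t + fourier g t"
  unfolding fourier_def using integrable_iexp_mult[OF assms(1)] integrable_iexp_mult[OF assms(2)]
  by (simp add: distrib_left)

lemma fourier_cmult: "fourier (\<lambda>x. c * f x) t = complex_of_real c * fourier f t"
  unfolding fourier_def by (simp add: ac_simps flip: integral_mult_right_zero)

lemma fourier_sum:
  assumes "\<And>k. k \<in> I \<Longrightarrow> integrable lborel (f k)"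
  shows "fourier (\<lambda>x. \<Sum>k\<in>I. f k x) t = (\<Sum>k\<in>I. fourier (f k) t)"
  unfolding fourier_def using integrable_iexp_mult[OF assms]
  by (simp add: sum_distrib_left)

lemma fourier_0: "fourier f 0 = complex_of_real (LINT x|lborel. f x)"
  unfolding fourier_def by simp

lemma measurable_fourier [measurable]:
  fixes f :: "'a::euclidean_space \<Rightarrow> real"
  assumes [measurable]: "f \<in> borel_measurable borel"
  shows "fourier f \<in> borel_measurable borel"
  unfolding fourier_def by measurable

section \<open>Translation and convolution\<close>

lemma nn_integral_shift_lborel:
  fixes f :: "'a::euclidean_space \<Rightarrow> ennreal"
  assumes [measurable]: "f \<in> borel_measurable borel"
  shows "(\<integral>\<^sup>+x. f (x + t) \<partial>lborel) = (\<integral>\<^sup>+x. f x \<partial>lborel)"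
  by (subst (2) lborel_affine[of 1 t]) (auto simp: nn_integral_density nn_integral_distr add.commute)

text \<open>Only the left factor carries a density; the right one is any finite Borel measure, so
  the errors enter through integration alone. Tonelli and translation invariance move the shift from
  the set to the density.\<close>

lemma convolution_density_left:
  fixes f :: "'a::ordered_euclidean_space \<Rightarrow> ennreal"
  assumes [measurable]: "f \<in> borel_measurable borel"
    and fin: "finite_measure (density lborel f)" and "finite_measure E" and [measurable_cong]: "sets E = sets borel"
  shows "density lborel f \<star> E = density lborel (\<lambda>x. \<integral>\<^sup>+y. f (x - y) \<partial>E)"
proof (rule measure_eqI)
  interpret E: finite_measure E by fact
  interpret pair_sigma_finite lborel E by unfold_locales
  fix A assume "A \<in> sets (density lborel f \<star> E)"
  then have [measurable]: "A \<in> sets borel" by simp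
  have "emeasure (density lborel f \<star> E) A = (\<integral>\<^sup>+x. indicator A x \<partial>(density lborel f \<star> E))"
    by simp
  also have "\<dots> = (\<integral>\<^sup>+x. \<integral>\<^sup>+y. indicator A (x + y) \<partial>E \<partial>density lborel f)"
    by (rule nn_integral_convolution) (auto simp: fin \<open>finite_measure E\<close> \<open>sets E = sets borel\<close>)
  also have "\<dots> = (\<integral>\<^sup>+x. \<integral>\<^sup>+y. f x * indicator A (x + y) \<partial>E \<partial>lborel)"
    by (subst nn_integral_density) (auto simp: nn_integral_cmult)
  also have "\<dots> = (\<integral>\<^sup>+y. \<integral>\<^sup>+x. f x * indicator A (x + y) \<partial>lborel \<partial>E)"
    by (rule Fubini'[symmetric]) simp
  also have "\<dots> = (\<integral>\<^sup>+y. \<integral>\<^sup>+x. f (x - y) * indicator A x \<partial>lborel \<partial>E)"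
  proof (rule nn_integral_cong)
    fix y
    show "(\<integral>\<^sup>+x. f x * indicator A (x + y) \<partial>lborel) = (\<integral>\<^sup>+x. f (x - y) * indicator A x \<partial>lborel)"
      using nn_integral_shift_lborel[of "\<lambda>x. f (x - y) * indicator A x" y] by simp
  qed
  also have "\<dots> = (\<integral>\<^sup>+x. \<integral>\<^sup>+y. f (x - y) * indicator A x \<partial>E \<partial>lborel)"
    by (rule Fubini') simp
  also have "\<dots> = emeasure (density lborel (\<lambda>x. \<integral>\<^sup>+y. f (x - y) \<partial>E)) A"
    by (subst emeasure_density) (auto simp: nn_integral_multc)
  finally show "emeasure (density lborel f \<star> E) A = emeasure (density lborel (\<lambda>x. \<integral>\<^sup>+y. f (x - y) \<partial>E)) A" .
qed simp

section \<open>Two-point testing bounds\<close>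

lemma prod_mono_ennreal:
  fixes f g :: "'a \<Rightarrow> ennreal"
  assumes "\<And>i. i \<in> I \<Longrightarrow> f i \<le> g i"
  shows "prod f I \<le> prod g I"
  using assms by (induction I rule: infinite_finite_induct) (auto intro!: mult_mono)

text \<open>The inequality \<open>min 1 l \<ge> l - l\<^sup>2 / 4\<close> replaces the detour through Hellinger or total variation distances.\<close>

lemma two_point_bound:
  fixes P :: "'a measure" and l X :: "'a \<Rightarrow> real"
  assumes "prob_space P" and l[measurable]: "l \<in> borel_measurable P" and l0: "\<And>x. 0 \<le> l x"
    and l1: "(\<integral>\<^sup>+x. ennreal (l x) \<partial>P) = 1" and l2: "(\<integral>\<^sup>+x. ennreal ((l x)\<^sup>2) \<partial>P) \<le> 2"
    and X[measurable]: "X \<in> borel_measurable P"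
  shows "ennreal (\<bar>a - b\<bar> / 2) \<le> (\<integral>\<^sup>+x. ennreal \<bar>X x - a\<bar> \<partial>P) +
    (\<integral>\<^sup>+x. ennreal \<bar>X x - b\<bar> \<partial>density P (\<lambda>x. ennreal (l x)))"
proof -
  let ?m = "\<integral>\<^sup>+x. ennreal (min 1 (l x) * \<bar>a - b\<bar>) \<partial>P"
  have "ennreal \<bar>a - b\<bar> = (\<integral>\<^sup>+x. ennreal \<bar>a - b\<bar> * ennreal (l x) \<partial>P)"
    by (simp add: nn_integral_cmult l1)
  also have "\<dots> \<le> (\<integral>\<^sup>+x. ennreal (min 1 (l x) * \<bar>a - b\<bar>) + ennreal (\<bar>a - b\<bar> / 4) * ennreal ((l x)\<^sup>2) \<partial>P)"
  proof (intro nn_integral_mono)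
    fix x
    have "l x \<le> min 1 (l x) + (l x)\<^sup>2 / 4"
      using zero_le_power2[of "l x / 2 - 1"] by (auto simp: min_def power2_eq_square field_simps)
    then have "\<bar>a - b\<bar> * l x \<le> \<bar>a - b\<bar> * (min 1 (l x) + (l x)\<^sup>2 / 4)"
      by (intro mult_left_mono) auto
    then show "ennreal \<bar>a - b\<bar> * ennreal (l x) \<le> ennreal (min 1 (l x) * \<bar>a - b\<bar>) + ennreal (\<bar>a - b\<bar> / 4) * ennreal ((l x)\<^sup>2)"
      using l0[of x] by (simp add: ennreal_mult[symmetric] ennreal_plus[symmetric] algebra_simps del: ennreal_plus)
  qed
  also have "\<dots> = ?m + ennreal (\<bar>a - b\<bar> / 4) * (\<integral>\<^sup>+x. ennreal ((l x)\<^sup>2) \<partial>P)"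
    by (simp add: nn_integral_add nn_integral_cmult)
  \<comment> \<open>The second moment bound 2 makes the quadratic loss at most half of
    \<open>\<bar>a - b\<bar>\<close>, so half of the separation survives.\<close>
  also have "\<dots> \<le> ?m + ennreal (\<bar>a - b\<bar> / 4) * 2"
    by (intro add_left_mono mult_left_mono l2) auto
  also have "\<dots> = ?m + ennreal (\<bar>a - b\<bar> / 2)"
    by (simp add: ennreal_numeral[symmetric] ennreal_mult[symmetric] del: ennreal_numeral)
  finally have "ennreal (\<bar>a - b\<bar> / 2) + ennreal (\<bar>a - b\<bar> / 2) \<le> ?m + ennreal (\<bar>a - b\<bar> / 2)"
    by (simp add: ennreal_plus[symmetric] del: ennreal_plus)
  then have "ennreal (\<bar>a - b\<bar> / 2) \<le> ?m"
    by (simp add: add.commute)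
  \<comment> \<open>\<open>min 1 (l x)\<close> lies below both densities \<open>1\<close> and
    \<open>l x\<close>, so the triangle inequality through \<open>X x\<close> splits the separation
    into one error under each law.\<close>
  also have "\<dots> \<le> (\<integral>\<^sup>+x. ennreal \<bar>X x - a\<bar> + ennreal (l x) * ennreal \<bar>X x - b\<bar> \<partial>P)"
  proof (intro nn_integral_mono)
    fix x
    have "min 1 (l x) * \<bar>a - b\<bar> \<le> min 1 (l x) * (\<bar>X x - a\<bar> + \<bar>X x - b\<bar>)"
      using l0[of x] by (intro mult_left_mono) auto
    also have "\<dots> \<le> \<bar>X x - a\<bar> + l x * \<bar>X x - b\<bar>"
      unfolding distrib_left using l0[of x]
      by (intro add_mono mult_right_mono mult_left_le_one_le) auto
    finally show "ennreal (min 1 (l x) * \<bar>a - b\<bar>) \<le> ennreal \<bar>X x - a\<bar> + ennreal (l x) * ennreal \<bar>X x - b\<bar>"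
      using l0[of x] by (simp add: ennreal_mult[symmetric] ennreal_plus[symmetric] del: ennreal_plus)
  qed
  also have "\<dots> = (\<integral>\<^sup>+x. ennreal \<bar>X x - a\<bar> \<partial>P) + (\<integral>\<^sup>+x. ennreal \<bar>X x - b\<bar> \<partial>density P (\<lambda>x. ennreal (l x)))"
    by (simp add: nn_integral_add nn_integral_density)
  finally show ?thesis .
qed

lemma PiM_density:
  assumes "finite I" "prob_space P" "prob_space (density P l)" and l[measurable]: "l \<in> borel_measurable P"
  shows "(\<Pi>\<^sub>M i\<in>I. density P l) = density (\<Pi>\<^sub>M i\<in>I. P) (\<lambda>y. \<Prod>i\<in>I. l (y i))"
proof -
  interpret P: prob_space P by fact
  interpret D: prob_space "density P l" by fact
  interpret PP: product_prob_space "\<lambda>_. P" by unfold_locales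
  interpret DD: product_prob_space "\<lambda>_. density P l" by unfold_locales
  show ?thesis
  proof (rule DD.PiM_eqI[symmetric])
    show "finite I" by fact
    show "sets (density (\<Pi>\<^sub>M i\<in>I. P) (\<lambda>y. \<Prod>i\<in>I. l (y i))) = sets (\<Pi>\<^sub>M i\<in>I. density P l)"
      by (simp cong: sets_PiM_cong)
    fix A assume A: "\<And>i. i \<in> I \<Longrightarrow> A i \<in> sets (density P l)"
    then have [measurable]: "Pi\<^sub>E I A \<in> sets (\<Pi>\<^sub>M i\<in>I. P)"
      using \<open>finite I\<close> by (intro sets_PiM_I_finite) auto
    have "emeasure (density (\<Pi>\<^sub>M i\<in>I. P) (\<lambda>y. \<Prod>i\<in>I. l (y i))) (Pi\<^sub>E I A)
      = (\<integral>\<^sup>+y. (\<Prod>i\<in>I. l (y i)) * indicator (Pi\<^sub>E I A) y \<partial>(\<Pi>\<^sub>M i\<in>I. P))"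
      by (simp add: emeasure_density)
    also have "\<dots> = (\<integral>\<^sup>+y. (\<Prod>i\<in>I. l (y i) * indicator (A i) (y i)) \<partial>(\<Pi>\<^sub>M i\<in>I. P))"
    proof (intro nn_integral_cong)
      \<comment> \<open>Elements of \<open>Pi\<^sub>E I A\<close> are extensional. On the space of
        the product measure every point is, which is why the factorisation of the indicator is
        claimed there only.\<close>
      fix y assume "y \<in> space (\<Pi>\<^sub>M i\<in>I. P)"
      then have "y \<in> extensional I" by (auto simp: space_PiM PiE_def)
      then have "indicator (Pi\<^sub>E I A) y = (\<Prod>i\<in>I. indicator (A i) (y i) :: ennreal)"
        using \<open>finite I\<close> by (auto simp: indicator_def PiE_def Pi_def)
      then show "(\<Prod>i\<in>I. l (y i)) * indicator (Pi\<^sub>E I A) y = (\<Prod>i\<in>I. l (y i) * indicator (A i) (y i))"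
        by (simp add: prod.distrib)
    qed
    also have "\<dots> = (\<Prod>i\<in>I. \<integral>\<^sup>+y. l y * indicator (A i) y \<partial>P)"
      using A \<open>finite I\<close> by (intro PP.product_nn_integral_prod) auto
    also have "\<dots> = (\<Prod>i\<in>I. emeasure (density P l) (A i))"
      using A by (intro prod.cong refl) (simp add: emeasure_density)
    finally show "emeasure (density (\<Pi>\<^sub>M i\<in>I. P) (\<lambda>y. \<Prod>i\<in>I. l (y i))) (Pi\<^sub>E I A) = (\<Prod>i\<in>I. emeasure (density P l) (A i))" .
  qed
qed

text \<open>The second moment of the likelihood ratio \<open>q / p\<close> is one plus the
  chi-square distance, and second moments multiply over the sample. With
  \<open>real n * K \<le> 1/2\<close> the product stays below \<open>exp (1/2) \<le> 2\<close>, the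
  threshold of the two-point inequality.\<close>

lemma sample_two_point_bound:
  fixes M :: "'a measure" and p q :: "'a \<Rightarrow> real"
  assumes p[measurable]: "p \<in> borel_measurable M" and q[measurable]: "q \<in> borel_measurable M"
    and p0: "\<And>x. 0 \<le> p x" and q0: "\<And>x. 0 \<le> q x"
    and p1: "(\<integral>\<^sup>+x. ennreal (p x) \<partial>M) = 1" and q1: "(\<integral>\<^sup>+x. ennreal (q x) \<partial>M) = 1"
    and pos: "AE x in M. 0 < p x"
    and chi: "(\<integral>\<^sup>+x. ennreal ((q x - p x)\<^sup>2 / p x) \<partial>M) \<le> ennreal K"
    and n: "real n * K \<le> 1/2" and chi0: "0 \<le> K"
    and X: "X \<in> borel_measurable (\<Pi>\<^sub>M i\<in>{..<n}. M)"
  shows "ennreal (\<bar>a - b\<bar> / 2) \<le>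
    (\<integral>\<^sup>+y. ennreal \<bar>X y - a\<bar> \<partial>(\<Pi>\<^sub>M i\<in>{..<n}. density M (\<lambda>x. ennreal (p x)))) +
    (\<integral>\<^sup>+y. ennreal \<bar>X y - b\<bar> \<partial>(\<Pi>\<^sub>M i\<in>{..<n}. density M (\<lambda>x. ennreal (q x))))"
proof -
  define P where "P = density M (\<lambda>x. ennreal (p x))"
  define l where "l = (\<lambda>x. q x / p x)"
  have l0: "0 \<le> l x" for x using p0 q0 by (simp add: l_def)
  have [measurable_cong]: "sets P = sets M" by (simp add: P_def)
  have lP[measurable]: "l \<in> borel_measurable M" by (simp add: l_def)
  interpret P: prob_space P
    using p1 by (intro prob_spaceI) (simp add: P_def emeasure_density cong: nn_integral_cong)
  have DQ: "density P (\<lambda>x. ennreal (l x)) = density M (\<lambda>x. ennreal (q x))"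
    unfolding P_def using pos p0 q0
    by (subst density_density_eq) (auto simp: l_def ennreal_mult[symmetric] intro!: density_cong)
  have probQ: "prob_space (density P (\<lambda>x. ennreal (l x)))"
    unfolding DQ using q1 by (intro prob_spaceI) (simp add: emeasure_density cong: nn_integral_cong)
  have l1: "(\<integral>\<^sup>+x. ennreal (l x) \<partial>P) = 1"
    unfolding P_def using pos p0 q0
    by (subst nn_integral_density)
       (auto simp: l_def ennreal_mult[symmetric] q1[symmetric] intro!: nn_integral_cong_AE)
  \<comment> \<open>Adding 1, the integral of \<open>p\<close>, replaces the subtraction in the
    chi-square formula by the identity
    \<open>q\<^sup>2 / p + p = 2 * q + (q - p)\<^sup>2 / p\<close>, whose terms are all nonnegative
    and fit into \<open>ennreal\<close>.\<close>
  have "(\<integral>\<^sup>+x. ennreal ((l x)\<^sup>2) \<partial>P) + 1 = (\<integral>\<^sup>+x. ennreal ((q x)\<^sup>2 / p x) + ennreal (p x) \<partial>M)"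
    unfolding P_def using pos p0 q0
    by (subst nn_integral_density)
       (auto simp: l_def ennreal_mult[symmetric] nn_integral_add p1 power2_eq_square field_simps
         intro!: nn_integral_cong_AE arg_cong2[where f="(+)"])
  also have "\<dots> = (\<integral>\<^sup>+x. 2 * ennreal (q x) + ennreal ((q x - p x)\<^sup>2 / p x) \<partial>M)"
  proof (intro nn_integral_cong_AE, use pos in eventually_elim)
    fix x assume "0 < p x"
    then have "(q x)\<^sup>2 / p x + p x = 2 * q x + (q x - p x)\<^sup>2 / p x"
      by (simp add: power2_eq_square field_simps)
    then show "ennreal ((q x)\<^sup>2 / p x) + ennreal (p x) = 2 * ennreal (q x) + ennreal ((q x - p x)\<^sup>2 / p x)"
      using p0[of x] q0[of x] by (simp add: ennreal_mult[symmetric] ennreal_numeral[symmetric] ennreal_plus[symmetric] del: ennreal_plus ennreal_numeral)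
  qed
  also have "\<dots> = 2 + (\<integral>\<^sup>+x. ennreal ((q x - p x)\<^sup>2 / p x) \<partial>M)"
    by (simp add: nn_integral_add nn_integral_cmult q1)
  also have "\<dots> \<le> 2 + ennreal K" by (intro add_left_mono chi)
  also have "\<dots> = ennreal (1 + K) + 1"
    using chi0 by (simp add: ennreal_numeral[symmetric] ennreal_plus[symmetric] ennreal_1[symmetric] del: ennreal_plus ennreal_numeral ennreal_1)
  finally have l2: "(\<integral>\<^sup>+x. ennreal ((l x)\<^sup>2) \<partial>P) \<le> ennreal (1 + K)"
    by (simp add: add.commute)
  interpret PP: product_prob_space "\<lambda>_::nat. P" by unfold_locales
  let ?PP = "\<Pi>\<^sub>M i\<in>{..<n}. P"
  let ?L = "\<lambda>y. \<Prod>i<n. l (y i)"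
  have [measurable]: "X \<in> borel_measurable ?PP"
    using X by (subst measurable_cong_sets[OF sets_PiM_cong[OF refl] refl, of _ _ "\<lambda>_. M"]) (auto simp: P_def)
  have "ennreal (\<bar>a - b\<bar> / 2) \<le> (\<integral>\<^sup>+y. ennreal \<bar>X y - a\<bar> \<partial>?PP) + (\<integral>\<^sup>+y. ennreal \<bar>X y - b\<bar> \<partial>density ?PP (\<lambda>y. ennreal (?L y)))"
  proof (rule two_point_bound)
    show "prob_space ?PP" by (intro prob_space_PiM P.prob_space_axioms)
    show "?L \<in> borel_measurable ?PP" by simp
    show "0 \<le> ?L y" for y by (intro prod_nonneg) (simp add: l0)
    have "(\<integral>\<^sup>+y. ennreal (?L y) \<partial>?PP) = (\<integral>\<^sup>+y. (\<Prod>i<n. ennreal (l (y i))) \<partial>?PP)"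
      by (simp add: prod_ennreal l0)
    also have "\<dots> = (\<Prod>i<n. \<integral>\<^sup>+y. ennreal (l y) \<partial>P)"
      by (intro PP.product_nn_integral_prod) auto
    finally show "(\<integral>\<^sup>+y. ennreal (?L y) \<partial>?PP) = 1" by (simp add: l1)
    have "(\<integral>\<^sup>+y. ennreal ((?L y)\<^sup>2) \<partial>?PP) = (\<integral>\<^sup>+y. (\<Prod>i<n. ennreal ((l (y i))\<^sup>2)) \<partial>?PP)"
      by (simp add: prod_ennreal l0 prod_power_distrib)
    also have "\<dots> = (\<Prod>i<n. \<integral>\<^sup>+y. ennreal ((l y)\<^sup>2) \<partial>P)"
      by (intro PP.product_nn_integral_prod) auto
    also have "\<dots> \<le> (\<Prod>i<n. ennreal (1 + K))"
      by (intro prod_mono_ennreal l2)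
    also have "\<dots> = ennreal ((1 + K) ^ n)"
      using chi0 by (simp add: ennreal_power del: ennreal_plus)
    also have "(1 + K) ^ n \<le> exp K ^ n"
      using chi0 by (intro power_mono) auto
    also have "\<dots> = exp (real n * K)" by (simp add: exp_of_nat_mult)
    also have "\<dots> \<le> exp (1/2)" using n by simp
    also have "\<dots> \<le> 2"
    proof -
      have "exp (1/2::real) \<le> 1 + 1/2 + (1/2)\<^sup>2" by (rule exp_bound) auto
      then show ?thesis by (simp add: power2_eq_square)
    qed
    finally show "(\<integral>\<^sup>+y. ennreal ((?L y)\<^sup>2) \<partial>?PP) \<le> 2"
      by (simp add: ennreal_leI)
  qed simp
  also have "density ?PP (\<lambda>y. ennreal (?L y)) = (\<Pi>\<^sub>M i\<in>{..<n}. density P (\<lambda>x. ennreal (l x)))"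
    by (subst PiM_density) (auto simp: prod_ennreal l0 P.prob_space_axioms probQ)
  finally show ?thesis unfolding DQ unfolding P_def .
qed

section \<open>Transport cost and Assouad's lemma\<close>

text \<open>The easy half of Kantorovich duality for a whole family at once: along any coupling the
  summed increments are at most \<open>\<Lambda>\<close> times the cost. With absolute values inside
  the sum no signs have to be chosen block by block.\<close>

lemma W1_lower_bound:
  fixes \<mu> \<nu> :: "'a::euclidean_space measure" and F :: "'k \<Rightarrow> 'a \<Rightarrow> real"
  assumes F[measurable]: "\<And>k. F k \<in> borel_measurable borel" and B: "\<And>k x. \<bar>F k x\<bar> \<le> B k"
    and lip: "\<And>x y. (\<Sum>k\<in>K. \<bar>F k x - F k y\<bar>) \<le> \<Lambda> * dist x y" and L: "0 < \<Lambda>"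
  shows "ennreal ((\<Sum>k\<in>K. \<bar>(LINT x|\<nu>. F k x) - (LINT x|\<mu>. F k x)\<bar>) / \<Lambda>) \<le> W1 \<nu> \<mu>"
  unfolding W1_def
proof (intro INF_greatest)
  fix \<pi> assume "\<pi> \<in> couplings \<nu> \<mu>"
  then interpret prob_space \<pi> by (simp add: couplings_def)
  from \<open>\<pi> \<in> couplings \<nu> \<mu>\<close> have [measurable_cong]: "sets \<pi> = sets (borel \<Otimes>\<^sub>M borel)"
    and nu: "\<nu> = distr \<pi> borel fst" and mu: "\<mu> = distr \<pi> borel snd"
    by (auto simp: couplings_def)
  have i1: "integrable \<pi> (\<lambda>z. F k (fst z))" "integrable \<pi> (\<lambda>z. F k (snd z))" for k
    by (rule integrable_const_bound[of _ "B k"]; use B in auto)+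
  have "(\<Sum>k\<in>K. \<bar>(LINT x|\<nu>. F k x) - (LINT x|\<mu>. F k x)\<bar>) / \<Lambda>
    = (\<Sum>k\<in>K. \<bar>LINT z|\<pi>. F k (fst z) - F k (snd z)\<bar>) / \<Lambda>"
    using i1 by (simp add: nu mu integral_distr)
  also have "\<dots> \<le> (\<Sum>k\<in>K. LINT z|\<pi>. \<bar>F k (fst z) - F k (snd z)\<bar>) / \<Lambda>"
    using L i1 by (intro divide_right_mono sum_mono integral_abs_bound) auto
  also have "\<dots> = (LINT z|\<pi>. (\<Sum>k\<in>K. \<bar>F k (fst z) - F k (snd z)\<bar>) / \<Lambda>)"
    using i1 by simp
  finally have "ennreal ((\<Sum>k\<in>K. \<bar>(LINT x|\<nu>. F k x) - (LINT x|\<mu>. F k x)\<bar>) / \<Lambda>)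
     \<le> ennreal (LINT z|\<pi>. (\<Sum>k\<in>K. \<bar>F k (fst z) - F k (snd z)\<bar>) / \<Lambda>)"
    by (rule ennreal_leI)
  also have "\<dots> = (\<integral>\<^sup>+z. ennreal ((\<Sum>k\<in>K. \<bar>F k (fst z) - F k (snd z)\<bar>) / \<Lambda>) \<partial>\<pi>)"
    using i1 L by (intro nn_integral_eq_integral[symmetric]) (auto intro!: sum_nonneg)
  also have "\<dots> \<le> (\<integral>\<^sup>+z. ennreal (dist (fst z) (snd z)) \<partial>\<pi>)"
    using L lip by (intro nn_integral_mono ennreal_leI) (auto simp: divide_le_eq mult.commute)
  finally show "ennreal ((\<Sum>k\<in>K. \<bar>(LINT x|\<nu>. F k x) - (LINT x|\<mu>. F k x)\<bar>) / \<Lambda>)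
     \<le> (\<integral>\<^sup>+z. ennreal (dist (fst z) (snd z)) \<partial>\<pi>)" .
qed

section \<open>Averaging over the edges of the hypercube of hypotheses\<close>

lemma sum_Pow_split:
  fixes R :: "nat set \<Rightarrow> 'b::comm_monoid_add"
  assumes "k < m"
  shows "(\<Sum>T\<in>Pow {..<m}. R T) = (\<Sum>T\<in>Pow ({..<m} - {k}). R T + R (insert k T))"
proof -
  have "{..<m} = insert k ({..<m} - {k})" using assms by auto
  then have "Pow {..<m} = Pow ({..<m} - {k}) \<union> insert k ` Pow ({..<m} - {k})"
    using Pow_insert[of k "{..<m} - {k}"] by simp
  moreover have "(\<Sum>T\<in>Pow ({..<m} - {k}) \<union> insert k ` Pow ({..<m} - {k}). R T) =
     (\<Sum>T\<in>Pow ({..<m} - {k}). R T) + (\<Sum>T\<in>insert k ` Pow ({..<m} - {k}). R T)"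
    by (intro sum.union_disjoint) auto
  moreover have "(\<Sum>T\<in>insert k ` Pow ({..<m} - {k}). R T) = (\<Sum>T\<in>Pow ({..<m} - {k}). R (insert k T))"
    by (subst sum.reindex) (auto intro!: inj_onI)
  ultimately show ?thesis by (simp add: sum.distrib)
qed

text \<open>The cube has \<open>2 ^ m\<close> vertices and \<open>m * 2 ^ (m - 1)\<close> edges. The
  two-point bound gives \<open>s / 2\<close> per edge, duality divides by \<open>\<Lambda>\<close>,
  and averaging over the vertices leaves the factor 1/4. Only neighbouring vertices are compared, so
  the chi-square condition concerns a single block.\<close>

lemma assouad_bound:
  fixes \<mu>s :: "nat set \<Rightarrow> (real ^ 'd) measure" and F :: "nat \<Rightarrow> real ^ 'd \<Rightarrow> real"
    and p :: "nat set \<Rightarrow> real ^ 'd \<Rightarrow> real"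
  assumes cls: "\<And>T. T \<subseteq> {..<m} \<Longrightarrow> \<mu>s T \<in> D"
    and est: "is_estimator n \<mu>hat"
    and F[measurable]: "\<And>k. F k \<in> borel_measurable borel" and B: "\<And>k x. \<bar>F k x\<bar> \<le> B k"
    and lip: "\<And>x y. (\<Sum>k<m. \<bar>F k x - F k y\<bar>) \<le> \<Lambda> * dist x y" and L: "0 < \<Lambda>"
    and p[measurable]: "\<And>T. p T \<in> borel_measurable borel" and p0: "\<And>T x. 0 \<le> p T x"
    and law: "\<And>T. T \<subseteq> {..<m} \<Longrightarrow> \<mu>s T \<star> product_power \<mu>eps = density lborel (\<lambda>x. ennreal (p T x))"
    and p1: "\<And>T. T \<subseteq> {..<m} \<Longrightarrow> (\<integral>\<^sup>+x. ennreal (p T x) \<partial>lborel) = 1"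
    and pos: "\<And>T. T \<subseteq> {..<m} \<Longrightarrow> AE x in lborel. 0 < p T x"
    and chi: "\<And>T k. T \<subseteq> {..<m} \<Longrightarrow> k < m \<Longrightarrow> k \<notin> T \<Longrightarrow>
       (\<integral>\<^sup>+x. ennreal ((p (insert k T) x - p T x)\<^sup>2 / p T x) \<partial>lborel) \<le> ennreal X"
    and X: "real n * X \<le> 1/2" "0 \<le> X"
    and sep: "\<And>T k. T \<subseteq> {..<m} \<Longrightarrow> k < m \<Longrightarrow> k \<notin> T \<Longrightarrow>
       s \<le> \<bar>(LINT x|\<mu>s (insert k T). F k x) - (LINT x|\<mu>s T. F k x)\<bar>" and s0: "0 \<le> s"
  shows "ennreal (real m * s / (4 * \<Lambda>)) \<le> (SUP \<mu>\<in>D. risk n \<mu>eps \<mu>hat \<mu>)"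
proof (cases "m = 0")
  case False
  define S where "S = (SUP \<mu>\<in>D. risk n \<mu>eps \<mu>hat \<mu>)"
  define a where "a = (\<lambda>k T. LINT x|\<mu>s T. F k x)"
  define N where "N = (\<lambda>k y. LINT x|\<mu>hat y. F k x)"
  define Q where "Q = (\<lambda>T. sample_law n (\<mu>s T \<star> product_power \<mu>eps))"
  define R where "R = (\<lambda>k T. \<integral>\<^sup>+y. ennreal \<bar>N k y - a k T\<bar> \<partial>Q T)"
  have setsQ: "sets (Q T) = sets (\<Pi>\<^sub>M i\<in>{..<n}. borel)" for T
    unfolding Q_def sample_law_def by (intro sets_PiM_cong) auto
  \<comment> \<open>Measurability into \<open>prob_algebra\<close> makes every linear functional of
    the estimator a real statistic, to which the two-point bound applies.\<close>
  have N[measurable]: "N k \<in> borel_measurable (\<Pi>\<^sub>M i\<in>{..<n}. borel)" for k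
    unfolding N_def using est[unfolded is_estimator_def sample_space_def]
    by (intro measurable_compose[OF measurable_prob_algebraD integral_measurable_subprob_algebra]) auto
  have NQ[measurable]: "N k \<in> borel_measurable (Q T)" for k T
    using N by (subst measurable_cong_sets[OF setsQ refl])
  have risk: "(\<Sum>k<m. R k T) * ennreal (1 / \<Lambda>) \<le> S" if T: "T \<subseteq> {..<m}" for T
  proof -
    have "(\<Sum>k<m. R k T) * ennreal (1 / \<Lambda>) = (\<integral>\<^sup>+y. (\<Sum>k<m. ennreal \<bar>N k y - a k T\<bar>) * ennreal (1 / \<Lambda>) \<partial>Q T)"
      unfolding R_def by (subst nn_integral_multc) (auto simp: nn_integral_sum simp del: sum_ennreal)
    also have "\<dots> = (\<integral>\<^sup>+y. ennreal ((\<Sum>k<m. \<bar>N k y - a k T\<bar>) / \<Lambda>) \<partial>Q T)"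
      using L by (intro nn_integral_cong) (simp add: sum_ennreal ennreal_mult[symmetric] sum_nonneg)
    \<comment> \<open>Monotonicity alone compares the linear statistics with the Wasserstein loss;
      measurability of the loss in \<open>y\<close> is never invoked.\<close>
    also have "\<dots> \<le> (\<integral>\<^sup>+y. W1 (\<mu>hat y) (\<mu>s T) \<partial>Q T)"
      unfolding N_def a_def by (intro nn_integral_mono W1_lower_bound[where B=B] F B lip L)
    also have "\<dots> = risk n \<mu>eps \<mu>hat (\<mu>s T)" by (simp add: risk_def Q_def)
    also have "\<dots> \<le> S" unfolding S_def using cls[OF T] by (rule SUP_upper)
    finally show ?thesis .
  qed
  have pair: "ennreal (s / 2) \<le> R k T + R k (insert k T)" if T: "T \<subseteq> {..<m}" "k < m" "k \<notin> T" for k T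
  proof -
    have iT: "insert k T \<subseteq> {..<m}" using T by auto
    have [measurable]: "N k \<in> borel_measurable (\<Pi>\<^sub>M i\<in>{..<n}. lborel)"
      using N[of k] by (subst measurable_cong_sets[OF sets_PiM_cong[OF refl sets_lborel] refl])
    have "ennreal (s / 2) \<le> ennreal (\<bar>a k T - a k (insert k T)\<bar> / 2)"
      using sep[OF T] by (intro ennreal_leI) (simp add: a_def abs_minus_commute)
    also have "\<dots> \<le> R k T + R k (insert k T)"
      unfolding R_def Q_def sample_law_def law[OF T(1)] law[OF iT]
      by (rule sample_two_point_bound[where K=X])
         (use p0 p1 pos chi T iT X in auto)
    finally show ?thesis .
  qed
  have "(\<Sum>k<m. 2 ^ (m - 1) * ennreal (s / 2)) \<le> (\<Sum>k<m. \<Sum>T\<in>Pow ({..<m} - {k}). R k T + R k (insert k T))"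
  proof (intro sum_mono)
    fix k assume k: "k \<in> {..<m}"
    then have "card (Pow ({..<m} - {k})) = 2 ^ (m - 1)" by (simp add: card_Pow)
    then have "2 ^ (m - 1) * ennreal (s / 2) = (\<Sum>T\<in>Pow ({..<m} - {k}). ennreal (s / 2))" by simp
    also have "\<dots> \<le> (\<Sum>T\<in>Pow ({..<m} - {k}). R k T + R k (insert k T))"
      using k by (intro sum_mono pair) auto
    finally show "2 ^ (m - 1) * ennreal (s / 2) \<le> (\<Sum>T\<in>Pow ({..<m} - {k}). R k T + R k (insert k T))" .
  qed
  also have "\<dots> = (\<Sum>k<m. \<Sum>T\<in>Pow {..<m}. R k T)"
    by (rule sum.cong[OF refl], rule sum_Pow_split[symmetric]) simp
  also have "\<dots> = (\<Sum>T\<in>Pow {..<m}. \<Sum>k<m. R k T)" by (rule sum.swap)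
  finally have "of_nat m * (2 ^ (m - 1) * ennreal (s / 2)) * ennreal (1 / \<Lambda>)
     \<le> (\<Sum>T\<in>Pow {..<m}. \<Sum>k<m. R k T) * ennreal (1 / \<Lambda>)"
    by (intro mult_right_mono) auto
  also have "\<dots> = (\<Sum>T\<in>Pow {..<m}. (\<Sum>k<m. R k T) * ennreal (1 / \<Lambda>))" by (rule sum_distrib_right)
  also have "\<dots> \<le> (\<Sum>T\<in>Pow {..<m}. S)" by (intro sum_mono risk) auto
  also have "\<dots> = 2 ^ m * S" by (simp add: card_Pow)
  also have "of_nat m * (2 ^ (m - 1) * ennreal (s / 2)) * ennreal (1 / \<Lambda>) = 2 ^ m * ennreal (real m * s / (4 * \<Lambda>))"
  proof -
    have pw: "(2::ennreal) ^ k = ennreal (2 ^ k)" for k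
      using ennreal_power[of 2 k] by simp
    have "real m * (2 ^ (m - 1) * (s / 2)) * (1 / \<Lambda>) = 2 ^ m * (real m * s / (4 * \<Lambda>))"
      using False L by (cases m) (auto simp: field_simps)
    then show ?thesis
      using s0 L unfolding pw ennreal_of_nat_eq_real_of_nat
      by (subst ennreal_mult[symmetric], simp, simp)+ simp
  qed
  finally have "2 ^ m * ennreal (real m * s / (4 * \<Lambda>)) \<le> 2 ^ m * S" .
  then show ?thesis unfolding S_def
    by (subst (asm) ennreal_mult_le_mult_iff) (auto simp: power_eq_top_ennreal)
qed simp

section \<open>Gaussian estimates and decay of Fourier integrals\<close>

text \<open>A single term of the exponential series bounds the power by
  \<open>fact N * exp (1 + \<bar>s\<bar>)\<close>, and
  \<open>\<bar>s\<bar> \<le> 1 + s\<^sup>2 / 4\<close> follows from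
  \<open>(\<bar>s\<bar> / 2 - 1)\<^sup>2 \<ge> 0\<close>.\<close>

lemma one_plus_abs_power_le: "(1 + \<bar>s\<bar>) ^ N \<le> fact N * exp 2 * exp (s\<^sup>2 / 4)" for s :: real
proof -
  have "(1 + \<bar>s\<bar>) ^ N / fact N \<le> exp (1 + \<bar>s\<bar>)"
    using exp_ge_add_one_self sum_le_suminf[OF summable_exp_generic[of "1 + \<bar>s\<bar>"], of "{N}"]
    by (simp add: exp_def divide_inverse mult.commute)
  also have "\<dots> \<le> exp (2 + s\<^sup>2 / 4)"
    using zero_le_power2[of "\<bar>s\<bar> / 2 - 1"] by (simp add: power2_eq_square field_simps)
  also have "\<dots> = exp 2 * exp (s\<^sup>2 / 4)" by (rule exp_add)
  finally show ?thesis by (simp add: pos_divide_le_eq mult_ac)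
qed

text \<open>Half of the Gaussian exponent pays for the polynomial; the remaining
  \<open>exp (- s\<^sup>2 / 4)\<close> is the majorant that \<open>fourier_decay\<close> works
  with.\<close>

lemma power_gauss_le: "(1 + \<bar>s\<bar>) ^ N * exp (- s\<^sup>2 / 2) \<le> fact N * exp 2 * exp (- s\<^sup>2 / 4)" for s :: real
proof -
  have "(1 + \<bar>s\<bar>) ^ N * exp (- s\<^sup>2 / 2) \<le> fact N * exp 2 * exp (s\<^sup>2 / 4) * exp (- s\<^sup>2 / 2)"
    by (intro mult_right_mono one_plus_abs_power_le) auto
  also have "\<dots> = fact N * exp 2 * exp (- s\<^sup>2 / 4)"
    by (simp add: mult.assoc flip: exp_add)
  finally show ?thesis .
qed

lemma fourier_std_normal: "fourier std_normal_density t = exp (- t\<^sup>2 / 2)"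
proof -
  have "fourier std_normal_density t = char std_normal_distribution t"
    unfolding fourier_def char_def
    by (subst integral_density) (auto simp: scaleR_conv_of_real mult.commute)
  then show ?thesis by (simp add: char_std_normal_distribution)
qed

text \<open>The Gaussian is its own transform up to a constant, so its transform formula read
  backwards is already an inversion formula. The inversion formulas for bumps, waves and smoothed
  boxes are all derived from this one.\<close>

lemma std_normal_inversion:
  "complex_of_real (std_normal_density x) = (1 / sqrt (2 * pi)) * (LINT s|lborel. iexp (s * x) * std_normal_density s)"
  using fourier_std_normal[of x] unfolding fourier_def
  by (simp add: std_normal_density_def mult.commute)

section \<open>An integrable weight and Peetre's inequality\<close>

lemma nn_integral_weight: "(\<integral>\<^sup>+x. ennreal ((1 + \<bar>x\<bar>) powr (- (3 / 2))) \<partial>lborel) = 4"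
proof -
  have half: "(\<integral>\<^sup>+x. ennreal ((1 + x) powr (- (3 / 2))) * indicator {0..} x \<partial>lborel) = ennreal (0 - (- 2 * (1 + 0) powr (- (1 / 2))))"
  proof (rule nn_integral_FTC_atLeast)
    fix x :: real assume "0 \<le> x"
    then show "((\<lambda>x. - 2 * (1 + x) powr (- (1 / 2))) has_real_derivative (1 + x) powr (- (3 / 2))) (at x)"
      by (auto intro!: derivative_eq_intros simp: field_simps)
  next
    show "((\<lambda>x::real. - 2 * (1 + x) powr (- (1 / 2))) \<longlongrightarrow> 0) at_top"
      by real_asymp
  qed auto
  have "(\<integral>\<^sup>+x. ennreal ((1 + \<bar>x\<bar>) powr (- (3 / 2))) \<partial>lborel)
    = (\<integral>\<^sup>+x. ennreal ((1 + x) powr (- (3 / 2))) * indicator {0..} x + ennreal ((1 + (- x)) powr (- (3 / 2))) * indicator {0..} (- x) \<partial>lborel)"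
    by (intro nn_integral_cong_AE, use AE_lborel_singleton[of 0] in eventually_elim) (auto simp: indicator_def)
  also have "\<dots> = (\<integral>\<^sup>+x. ennreal ((1 + x) powr (- (3 / 2))) * indicator {0..} x \<partial>lborel) +
     (\<integral>\<^sup>+x. ennreal ((1 + (- x)) powr (- (3 / 2))) * indicator {0..} (- x) \<partial>lborel)"
    by (rule nn_integral_add) auto
  also have "(\<integral>\<^sup>+x. ennreal ((1 + (- x)) powr (- (3 / 2))) * indicator {0..} (- x) \<partial>lborel)
     = (\<integral>\<^sup>+x. ennreal ((1 + x) powr (- (3 / 2))) * indicator {0..} x \<partial>lborel)"
    by (subst (2) nn_integral_real_affine[where c="-1" and t=0]) auto
  finally show ?thesis unfolding half by simp
qed

lemma integrable_weight: "integrable lborel (\<lambda>x::real. (1 + \<bar>x\<bar>) powr (- (3 / 2)))"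
  by (rule integrableI_nn_integral_finite[where x=4]) (auto simp: nn_integral_weight)

lemma one_plus_abs_triangle: "1 + \<bar>a\<bar> \<le> (1 + \<bar>b\<bar>) * (1 + \<bar>a - b\<bar>)" for a b :: real
proof -
  have "1 + \<bar>a\<bar> \<le> 1 + \<bar>b\<bar> + \<bar>a - b\<bar>" by simp
  also have "\<dots> \<le> (1 + \<bar>b\<bar>) * (1 + \<bar>a - b\<bar>)" by (simp add: algebra_simps)
  finally show ?thesis .
qed

text \<open>Peetre's inequality, the device for carrying polynomial weights through translations and
  hence through convolutions.\<close>

lemma peetre:
  fixes a b p :: real
  assumes "0 \<le> p"
  shows "(1 + \<bar>a\<bar>) powr p \<le> (1 + \<bar>b\<bar>) powr p * (1 + \<bar>a - b\<bar>) powr p"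
  unfolding powr_mult[symmetric] by (intro powr_mono2 assms one_plus_abs_triangle) auto

lemma peetre_minus:
  fixes a b p :: real
  assumes "0 \<le> p"
  shows "(1 + \<bar>a\<bar>) powr (- p) \<le> (1 + \<bar>b\<bar>) powr (- p) * (1 + \<bar>a - b\<bar>) powr p"
  using peetre[OF assms, of b a]
  by (simp add: powr_minus field_simps abs_minus_commute)

text \<open>Comparison with the integral: over a unit cell the weight varies by a factor of at most
  \<open>2 powr (3/2) \<le> 4\<close>, the cells are disjoint, and the integral is 4. Uniformity in
  \<open>y\<close> and \<open>m\<close> is what makes sums over blocks independent of their
  number.\<close>

lemma sum_weight_le: "(\<Sum>k<m. (1 + \<bar>y - real k\<bar>) powr (- (3 / 2))) \<le> 16" for y :: real
proof -
  let ?v = "\<lambda>x::real. (1 + \<bar>x\<bar>) powr (- (3 / 2))"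
  have four: "2 powr (3/2) \<le> (4::real)"
    using powr_mono[of "3/2" 2 "2::real"] by simp
  have "ennreal (\<Sum>k<m. ?v (y - real k)) = (\<Sum>k<m. \<integral>\<^sup>+s. ennreal (?v (y - real k)) * indicator {real k..<real k + 1} s \<partial>lborel)"
    by (simp add: nn_integral_cmult_indicator sum_ennreal)
  also have "\<dots> \<le> (\<Sum>k<m. \<integral>\<^sup>+s. 4 * ennreal (?v (y - s)) * indicator {real k..<real k + 1} s \<partial>lborel)"
  proof (intro sum_mono nn_integral_mono)
    fix k and s :: real
    have "?v (y - real k) \<le> 4 * ?v (y - s)" if "s \<in> {real k..<real k + 1}"
    proof -
      have "?v (y - real k) \<le> ?v (y - s) * (1 + \<bar>(y - real k) - (y - s)\<bar>) powr (3/2)"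
        using peetre_minus[of "3/2" "y - real k" "y - s"] by simp
      also have "\<dots> \<le> ?v (y - s) * 2 powr (3/2)"
        using that by (intro mult_left_mono powr_mono2) auto
      also have "\<dots> \<le> ?v (y - s) * 4" using four by (intro mult_left_mono) auto
      finally show ?thesis by simp
    qed
    then show "ennreal (?v (y - real k)) * indicator {real k..<real k + 1} s \<le> 4 * ennreal (?v (y - s)) * indicator {real k..<real k + 1} s"
      by (auto simp: indicator_def ennreal_mult[symmetric] ennreal_numeral[symmetric] simp del: ennreal_numeral intro!: ennreal_leI)
  qed
  also have "\<dots> = (\<integral>\<^sup>+s. (\<Sum>k<m. 4 * ennreal (?v (y - s)) * indicator {real k..<real k + 1} s) \<partial>lborel)"
    by (rule nn_integral_sum[symmetric]) auto
  also have "\<dots> \<le> (\<integral>\<^sup>+s. 4 * ennreal (?v (y - s)) \<partial>lborel)"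
  proof (intro nn_integral_mono)
    fix s :: real
    have "(\<Sum>k<m. indicator {real k..<real k + 1} s) \<le> (1::ennreal)"
    proof -
      have "(\<Sum>k<m. indicator {real k..<real k + 1} s :: ennreal) \<le> (\<Sum>k<m. if k = nat \<lfloor>s\<rfloor> then 1 else 0)"
      proof (intro sum_mono)
        fix k
        have aux: "(indicator I s :: ennreal) \<le> (if P then 1 else 0)" if "s \<in> I \<Longrightarrow> P" for I P
          using that by (cases "s \<in> I") auto
        show "(indicator {real k..<real k + 1} s :: ennreal) \<le> (if k = nat \<lfloor>s\<rfloor> then 1 else 0)"
        proof (rule aux)
          assume "s \<in> {real k..<real k + 1}"
          then have "\<lfloor>s\<rfloor> = int k" by (intro floor_unique) auto
          then show "k = nat \<lfloor>s\<rfloor>" by simp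
        qed
      qed
      also have "\<dots> \<le> 1" by (simp add: sum.delta)
      finally show ?thesis .
    qed
    then have "4 * ennreal (?v (y - s)) * (\<Sum>k<m. indicator {real k..<real k + 1} s) \<le> 4 * ennreal (?v (y - s)) * 1"
      by (intro mult_left_mono) auto
    then show "(\<Sum>k<m. 4 * ennreal (?v (y - s)) * indicator {real k..<real k + 1} s) \<le> 4 * ennreal (?v (y - s))"
      by (simp add: sum_distrib_left)
  qed
  also have "\<dots> = 4 * (\<integral>\<^sup>+s. ennreal (?v (y - s)) \<partial>lborel)" by (rule nn_integral_cmult) auto
  also have "(\<integral>\<^sup>+s. ennreal (?v (y - s)) \<partial>lborel) = (\<integral>\<^sup>+s. ennreal (?v s) \<partial>lborel)"
    by (subst (2) nn_integral_real_affine[where c="-1" and t=y]) auto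
  also have "4 * \<dots> = ennreal 16" by (simp add: nn_integral_weight)
  finally show ?thesis by (subst (asm) ennreal_le_iff) auto
qed

text \<open>Gauge integrals make the measurability of \<open>\<Phi>''\<close> irrelevant in the following integration by parts.\<close>

lemma fourier_decay:
  fixes \<Phi> \<Phi>' \<Phi>'' :: "real \<Rightarrow> complex" and K z :: real
  assumes d1: "\<And>s. (\<Phi> has_vector_derivative \<Phi>' s) (at s)"
    and d2: "\<And>s. (\<Phi>' has_vector_derivative \<Phi>'' s) (at s)"
    and b0: "\<And>s. cmod (\<Phi> s) \<le> K * exp (- s\<^sup>2 / 4)"
    and b1: "\<And>s. cmod (\<Phi>' s) \<le> K * exp (- s\<^sup>2 / 4)"
    and b2: "\<And>s. cmod (\<Phi>'' s) \<le> K * exp (- s\<^sup>2 / 4)"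
  shows "cmod (LINT s|lborel. iexp (s * z) * \<Phi> s) \<le> 8 * K / (1 + z\<^sup>2)"
    and "integrable lborel \<Phi>"
proof -
  have "(\<lambda>s. exp (- s\<^sup>2 / 4)) = (\<lambda>s. sqrt (4 * pi) * normal_density 0 (sqrt 2) s)"
    by (auto simp: normal_density_def fun_eq_iff)
  then have gi: "has_bochner_integral lborel (\<lambda>s::real. exp (- s\<^sup>2 / 4)) (sqrt (4 * pi))"
    using integrable_normal_density[of "sqrt 2" 0] integral_normal_density[of "sqrt 2" 0]
    by (simp add: has_bochner_integral_iff)
  have K: "0 \<le> K" using b0[of 0] norm_ge_zero[of "\<Phi> 0"] by (simp del: norm_ge_zero)
  have sp: "sqrt (4 * pi) \<le> 4"
    using pi_less_4 by (intro real_le_lsqrt) auto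
  have cont: "isCont \<Phi> s" for s
    using has_vector_derivative_continuous[OF d1] .
  then have [measurable]: "\<Phi> \<in> borel_measurable borel"
    by (intro borel_measurable_continuous_onI continuous_at_imp_continuous_on) auto
  show int: "integrable lborel \<Phi>"
    by (rule Bochner_Integration.integrable_bound[of _ "\<lambda>s. K * exp (- s\<^sup>2 / 4)"])
       (use gi b0 K in \<open>auto simp: has_bochner_integral_iff\<close>)
  let ?I = "\<lambda>R. integral {- R..R} (\<lambda>s. iexp (s * z) * \<Phi> s)"
  let ?J = "LINT s|lborel. iexp (s * z) * \<Phi> s"
  have intz: "integrable lborel (\<lambda>s. iexp (s * z) * \<Phi> s)"
    by (rule Bochner_Integration.integrable_bound[OF int]) (auto simp: norm_mult)
  have set_int: "set_integrable lborel {- R..R} (\<lambda>s. iexp (s * z) * \<Phi> s)" for R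
    using intz by (rule integrable_mult_indicator[folded set_integrable_def, rotated]) simp
  have lim: "(?I \<longlongrightarrow> ?J) at_top"
  proof -
    have "((\<lambda>R. LINT s:{- R..R}|lborel. iexp (s * z) * \<Phi> s) \<longlongrightarrow> ?J) at_top"
      unfolding set_lebesgue_integral_def
    proof (rule integral_dominated_convergence_at_top[where w="\<lambda>s. cmod (iexp (s * z) * \<Phi> s)"])
      show "AE s in lborel. ((\<lambda>R. indicat_real {- R..R} s *\<^sub>R (iexp (s * z) * \<Phi> s)) \<longlongrightarrow> iexp (s * z) * \<Phi> s) at_top"
      proof (intro AE_I2 tendsto_eventually)
        fix s :: real
        show "eventually (\<lambda>R. indicat_real {- R..R} s *\<^sub>R (iexp (s * z) * \<Phi> s) = iexp (s * z) * \<Phi> s) at_top"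
          using eventually_ge_at_top[of "\<bar>s\<bar>"] by eventually_elim (auto simp: indicator_def)
      qed
    qed (use intz in \<open>auto intro!: always_eventually simp: indicator_def\<close>)
    then show ?thesis unfolding set_borel_integral_eq_integral(2)[OF set_int] .
  qed
  have J0: "cmod ?J \<le> 4 * K"
  proof -
    have "cmod ?J \<le> (LINT s|lborel. K * exp (- s\<^sup>2 / 4))"
      using gi b0 by (intro Bochner_Integration.integral_norm_bound_integral intz) (auto simp: norm_mult has_bochner_integral_iff)
    also have "\<dots> = K * sqrt (4 * pi)" using gi by (simp add: has_bochner_integral_iff)
    also have "\<dots> \<le> K * 4" using K sp by (intro mult_left_mono)
    finally show ?thesis by simp
  qed
  have bound: "z\<^sup>2 * cmod (?I R) \<le> 4 * K + 2 * (1 + \<bar>z\<bar>) * K * exp (- R\<^sup>2 / 4)" if "0 \<le> R" for R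
  proof -
    \<comment> \<open>\<open>?D\<close> collects the boundary terms of two integrations by parts.
      Its derivative is \<open>iexp (s * z) * (\<Phi>'' s + z\<^sup>2 * \<Phi> s)\<close>, so
      \<open>z\<^sup>2\<close> times the wanted integral equals boundary terms minus an integral of
      \<open>\<Phi>''\<close>.\<close>
    let ?D = "\<lambda>s. iexp (s * z) * \<Phi>' s - \<i> * z * iexp (s * z) * \<Phi> s"
    have der: "(?D has_vector_derivative (iexp (s * z) * \<Phi>'' s + z\<^sup>2 * (iexp (s * z) * \<Phi> s))) (at s within {- R..R})" for s
    proof -
      define e where "e = (\<lambda>s. iexp (s * z))"
      have "((\<lambda>s. s * z) has_vector_derivative z) (at s)"
        unfolding has_real_derivative_iff_has_vector_derivative[symmetric]
        by (auto intro!: derivative_eq_intros)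
      from vector_diff_chain_at[OF this has_vector_derivative_iexp]
      have "(e has_vector_derivative z *\<^sub>R (\<i> * e s)) (at s)" by (simp add: o_def e_def)
      note [derivative_intros] = this d1 d2
      have "((\<lambda>s. e s * \<Phi>' s - \<i> * z * e s * \<Phi> s) has_vector_derivative
          (e s * \<Phi>'' s + z\<^sup>2 * (e s * \<Phi> s))) (at s within {- R..R})"
        by (rule has_vector_derivative_at_within)
           (auto intro!: derivative_eq_intros simp: scaleR_conv_of_real algebra_simps power2_eq_square)
      then show ?thesis unfolding e_def .
    qed
    have ftc: "((\<lambda>s. iexp (s * z) * \<Phi>'' s + z\<^sup>2 * (iexp (s * z) * \<Phi> s)) has_integral (?D R - ?D (- R))) {- R..R}"
      using that der by (intro fundamental_theorem_of_calculus) auto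
    have iz: "(\<lambda>s. z\<^sup>2 * (iexp (s * z) * \<Phi> s)) integrable_on {- R..R}"
      using cont by (intro integrable_continuous_interval continuous_intros continuous_at_imp_continuous_on) auto
    have i2: "(\<lambda>s. iexp (s * z) * \<Phi>'' s) integrable_on {- R..R}"
      using integrable_diff[OF has_integral_integrable[OF ftc] iz] by simp
    have eq: "z\<^sup>2 * ?I R = (?D R - ?D (- R)) - integral {- R..R} (\<lambda>s. iexp (s * z) * \<Phi>'' s)"
      using integral_unique[OF ftc] integral_add[OF i2 iz] by simp
    have "z\<^sup>2 * cmod (?I R) = cmod (z\<^sup>2 * ?I R)" by (simp add: norm_mult norm_power)
    also have "\<dots> = cmod ((?D R - ?D (- R)) - integral {- R..R} (\<lambda>s. iexp (s * z) * \<Phi>'' s))"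
      by (simp only: eq)
    also have "\<dots> \<le> cmod (?D R) + cmod (?D (- R)) + cmod (integral {- R..R} (\<lambda>s. iexp (s * z) * \<Phi>'' s))"
      by (rule order_trans[OF norm_triangle_ineq4 add_right_mono[OF norm_triangle_ineq4]])
    also have "cmod (integral {- R..R} (\<lambda>s. iexp (s * z) * \<Phi>'' s)) \<le> integral {- R..R} (\<lambda>s. K * exp (- s\<^sup>2 / 4))"
      using b2 by (intro Henstock_Kurzweil_Integration.integral_norm_bound_integral i2)
         (auto simp: norm_mult intro!: integrable_continuous_interval continuous_intros)
    also have "\<dots> = (LINT s:{- R..R}|lborel. K * exp (- s\<^sup>2 / 4))"
      using gi by (intro set_borel_integral_eq_integral(2)[symmetric]
        integrable_mult_indicator[folded set_integrable_def]) (auto simp: has_bochner_integral_iff)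
    also have "\<dots> \<le> (LINT s|lborel. K * exp (- s\<^sup>2 / 4))"
      unfolding set_lebesgue_integral_def using gi K
      by (intro integral_mono integrable_mult_indicator) (auto simp: has_bochner_integral_iff indicator_def)
    also have "\<dots> = K * sqrt (4 * pi)" using gi by (simp add: has_bochner_integral_iff)
    also have "\<dots> \<le> K * 4" using K sp by (intro mult_left_mono)
    finally have *: "z\<^sup>2 * cmod (?I R) \<le> cmod (?D R) + cmod (?D (- R)) + K * 4" by simp
    have D: "cmod (?D r) \<le> (1 + \<bar>z\<bar>) * K * exp (- r\<^sup>2 / 4)" for r
    proof -
      have "cmod (?D r) \<le> cmod (\<Phi>' r) + \<bar>z\<bar> * cmod (\<Phi> r)"
        by (rule order_trans[OF norm_triangle_ineq4]) (simp add: norm_mult)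
      also have "\<dots> \<le> K * exp (- r\<^sup>2 / 4) + \<bar>z\<bar> * (K * exp (- r\<^sup>2 / 4))"
        by (intro add_mono mult_left_mono b0 b1) auto
      finally show ?thesis by (simp add: algebra_simps)
    qed
    have "2 * (1 + \<bar>z\<bar>) * K * exp (- R\<^sup>2 / 4) = (1 + \<bar>z\<bar>) * K * exp (- R\<^sup>2 / 4) + (1 + \<bar>z\<bar>) * K * exp (- R\<^sup>2 / 4)"
      by (simp add: algebra_simps)
    then show ?thesis using * D[of R] D[of "- R", unfolded power2_minus] by linarith
  qed
  \<comment> \<open>The boundary terms vanish in the limit through their Gaussian factor. Adding the
    trivial bound \<open>J0\<close> then gives the denominator \<open>1 + z\<^sup>2\<close> and the
    constant 8 = 4 + 4.\<close>
  have "z\<^sup>2 * cmod ?J \<le> 4 * K"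
  proof (rule tendsto_le)
    show "((\<lambda>R. z\<^sup>2 * cmod (?I R)) \<longlongrightarrow> z\<^sup>2 * cmod ?J) at_top" by (intro tendsto_intros lim)
    have "((\<lambda>R::real. exp (- R\<^sup>2 / 4)) \<longlongrightarrow> 0) at_top" by real_asymp
    then have "((\<lambda>R. 4 * K + 2 * (1 + \<bar>z\<bar>) * K * exp (- R\<^sup>2 / 4)) \<longlongrightarrow> 4 * K + 2 * (1 + \<bar>z\<bar>) * K * 0) at_top"
      by (intro tendsto_intros)
    then show "((\<lambda>R. 4 * K + 2 * (1 + \<bar>z\<bar>) * K * exp (- R\<^sup>2 / 4)) \<longlongrightarrow> 4 * K) at_top" by simp
    show "eventually (\<lambda>R. z\<^sup>2 * cmod (?I R) \<le> 4 * K + 2 * (1 + \<bar>z\<bar>) * K * exp (- R\<^sup>2 / 4)) at_top"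
      using eventually_ge_at_top[of 0] by eventually_elim (rule bound)
  qed auto
  with J0 have "(1 + z\<^sup>2) * cmod ?J \<le> 8 * K" by (simp add: algebra_simps)
  then show "cmod ?J \<le> 8 * K / (1 + z\<^sup>2)"
    by (subst pos_le_divide_eq) (auto simp: mult.commute add_pos_nonneg)
qed

section \<open>Gaussian bumps\<close>

lemma std_normal_density_le: "std_normal_density s \<le> exp (- s\<^sup>2 / 2)"
proof -
  have "1 \<le> sqrt (2 * pi)" using pi_gt3 by (simp add: real_le_rsqrt)
  then show ?thesis by (simp add: std_normal_density_def divide_le_eq)
qed

text \<open>Two derivatives of the Gaussian cost a polynomial of degree 2, whence
  \<open>M + 2\<close>: the coefficients \<open>1\<close>, \<open>1 + \<bar>s\<bar>\<close> and
  \<open>1 + 2 * \<bar>s\<bar> + \<bar>s\<^sup>2 - 1\<bar>\<close> of the product rule all lie below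
  \<open>2 * (1 + \<bar>s\<bar>)\<^sup>2\<close>. The 16 is this 2 times the 8 of
  \<open>fourier_decay\<close>.\<close>

lemma gauss_fourier_decay:
  fixes H H' H'' :: "real \<Rightarrow> complex" and K z :: real
  assumes d1: "\<And>s. (H has_vector_derivative H' s) (at s)"
    and d2: "\<And>s. (H' has_vector_derivative H'' s) (at s)"
    and b: "\<And>s. cmod (H s) \<le> K * (1 + \<bar>s\<bar>) ^ M" "\<And>s. cmod (H' s) \<le> K * (1 + \<bar>s\<bar>) ^ M"
      "\<And>s. cmod (H'' s) \<le> K * (1 + \<bar>s\<bar>) ^ M"
  shows "cmod (LINT s|lborel. iexp (s * z) * (std_normal_density s * H s))
    \<le> (16 * fact (M + 2) * exp 2) * K / (1 + z\<^sup>2)"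
proof -
  let ?g = "std_normal_density"
  define c where "c = 1 / sqrt (2 * pi)"
  have g: "?g = (\<lambda>s. c * exp (- s\<^sup>2 / 2))" by (simp add: std_normal_density_def c_def fun_eq_iff)
  have dg: "((\<lambda>s. complex_of_real (?g s)) has_vector_derivative complex_of_real (- s * ?g s)) (at s)" for s
  proof -
    have "(?g has_real_derivative - s * ?g s) (at s)"
      unfolding g by (auto intro!: derivative_eq_intros)
    then show ?thesis
      using has_vector_derivative_of_real has_real_derivative_iff_has_vector_derivative by blast
  qed
  have dsg: "((\<lambda>s. complex_of_real (- s * ?g s)) has_vector_derivative complex_of_real ((s\<^sup>2 - 1) * ?g s)) (at s)" for s
  proof -
    have "((\<lambda>s. - s * ?g s) has_real_derivative (s\<^sup>2 - 1) * ?g s) (at s)"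
      unfolding g by (auto intro!: derivative_eq_intros simp: field_simps power2_eq_square)
    then show ?thesis
      using has_vector_derivative_of_real has_real_derivative_iff_has_vector_derivative by blast
  qed
  note [derivative_intros] = dg dsg d1 d2
  let ?\<Phi>1 = "\<lambda>s. of_real (?g s) * H' s + of_real (- s * ?g s) * H s"
  let ?\<Phi>2 = "\<lambda>s. (of_real (?g s) * H'' s + of_real (- s * ?g s) * H' s) +
     (of_real (- s * ?g s) * H' s + of_real ((s\<^sup>2 - 1) * ?g s) * H s)"
  have K: "0 \<le> K" using b(1)[of 0] norm_ge_zero[of "H 0"] by (simp del: norm_ge_zero)
  have gb: "q * ?g s * (K * (1 + \<bar>s\<bar>) ^ M) \<le> 2 * fact (M + 2) * exp 2 * K * exp (- s\<^sup>2 / 4)"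
    if "0 \<le> q" "q \<le> 2 * (1 + \<bar>s\<bar>)\<^sup>2" for q s
  proof -
    have "q * ?g s * (K * (1 + \<bar>s\<bar>) ^ M) \<le> 2 * (1 + \<bar>s\<bar>)\<^sup>2 * exp (- s\<^sup>2 / 2) * (K * (1 + \<bar>s\<bar>) ^ M)"
      using that K std_normal_density_le[of s] by (intro mult_right_mono mult_mono) auto
    also have "\<dots> = 2 * K * ((1 + \<bar>s\<bar>) ^ (M + 2) * exp (- s\<^sup>2 / 2))"
      by (simp add: power_add power2_eq_square)
    also have "\<dots> \<le> 2 * K * (fact (M + 2) * exp 2 * exp (- s\<^sup>2 / 4))"
      using K by (intro mult_left_mono power_gauss_le) auto
    finally show ?thesis by (simp add: mult_ac)
  qed
  have quad: "1 \<le> 2 * (1 + \<bar>s\<bar>)\<^sup>2" "1 + \<bar>s\<bar> \<le> 2 * (1 + \<bar>s\<bar>)\<^sup>2" "1 + 2 * \<bar>s\<bar> + \<bar>s\<^sup>2 - 1\<bar> \<le> 2 * (1 + \<bar>s\<bar>)\<^sup>2" for s :: real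
    by (auto simp: power2_eq_square algebra_simps abs_if mult_nonneg_nonneg zero_le_square)
  have "cmod (LINT s|lborel. iexp (s * z) * (?g s * H s)) \<le> 8 * (2 * fact (M + 2) * exp 2 * K) / (1 + z\<^sup>2)"
  proof (rule fourier_decay[where \<Phi>'="?\<Phi>1" and \<Phi>''="?\<Phi>2"])
    fix s
    show "((\<lambda>s. of_real (?g s) * H s) has_vector_derivative ?\<Phi>1 s) (at s)"
      by (rule derivative_intros)+
    show "(?\<Phi>1 has_vector_derivative ?\<Phi>2 s) (at s)"
      by (rule derivative_intros)+
    have "cmod (of_real (?g s) * H s) \<le> 1 * ?g s * (K * (1 + \<bar>s\<bar>) ^ M)"
      using b(1)[of s] by (simp add: norm_mult mult_left_mono)
    also note gb[OF _ quad(1)]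
    finally show "cmod (of_real (?g s) * H s) \<le> 2 * fact (M + 2) * exp 2 * K * exp (- s\<^sup>2 / 4)" by simp
    have "cmod (?\<Phi>1 s) \<le> ?g s * cmod (H' s) + \<bar>s\<bar> * ?g s * cmod (H s)"
      by (rule order_trans[OF norm_triangle_ineq]) (simp add: norm_mult)
    also have "\<dots> \<le> ?g s * (K * (1 + \<bar>s\<bar>) ^ M) + \<bar>s\<bar> * ?g s * (K * (1 + \<bar>s\<bar>) ^ M)"
      by (intro add_mono mult_left_mono b) auto
    also have "\<dots> = (1 + \<bar>s\<bar>) * ?g s * (K * (1 + \<bar>s\<bar>) ^ M)" by (simp add: algebra_simps)
    also note gb[OF _ quad(2)]
    finally show "cmod (?\<Phi>1 s) \<le> 2 * fact (M + 2) * exp 2 * K * exp (- s\<^sup>2 / 4)" by simp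
    have "cmod (?\<Phi>2 s) \<le> (?g s * cmod (H'' s) + \<bar>s\<bar> * ?g s * cmod (H' s)) +
       (\<bar>s\<bar> * ?g s * cmod (H' s) + \<bar>s\<^sup>2 - 1\<bar> * ?g s * cmod (H s))"
      by (intro order_trans[OF norm_triangle_ineq] add_mono; simp add: norm_mult abs_mult del: of_real_diff of_real_mult)
    also have "\<dots> \<le> (?g s * (K * (1 + \<bar>s\<bar>) ^ M) + \<bar>s\<bar> * ?g s * (K * (1 + \<bar>s\<bar>) ^ M)) +
       (\<bar>s\<bar> * ?g s * (K * (1 + \<bar>s\<bar>) ^ M) + \<bar>s\<^sup>2 - 1\<bar> * ?g s * (K * (1 + \<bar>s\<bar>) ^ M))"
      by (intro add_mono mult_left_mono b) auto
    also have "\<dots> = (1 + 2 * \<bar>s\<bar> + \<bar>s\<^sup>2 - 1\<bar>) * ?g s * (K * (1 + \<bar>s\<bar>) ^ M)" by (simp add: algebra_simps)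
    also note gb[OF _ quad(3)]
    finally show "cmod (?\<Phi>2 s) \<le> 2 * fact (M + 2) * exp 2 * K * exp (- s\<^sup>2 / 4)" by simp
  qed
  also have "8 * (2 * fact (M + 2) * exp 2 * K) = (16 * fact (M + 2) * exp 2) * K"
    by simp
  finally show ?thesis .
qed

text \<open>Convolving a Fourier integral with a probability measure multiplies its amplitude by the
  characteristic function at the negated frequency. The frequency map \<open>\<rho>\<close> will be
  \<open>s / h\<close> for bumps, \<open>s + b\<close> for waves and \<open>s * h\<close> for
  smoothed boxes.\<close>

lemma conv_inversion:
  fixes A :: "real \<Rightarrow> complex" and \<rho> :: "real \<Rightarrow> real" and \<epsilon> :: "real measure"
  assumes "prob_space \<epsilon>" and [measurable_cong]: "sets \<epsilon> = sets borel"
    and [measurable]: "A \<in> borel_measurable borel" "\<rho> \<in> borel_measurable borel" and A: "\<And>s. cmod (A s) \<le> B"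
  shows "(LINT y|\<epsilon>. LINT s|lborel. iexp (\<rho> s * (x - y)) * (std_normal_density s * A s))
    = (LINT s|lborel. iexp (\<rho> s * x) * (std_normal_density s * (A s * (LINT y|\<epsilon>. iexp (- \<rho> s * y)))))"
proof -
  interpret E: prob_space \<epsilon> by fact
  interpret pair_sigma_finite lborel \<epsilon> by unfold_locales
  have B: "0 \<le> B" using A[of 0] norm_ge_zero[of "A 0"] by linarith
  have bd: "cmod (iexp (\<rho> s * (x - y)) * (std_normal_density s * A s)) \<le> std_normal_density s * B" for s y
    using A[of s] by (simp add: norm_mult mult_left_mono)
  have "integrable (lborel \<Otimes>\<^sub>M \<epsilon>) (\<lambda>(s, y). iexp (\<rho> s * (x - y)) * (std_normal_density s * A s))"
  proof (rule Fubini_integrable)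
    show "integrable lborel (\<lambda>s. LINT y|\<epsilon>. cmod (case (s, y) of (s, y) \<Rightarrow> iexp (\<rho> s * (x - y)) * (std_normal_density s * A s)))"
    proof (rule Bochner_Integration.integrable_bound[of _ "\<lambda>s. std_normal_density s * B"])
      show "AE s in lborel. norm (LINT y|\<epsilon>. cmod (case (s, y) of (s, y) \<Rightarrow> iexp (\<rho> s * (x - y)) * (std_normal_density s * A s)))
          \<le> norm (std_normal_density s * B)"
        using B A by (auto simp: norm_mult E.prob_space abs_mult intro!: mult_left_mono)
    qed auto
    show "AE s in lborel. integrable \<epsilon> (\<lambda>y. case (s, y) of (s, y) \<Rightarrow> iexp (\<rho> s * (x - y)) * (std_normal_density s * A s))"
    proof (rule AE_I2)
      fix s
      show "integrable \<epsilon> (\<lambda>y. case (s, y) of (s, y) \<Rightarrow> iexp (\<rho> s * (x - y)) * (std_normal_density s * A s))"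
        unfolding prod.case by (rule E.integrable_const_bound[of _ "std_normal_density s * B"]) (use bd in blast, measurable)
    qed
  qed auto
  from Fubini_integral[OF this]
  have "(LINT y|\<epsilon>. LINT s|lborel. iexp (\<rho> s * (x - y)) * (std_normal_density s * A s))
    = (LINT s|lborel. LINT y|\<epsilon>. iexp (\<rho> s * (x - y)) * (std_normal_density s * A s))" by simp
  also have "\<dots> = (LINT s|lborel. iexp (\<rho> s * x) * (std_normal_density s * (A s * (LINT y|\<epsilon>. iexp (- \<rho> s * y)))))"
  proof (intro Bochner_Integration.integral_cong refl)
    fix s
    have "iexp (\<rho> s * (x - y)) * (std_normal_density s * A s) = (iexp (\<rho> s * x) * (std_normal_density s * A s)) * iexp (- \<rho> s * y)" for y
    proof -
      have "iexp (\<rho> s * (x - y)) = iexp (\<rho> s * x) * iexp (- \<rho> s * y)"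
        by (simp add: exp_add[symmetric] right_diff_distrib)
      then show ?thesis by (simp only: mult_ac)
    qed
    then show "(LINT y|\<epsilon>. iexp (\<rho> s * (x - y)) * (std_normal_density s * A s)) =
       iexp (\<rho> s * x) * (std_normal_density s * (A s * (LINT y|\<epsilon>. iexp (- \<rho> s * y))))"
      by (simp only: integral_mult_right_zero mult.assoc)
  qed
  finally show ?thesis .
qed

text \<open>
  The \<open>N\<close>-th difference makes the Fourier transform vanish to order \<open>N\<close> at \<open>0\<close>. This compensates
  the bounds \<open>\<bar>t\<bar> powr (- (\<beta> + l))\<close> for the error density, which after rescaling are singular there.
\<close>

definition bump :: "nat \<Rightarrow> real \<Rightarrow> real" where
  "bump N z = (\<Sum>j\<le>N. (- 1) ^ j * real (N choose j) * std_normal_density (z + real j))"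

lemma measurable_bump [measurable]: "bump N \<in> borel_measurable borel"
  unfolding bump_def by measurable

lemma isCont_bump: "isCont (bump N) z"
  unfolding bump_def std_normal_density_def by (intro continuous_intros) auto

lemma binomial_iexp: "(\<Sum>j\<le>N. (- 1) ^ j * of_nat (N choose j) * iexp (s * real j)) = (1 - iexp s) ^ N"
proof -
  have "(1 - iexp s) ^ N = (- iexp s + 1) ^ N" by simp
  also have "\<dots> = (\<Sum>j\<le>N. of_nat (N choose j) * (- iexp s) ^ j * 1 ^ (N - j))" by (rule binomial_ring)
  also have "\<dots> = (\<Sum>j\<le>N. (- 1) ^ j * of_nat (N choose j) * iexp (s * real j))"
    by (intro sum.cong refl) (simp add: power_minus[of "iexp s"] exp_of_nat_mult[symmetric] mult_ac)
  finally show ?thesis by simp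
qed

lemma cmod_one_minus_iexp_le: "cmod (1 - iexp s) \<le> \<bar>s\<bar>" "cmod (1 - iexp s) \<le> 2"
proof -
  show "cmod (1 - iexp s) \<le> \<bar>s\<bar>"
    using iexp_approx1[of s 0] by (simp add: norm_minus_commute)
  show "cmod (1 - iexp s) \<le> 2"
    using norm_triangle_ineq4[of 1 "iexp s"] by simp
qed

lemma integrable_std_normal_iexp: "integrable lborel (\<lambda>s. iexp (s * z) * std_normal_density s)"
  by (rule Bochner_Integration.integrable_bound[of _ std_normal_density]) (auto simp: norm_mult)

text \<open>Translating the Gaussian by \<open>j\<close> multiplies its spectrum by
  \<open>iexp (s * real j)\<close>, and the alternating binomial sum of these phases is
  \<open>(1 - iexp s) ^ N\<close>, which has a zero of order \<open>N\<close> at the origin.\<close>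

lemma bump_inversion:
  "complex_of_real (bump N z) = (1 / sqrt (2 * pi)) * (LINT s|lborel. iexp (s * z) * (std_normal_density s * (1 - iexp s) ^ N))"
proof -
  have "complex_of_real (bump N z) = (\<Sum>j\<le>N. (- 1) ^ j * of_nat (N choose j) * complex_of_real (std_normal_density (z + real j)))"
    by (simp add: bump_def)
  also have "\<dots> = (1 / sqrt (2 * pi)) * (\<Sum>j\<le>N. (- 1) ^ j * of_nat (N choose j) * (LINT s|lborel. iexp (s * (z + real j)) * std_normal_density s))"
    unfolding sum_distrib_left by (intro sum.cong refl) (subst std_normal_inversion, simp only: mult_ac)
  also have "(\<Sum>j\<le>N. (- 1) ^ j * of_nat (N choose j) * (LINT s|lborel. iexp (s * (z + real j)) * std_normal_density s))
     = (LINT s|lborel. (\<Sum>j\<le>N. ((- 1) ^ j * of_nat (N choose j)) * (iexp (s * (z + real j)) * std_normal_density s)))"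
    by (subst Bochner_Integration.integral_sum)
       (intro integrable_mult_right integrable_std_normal_iexp, simp only: integral_mult_right_zero)
  also have "\<dots> = (LINT s|lborel. iexp (s * z) * (std_normal_density s * (1 - iexp s) ^ N))"
    unfolding binomial_iexp[symmetric] sum_distrib_left
    by (intro Bochner_Integration.integral_cong refl sum.cong) (simp add: distrib_left exp_add mult_ac)
  finally show ?thesis .
qed

text \<open>The exponent 4 is \<open>5/2 + 3/2\<close>: one part will match the weight of the base
  density, the other is summable over the blocks.\<close>

lemma bump_le:
  obtains C where "0 \<le> C" "\<And>z. \<bar>bump N z\<bar> \<le> C * (1 + \<bar>z\<bar>) powr (- 4)"
proof -
  define C where "C = (\<Sum>j\<le>N. real (N choose j) * (1 + real j) powr 4 * (fact 4 * exp 2))"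
  have g: "std_normal_density u \<le> fact 4 * exp 2 * (1 + \<bar>u\<bar>) powr (- 4)" for u
  proof -
    have "(1 + \<bar>u\<bar>) ^ 4 * std_normal_density u \<le> (1 + \<bar>u\<bar>) ^ 4 * exp (- u\<^sup>2 / 2)"
      by (intro mult_left_mono std_normal_density_le) auto
    also have "\<dots> \<le> fact 4 * exp 2 * exp (- u\<^sup>2 / 4)" by (rule power_gauss_le)
    also have "\<dots> \<le> fact 4 * exp 2 * 1" by (intro mult_left_mono) auto
    finally have "(1 + \<bar>u\<bar>) powr 4 * std_normal_density u \<le> fact 4 * exp 2"
      by (simp add: powr_numeral)
    then show ?thesis by (simp add: powr_minus field_simps)
  qed
  have "\<bar>bump N z\<bar> \<le> C * (1 + \<bar>z\<bar>) powr (- 4)" for z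
  proof -
    have "\<bar>bump N z\<bar> \<le> (\<Sum>j\<le>N. real (N choose j) * std_normal_density (z + real j))"
      unfolding bump_def by (rule order_trans[OF sum_abs]) (simp add: abs_mult power_abs)
    also have "\<dots> \<le> (\<Sum>j\<le>N. real (N choose j) * (fact 4 * exp 2 * ((1 + \<bar>z\<bar>) powr (- 4) * (1 + real j) powr 4)))"
    proof (intro sum_mono mult_left_mono)
      fix j
      have "std_normal_density (z + real j) \<le> fact 4 * exp 2 * (1 + \<bar>z + real j\<bar>) powr (- 4)" by (rule g)
      also have "(1 + \<bar>z + real j\<bar>) powr (- 4) \<le> (1 + \<bar>z\<bar>) powr (- 4) * (1 + real j) powr 4"
        using peetre_minus[of 4 "z + real j" z] by simp
      finally show "std_normal_density (z + real j) \<le> fact 4 * exp 2 * ((1 + \<bar>z\<bar>) powr (- 4) * (1 + real j) powr 4)" by simp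
    qed auto
    also have "\<dots> = C * (1 + \<bar>z\<bar>) powr (- 4)"
      unfolding C_def sum_distrib_right by (intro sum.cong refl) (simp add: mult_ac)
    finally show ?thesis .
  qed
  moreover have "0 \<le> C" unfolding C_def by (intro sum_nonneg) auto
  ultimately show thesis using that by blast
qed

lemma integrable_std_normal_shift: "integrable lborel (\<lambda>x. std_normal_density (x + a))"
  using lborel_integrable_real_affine[of std_normal_density 1 a] by (simp add: add.commute)

lemma integrable_bump: "integrable lborel (bump N)"
  unfolding bump_def
  by (intro Bochner_Integration.integrable_sum integrable_mult_right integrable_std_normal_shift)

lemma fourier_affine:
  assumes h: "0 < h" and f: "f \<in> borel_measurable borel"
  shows "fourier (\<lambda>x. f (x / h - c)) t = h * iexp (t * h * c) * fourier f (t * h)"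
proof -
  have "fourier (\<lambda>x. f (x / h - c)) t = \<bar>h\<bar> *\<^sub>R (LINT u|lborel. iexp (t * (h * c + h * u)) * f ((h * c + h * u) / h - c))"
    unfolding fourier_def inner_real_def using h by (intro lborel_integral_real_affine) auto
  also have "\<dots> = h *\<^sub>R (LINT u|lborel. iexp (t * h * c) * (iexp (t * h * u) * f u))"
    using h by (simp add: add_divide_distrib distrib_left exp_add mult_ac)
  also have "\<dots> = h * iexp (t * h * c) * fourier f (t * h)"
    unfolding integral_mult_right_zero fourier_def inner_real_def by (simp add: scaleR_conv_of_real)
  finally show ?thesis .
qed

lemma fourier_bump: "fourier (bump N) t = (1 - iexp (- t)) ^ N * exp (- t\<^sup>2 / 2)"
proof -
  have "fourier (bump N) t = (\<Sum>j\<le>N. fourier (\<lambda>x. (- 1) ^ j * real (N choose j) * std_normal_density (x + real j)) t)"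
    unfolding bump_def by (intro fourier_sum integrable_mult_right integrable_std_normal_shift)
  also have "\<dots> = (\<Sum>j\<le>N. (- 1) ^ j * of_nat (N choose j) * iexp (- t * real j) * exp (- t\<^sup>2 / 2))"
    unfolding fourier_cmult
    using fourier_affine[of 1 std_normal_density "- real _" t] by (intro sum.cong refl) (simp add: fourier_std_normal)
  also have "\<dots> = (1 - iexp (- t)) ^ N * exp (- t\<^sup>2 / 2)"
    by (simp only: sum_distrib_right[symmetric] binomial_iexp)
  finally show ?thesis .
qed

lemma bump_nonzero: "\<exists>z. bump N z \<noteq> 0"
proof (rule ccontr)
  assume "\<nexists>z. bump N z \<noteq> 0"
  then have "bump N = (\<lambda>z. 0)" by auto
  \<comment> \<open>At frequency \<open>pi\<close> the factor \<open>1 - iexp (- t)\<close> equals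
    2, so the transform is plainly nonzero there.\<close>
  then have "fourier (bump N) pi = 0" by (simp add: fourier_def)
  moreover have "iexp (- pi) = - 1"
    unfolding cis_conv_exp[symmetric] by (simp add: complex_eq_iff)
  ultimately show False unfolding fourier_bump by simp
qed

section \<open>Smoothing by the error distribution\<close>

text \<open>The substitution \<open>x = h * (k + z)\<close> produces the factor \<open>h\<close>,
  the gain from localisation in one coordinate. The centre \<open>h * k\<close> lies in the unit
  interval, so the weight in \<open>x\<close> is at most a constant times the same weight in
  \<open>z\<close>, and the exponents combine to \<open>5/2 - 4 = - 3/2\<close>. The constant is 4 *
  8 * 4, from the squared decay, from \<open>2 powr (5/2) \<le> 8\<close>, and from the integral of
  the weight.\<close>

lemma nn_integral_decay_weight:
  fixes u :: "real \<Rightarrow> real"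
  assumes [measurable]: "u \<in> borel_measurable borel"
    and h: "0 < h" "h \<le> 1" and k: "0 \<le> k" "k * h \<le> 1"
    and u: "\<And>x. \<bar>u x\<bar> \<le> K / (1 + (x / h - k)\<^sup>2)"
  shows "(\<integral>\<^sup>+x. ennreal ((u x)\<^sup>2 * (1 + \<bar>x\<bar>) powr (5/2)) \<partial>lborel) \<le> ennreal (128 * K\<^sup>2 * h)"
proof -
  have "(u (h * k + h * z))\<^sup>2 * (1 + \<bar>h * k + h * z\<bar>) powr (5/2) \<le> 32 * K\<^sup>2 * (1 + \<bar>z\<bar>) powr (- (3/2))" for z
  proof -
    have "\<bar>u (h * k + h * z)\<bar> \<le> K / (1 + z\<^sup>2)"
      using u[of "h * k + h * z"] h by (simp add: add_divide_distrib)
    then have "(u (h * k + h * z))\<^sup>2 \<le> (K / (1 + z\<^sup>2))\<^sup>2"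
      by (metis abs_ge_zero power2_abs power_mono)
    also have "\<dots> \<le> K\<^sup>2 * (4 / (1 + \<bar>z\<bar>) ^ 4)"
    proof -
      have "(1 + \<bar>z\<bar>)\<^sup>2 \<le> 2 * (1 + z\<^sup>2)"
        using zero_le_power2[of "\<bar>z\<bar> - 1"] by (simp add: power2_eq_square algebra_simps)
      then have "((1 + \<bar>z\<bar>)\<^sup>2)\<^sup>2 \<le> (2 * (1 + z\<^sup>2))\<^sup>2" by (intro power_mono) auto
      also have "(2 * (1 + z\<^sup>2))\<^sup>2 = 4 * (1 + z\<^sup>2)\<^sup>2" by (subst power_mult_distrib) simp
      finally have "(1 + \<bar>z\<bar>) ^ 4 \<le> 4 * (1 + z\<^sup>2)\<^sup>2" by (simp flip: power_mult)
      moreover have "0 < 1 + z\<^sup>2" by (simp add: add_pos_nonneg)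
      ultimately have "1 / (1 + z\<^sup>2)\<^sup>2 \<le> 4 / (1 + \<bar>z\<bar>) ^ 4" by (simp add: divide_simps)
      then have "K\<^sup>2 * (1 / (1 + z\<^sup>2)\<^sup>2) \<le> K\<^sup>2 * (4 / (1 + \<bar>z\<bar>) ^ 4)" by (intro mult_left_mono) auto
      then show ?thesis by (simp add: power_divide)
    qed
    finally have 1: "(u (h * k + h * z))\<^sup>2 \<le> K\<^sup>2 * (4 / (1 + \<bar>z\<bar>) ^ 4)" .
    have "1 + \<bar>h * k + h * z\<bar> \<le> 1 + (1 + \<bar>z\<bar>)"
      using h k mult_left_le_one_le[of "\<bar>z\<bar>" h] abs_triangle_ineq[of "h * k" "h * z"]
      by (simp add: abs_mult mult.commute)
    also have "\<dots> \<le> 2 * (1 + \<bar>z\<bar>)" by simp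
    finally have "(1 + \<bar>h * k + h * z\<bar>) powr (5/2) \<le> (2 * (1 + \<bar>z\<bar>)) powr (5/2)"
      by (intro powr_mono2) auto
    also have "\<dots> = 2 powr (5/2) * (1 + \<bar>z\<bar>) powr (5/2)" by (rule powr_mult)
    also have "\<dots> \<le> 8 * (1 + \<bar>z\<bar>) powr (5/2)"
      using powr_mono[of "5/2" 3 "2::real"] by (intro mult_right_mono) (simp_all add: powr_numeral)
    finally have "(u (h * k + h * z))\<^sup>2 * (1 + \<bar>h * k + h * z\<bar>) powr (5/2)
      \<le> (K\<^sup>2 * (4 / (1 + \<bar>z\<bar>) ^ 4)) * (8 * (1 + \<bar>z\<bar>) powr (5/2))"
      by (intro mult_mono 1) auto
    also have "\<dots> = 32 * K\<^sup>2 * ((1 + \<bar>z\<bar>) powr (5/2) * (1 + \<bar>z\<bar>) powr (- 4))"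
    proof -
      have p: "0 \<le> 1 + \<bar>z\<bar>" by simp
      have "(1 + \<bar>z\<bar>) powr (- 4) = 1 / (1 + \<bar>z\<bar>) ^ 4"
        using powr_numeral[OF p, of "num.Bit0 (num.Bit0 num.One)"] by (simp only: powr_minus_divide)
      then show ?thesis by simp
    qed
    also have "(1 + \<bar>z\<bar>) powr (5/2) * (1 + \<bar>z\<bar>) powr (- 4) = (1 + \<bar>z\<bar>) powr (- (3/2))"
      by (simp flip: powr_add)
    finally show ?thesis .
  qed
  note le = this
  have "(\<integral>\<^sup>+x. ennreal ((u x)\<^sup>2 * (1 + \<bar>x\<bar>) powr (5/2)) \<partial>lborel)
    = ennreal \<bar>h\<bar> * (\<integral>\<^sup>+z. ennreal ((u (h * k + h * z))\<^sup>2 * (1 + \<bar>h * k + h * z\<bar>) powr (5/2)) \<partial>lborel)"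
    using h by (intro nn_integral_real_affine) auto
  also have "\<dots> \<le> ennreal \<bar>h\<bar> * (\<integral>\<^sup>+z. ennreal (32 * K\<^sup>2) * ennreal ((1 + \<bar>z\<bar>) powr (- (3/2))) \<partial>lborel)"
    using le by (intro mult_left_mono nn_integral_mono) (auto simp: ennreal_mult[symmetric] intro!: ennreal_leI)
  also have "\<dots> = ennreal \<bar>h\<bar> * (ennreal (32 * K\<^sup>2) * ennreal 4)"
    by (subst nn_integral_cmult) (auto simp: nn_integral_weight)
  also have "\<dots> = ennreal (128 * K\<^sup>2 * h)"
    using h by (simp add: ennreal_mult[symmetric] mult_ac del: ennreal_numeral)
  finally show ?thesis .
qed

text \<open>The derivatives are carried as functions \<open>F0\<close>, \<open>F1\<close>,
  \<open>F2\<close> linked by derivative relations, with one constant \<open>D\<close> for all three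
  bounds. The order \<open>N\<close> of the difference exceeds \<open>\<beta> + 2\<close> by at
  least one, so a positive power of \<open>\<bar>s\<bar>\<close> remains after two derivatives are
  spread over the two factors.\<close>

locale smooth_error = prob_space \<epsilon> for \<epsilon> :: "real measure" +
  fixes F0 F1 F2 :: "real \<Rightarrow> complex" and \<beta> D :: real and N :: nat
  assumes sets_eps [measurable_cong, simp]: "sets \<epsilon> = sets borel"
    and F0: "\<And>t. F0 t = (LINT y|\<epsilon>. iexp (t * y))"
    and dF: "\<And>t. (F0 has_vector_derivative F1 t) (at t)" "\<And>t. (F1 has_vector_derivative F2 t) (at t)"
    and bF: "\<And>t. cmod (F0 t) \<le> D * (1 + \<bar>t\<bar>) powr (- \<beta>)"
      "\<And>t. cmod (F1 t) \<le> D * (1 + \<bar>t\<bar>) powr (- (\<beta> + 1))"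
      "\<And>t. cmod (F2 t) \<le> D * (1 + \<bar>t\<bar>) powr (- (\<beta> + 2))"
    and beta: "0 < \<beta>" and N: "\<beta> + 3 \<le> real N"
begin

lemma D_nonneg: "0 \<le> D"
  using bF(1)[of 0] norm_ge_zero[of "F0 0"] by (simp del: norm_ge_zero)

lemma dF_affine:
  "((\<lambda>s. F0 (a * s + b)) has_vector_derivative a * F1 (a * s + b)) (at s)"
  "((\<lambda>s. a * F1 (a * s + b)) has_vector_derivative complex_of_real (a\<^sup>2) * F2 (a * s + b)) (at s)"
proof -
  have d: "((\<lambda>s. a * s + b) has_vector_derivative a) (at s)"
    unfolding has_real_derivative_iff_has_vector_derivative[symmetric]
    by (auto intro!: derivative_eq_intros)
  show "((\<lambda>s. F0 (a * s + b)) has_vector_derivative a * F1 (a * s + b)) (at s)"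
    using vector_diff_chain_at[OF d dF(1)] by (simp add: o_def scaleR_conv_of_real)
  have "((\<lambda>s. F1 (a * s + b)) has_vector_derivative a * F2 (a * s + b)) (at s)"
    using vector_diff_chain_at[OF d dF(2)] by (simp add: o_def scaleR_conv_of_real)
  from has_vector_derivative_mult_right[OF this, of a]
  show "((\<lambda>s. a * F1 (a * s + b)) has_vector_derivative complex_of_real (a\<^sup>2) * F2 (a * s + b)) (at s)"
    by (simp add: power2_eq_square mult.assoc)
qed

text \<open>Here \<open>a\<close> derivatives fall on the difference factor and \<open>c\<close> on
  the rescaled characteristic function. Bounding \<open>1 + \<bar>s\<bar> / h\<close> below by
  \<open>\<bar>s\<bar> / h\<close> turns the decay into
  \<open>(h / \<bar>s\<bar>) powr (\<beta> + c)\<close>: the part \<open>h ^ c\<close> cancels the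
  chain rule, \<open>h powr \<beta>\<close> remains, and the singularity at 0 is absorbed by
  \<open>\<bar>s\<bar> ^ (N - a)\<close>. At \<open>s = 0\<close> the left side vanishes because
  \<open>a < N\<close>.\<close>

lemma power_cancel:
  assumes h: "0 < h" and "a + c \<le> 2"
  shows "\<bar>s\<bar> ^ (N - a) * ((1 / h) ^ c * (1 + \<bar>- (1 / h) * s + 0\<bar>) powr (- (\<beta> + real c))) \<le> h powr \<beta> * (1 + \<bar>s\<bar>) ^ N"
proof (cases "s = 0")
  case True
  have "a < N" using assms N beta by linarith
  then show ?thesis using True by (simp add: zero_power)
next
  case False
  have aN: "a < N" using assms N beta by linarith
  have "(1 + \<bar>- (1 / h) * s + 0\<bar>) powr (- (\<beta> + real c)) \<le> (\<bar>s\<bar> / h) powr (- (\<beta> + real c))"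
    using False h beta by (intro powr_mono2') (auto simp: abs_mult)
  also have "\<dots> = \<bar>s\<bar> powr (- (\<beta> + real c)) * h powr (\<beta> + real c)"
  proof -
    have "h powr (- (\<beta> + real c)) = 1 / h powr (\<beta> + real c)" by (rule powr_minus_divide)
    then show ?thesis using h by (subst powr_divide) auto
  qed
  finally have "\<bar>s\<bar> ^ (N - a) * ((1 / h) ^ c * (1 + \<bar>- (1 / h) * s + 0\<bar>) powr (- (\<beta> + real c)))
    \<le> \<bar>s\<bar> ^ (N - a) * ((1 / h) ^ c * (\<bar>s\<bar> powr (- (\<beta> + real c)) * h powr (\<beta> + real c)))"
    using h by (intro mult_left_mono) auto
  also have "\<dots> = h powr \<beta> * (\<bar>s\<bar> powr real (N - a) * \<bar>s\<bar> powr (- (\<beta> + real c)))"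
    using h False by (simp add: powr_add powr_realpow power_one_over)
  also have "\<bar>s\<bar> powr real (N - a) * \<bar>s\<bar> powr (- (\<beta> + real c)) = \<bar>s\<bar> powr (real N - real a - \<beta> - real c)"
    using aN by (simp add: of_nat_diff algebra_simps flip: powr_add)
  also have "\<dots> \<le> (1 + \<bar>s\<bar>) powr (real N - real a - \<beta> - real c)"
    using assms N by (intro powr_mono2) (auto simp: of_nat_le_iff[of "a + c" 2, symmetric, where 'a=real] simp del: of_nat_le_iff)
  also have "\<dots> \<le> (1 + \<bar>s\<bar>) powr real N"
    using beta by (intro powr_mono) auto
  also have "\<dots> = (1 + \<bar>s\<bar>) ^ N" by (simp add: powr_realpow)
  finally show ?thesis using h by (simp add: mult_left_mono)
qed

text \<open>In rescaled frequency the smoothed bump has the amplitude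
  \<open>(1 - iexp s) ^ N * F0 (- s / h)\<close> against the Gaussian. This amplitude and its first
  two derivatives are of size \<open>h powr \<beta>\<close> times a polynomial in
  \<open>\<bar>s\<bar>\<close>, so the quadratic decay in \<open>x / h - k\<close> comes together
  with the smoothing factor.\<close>

lemma conv_bump:
  obtains C where "0 \<le> C"
    "\<And>h k x. 0 < h \<Longrightarrow> \<bar>LINT y|\<epsilon>. bump N ((x - y) / h - k)\<bar> \<le> C * h powr \<beta> / (1 + (x / h - k)\<^sup>2)"
proof -
  \<comment> \<open>\<open>4 * (real N)\<^sup>2\<close> bounds the coefficients that the product
    rule produces up to order two, relative to the common majorant \<open>?B\<close>.\<close>
  define C where "C = (16 * fact (N + 1 + 2) * exp 2) * (4 * (real N)\<^sup>2 * D)"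
  have N3: "3 \<le> N" using N beta by linarith
  have "\<bar>LINT y|\<epsilon>. bump N ((x - y) / h - k)\<bar> \<le> C * h powr \<beta> / (1 + (x / h - k)\<^sup>2)" if h: "0 < h" for h k x
  proof -
    define e where "e = (\<lambda>s. iexp s)"
    have ne: "cmod (e s) = 1" for s by (simp add: e_def)
    define P where "P = (\<lambda>s. (1 - e s) ^ N)"
    define P1 where "P1 = (\<lambda>s. - (of_nat N * (\<i> * e s) * (1 - e s) ^ (N - 1)))"
    define P2 where "P2 = (\<lambda>s. of_nat N * e s * (1 - e s) ^ (N - 1) - of_nat N * of_nat (N - 1) * (e s)\<^sup>2 * (1 - e s) ^ (N - 2))"
    define f0 where "f0 = (\<lambda>s. F0 (- (1 / h) * s + 0))"
    define f1 where "f1 = (\<lambda>s. complex_of_real (- (1 / h)) * F1 (- (1 / h) * s + 0))"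
    define f2 where "f2 = (\<lambda>s. complex_of_real ((- (1 / h))\<^sup>2) * F2 (- (1 / h) * s + 0))"
    have de: "(e has_vector_derivative \<i> * e s) (at s)" for s
      unfolding e_def by (rule has_vector_derivative_iexp)
    have pw: "((\<lambda>s. (1 - e s) ^ n) has_vector_derivative - (of_nat n * (\<i> * e s) * (1 - e s) ^ (n - 1))) (at s)" for n s
    proof -
      have "((\<lambda>s. 1 - e s) has_vector_derivative 0 - \<i> * e s) (at s)"
        by (intro has_vector_derivative_diff has_vector_derivative_const de)
      moreover have "((\<lambda>w. w ^ n) has_field_derivative of_nat n * (1 - e s) ^ (n - 1)) (at (1 - e s))"
        by (auto intro!: derivative_eq_intros)
      ultimately have "(((\<lambda>w. w ^ n) \<circ> (\<lambda>s. 1 - e s)) has_vector_derivative (0 - \<i> * e s) * (of_nat n * (1 - e s) ^ (n - 1))) (at s)"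
        by (rule field_vector_diff_chain_at)
      then show ?thesis by (simp add: o_def mult_ac)
    qed
    have dP: "(P has_vector_derivative P1 s) (at s)" for s
      unfolding P_def P1_def by (rule pw)
    have dP1: "(P1 has_vector_derivative P2 s) (at s)" for s
      unfolding P1_def P2_def
      by (auto intro!: derivative_eq_intros de pw simp: algebra_simps power2_eq_square numeral_2_eq_2)
    have df: "(f0 has_vector_derivative f1 s) (at s)" "(f1 has_vector_derivative f2 s) (at s)" for s
      unfolding f0_def f1_def f2_def by (rule dF_affine)+
    have bP: "cmod (P s) \<le> \<bar>s\<bar> ^ (N - 0)" "cmod (P1 s) \<le> real N * \<bar>s\<bar> ^ (N - 1)"
       "cmod (P2 s) \<le> real N * \<bar>s\<bar> ^ (N - 1) + (real N)\<^sup>2 * \<bar>s\<bar> ^ (N - 2)" for s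
    proof -
      have q: "cmod (1 - e s) ^ n \<le> \<bar>s\<bar> ^ n" for n
        unfolding e_def by (intro power_mono cmod_one_minus_iexp_le) auto
      show "cmod (P s) \<le> \<bar>s\<bar> ^ (N - 0)" using q by (simp add: P_def norm_power)
      show "cmod (P1 s) \<le> real N * \<bar>s\<bar> ^ (N - 1)"
        using q by (simp add: P1_def norm_power norm_mult ne mult_left_mono)
      have "cmod (P2 s) \<le> real N * cmod (1 - e s) ^ (N - 1) + real N * real (N - 1) * cmod (1 - e s) ^ (N - 2)"
        unfolding P2_def by (rule order_trans[OF norm_triangle_ineq4]) (simp add: norm_power norm_mult ne)
      also have "\<dots> \<le> real N * \<bar>s\<bar> ^ (N - 1) + (real N)\<^sup>2 * \<bar>s\<bar> ^ (N - 2)"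
        unfolding power2_eq_square by (intro add_mono mult_mono q order.refl) auto
      finally show "cmod (P2 s) \<le> real N * \<bar>s\<bar> ^ (N - 1) + (real N)\<^sup>2 * \<bar>s\<bar> ^ (N - 2)" .
    qed
    have bf: "cmod (f0 s) \<le> D * ((1 / h) ^ 0 * (1 + \<bar>- (1 / h) * s + 0\<bar>) powr (- (\<beta> + real 0)))"
      "cmod (f1 s) \<le> D * ((1 / h) ^ 1 * (1 + \<bar>- (1 / h) * s + 0\<bar>) powr (- (\<beta> + real 1)))"
      "cmod (f2 s) \<le> D * ((1 / h) ^ 2 * (1 + \<bar>- (1 / h) * s + 0\<bar>) powr (- (\<beta> + real 2)))" for s
    proof -
      show "cmod (f0 s) \<le> D * ((1 / h) ^ 0 * (1 + \<bar>- (1 / h) * s + 0\<bar>) powr (- (\<beta> + real 0)))"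
        using bF(1)[of "- (1 / h) * s + 0"] by (simp add: f0_def)
      have "cmod (f1 s) = (1 / h) * cmod (F1 (- (1 / h) * s + 0))"
        unfolding f1_def norm_mult norm_of_real using h by simp
      also have "\<dots> \<le> (1 / h) * (D * (1 + \<bar>- (1 / h) * s + 0\<bar>) powr (- (\<beta> + 1)))"
        using h by (intro mult_left_mono bF) auto
      finally show "cmod (f1 s) \<le> D * ((1 / h) ^ 1 * (1 + \<bar>- (1 / h) * s + 0\<bar>) powr (- (\<beta> + real 1)))"
        by (simp only: power_one_right of_nat_1 mult_ac)
      have "cmod (f2 s) = (1 / h) ^ 2 * cmod (F2 (- (1 / h) * s + 0))"
        unfolding f2_def norm_mult norm_of_real by simp
      also have "\<dots> \<le> (1 / h) ^ 2 * (D * (1 + \<bar>- (1 / h) * s + 0\<bar>) powr (- (\<beta> + 2)))"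
        using h by (intro mult_left_mono bF) auto
      finally show "cmod (f2 s) \<le> D * ((1 / h) ^ 2 * (1 + \<bar>- (1 / h) * s + 0\<bar>) powr (- (\<beta> + real 2)))"
        by (simp only: of_nat_numeral mult_ac)
    qed
    \<comment> \<open>Up to powers of \<open>N\<close>, this one majorant controls every product of
      a derivative of the difference factor with a derivative of the characteristic function of
      total order at most 2.\<close>
    let ?B = "\<lambda>s. D * (h powr \<beta> * (1 + \<bar>s\<bar>) ^ N)"
    have prod: "u * v \<le> ?B s" 
      if "u \<le> \<bar>s\<bar> ^ (N - a)" "v \<le> D * ((1 / h) ^ c * (1 + \<bar>- (1 / h) * s + 0\<bar>) powr (- (\<beta> + real c)))"
        "a + c \<le> 2" "0 \<le> v" for u v s a c
    proof -
      have "u * v \<le> \<bar>s\<bar> ^ (N - a) * (D * ((1 / h) ^ c * (1 + \<bar>- (1 / h) * s + 0\<bar>) powr (- (\<beta> + real c))))"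
        using that by (intro mult_mono) auto
      also have "\<dots> = D * (\<bar>s\<bar> ^ (N - a) * ((1 / h) ^ c * (1 + \<bar>- (1 / h) * s + 0\<bar>) powr (- (\<beta> + real c))))"
        by (simp only: mult_ac)
      also have "\<dots> \<le> ?B s" using D_nonneg that(3) h by (intro mult_left_mono power_cancel) auto
      finally show ?thesis .
    qed
    let ?H = "\<lambda>s. P s * f0 s" and ?H1 = "\<lambda>s. P s * f1 s + P1 s * f0 s"
      and ?H2 = "\<lambda>s. (P s * f2 s + P1 s * f1 s) + (P1 s * f1 s + P2 s * f0 s)"
    have "cmod (LINT s|lborel. iexp (s * (x / h - k)) * (std_normal_density s * ?H s))
        \<le> (16 * fact (N + 1 + 2) * exp 2) * (4 * (real N)\<^sup>2 * D * h powr \<beta>) / (1 + (x / h - k)\<^sup>2)"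
    proof (rule gauss_fourier_decay[where H'="?H1" and H''="?H2"])
      fix s
      show "(?H has_vector_derivative ?H1 s) (at s)"
        by (intro has_vector_derivative_mult dP df)
      show "(?H1 has_vector_derivative ?H2 s) (at s)"
        by (intro has_vector_derivative_mult has_vector_derivative_add dP dP1 df)
      have B0: "0 \<le> ?B s" using D_nonneg by simp
      have fin: "q * ?B s \<le> 4 * (real N)\<^sup>2 * D * h powr \<beta> * (1 + \<bar>s\<bar>) ^ (N + 1)"
        if "q \<le> 4 * (real N)\<^sup>2 * (1 + \<bar>s\<bar>)" for q
        using mult_right_mono[OF that B0] by (simp add: mult_ac)
      have N2: "real N \<le> (real N)\<^sup>2" "1 \<le> (real N)\<^sup>2"
        using N3 by (auto simp: power2_eq_square intro: order_trans[of 1 "real N"])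
      then have N2s: "real N \<le> (real N)\<^sup>2 * (1 + \<bar>s\<bar>)" "1 \<le> (real N)\<^sup>2 * (1 + \<bar>s\<bar>)"
        by (auto simp: distrib_left intro: add_increasing2)
      have "cmod (?H s) \<le> ?B s"
        unfolding norm_mult by (rule prod[of _ s 0 _ 0]) (use bP bf in auto)
      then show "cmod (?H s) \<le> 4 * (real N)\<^sup>2 * D * h powr \<beta> * (1 + \<bar>s\<bar>) ^ (N + 1)"
        using fin[of 1] N2s by simp
      have P1f: "cmod (P1 s) * v \<le> real N * ?B s"
        if "v \<le> D * ((1 / h) ^ c * (1 + \<bar>- (1 / h) * s + 0\<bar>) powr (- (\<beta> + real c)))" "c \<le> 1" "0 \<le> v" for v c
      proof -
        have "cmod (P1 s) * v \<le> real N * (\<bar>s\<bar> ^ (N - 1) * v)"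
          using mult_right_mono[OF bP(2)[of s] that(3)] by (simp add: mult.assoc)
        also have "\<dots> \<le> real N * ?B s"
          using that by (intro mult_left_mono prod[of _ _ 1 _ c]) auto
        finally show ?thesis .
      qed
      have "cmod (?H1 s) \<le> ?B s + real N * ?B s"
        using norm_triangle_ineq[of "P s * f1 s" "P1 s * f0 s"]
          prod[OF bP(1) bf(2)[of s]] P1f[OF bf(1)] by (simp only: norm_mult) auto
      also have "\<dots> = (1 + real N) * ?B s" by (simp add: algebra_simps)
      also note fin[of "1 + real N"]
      finally show "cmod (?H1 s) \<le> 4 * (real N)\<^sup>2 * D * h powr \<beta> * (1 + \<bar>s\<bar>) ^ (N + 1)"
        using N2s by simp
      have P2f: "cmod (P2 s) * cmod (f0 s) \<le> (real N * (1 + \<bar>s\<bar>) + (real N)\<^sup>2) * ?B s"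
      proof -
        have "cmod (P2 s) * cmod (f0 s) \<le> (real N * \<bar>s\<bar> ^ (N - 1) + (real N)\<^sup>2 * \<bar>s\<bar> ^ (N - 2)) * cmod (f0 s)"
          by (intro mult_right_mono bP) auto
        also have "\<dots> = real N * (\<bar>s\<bar> ^ (N - 1) * cmod (f0 s)) + (real N)\<^sup>2 * (\<bar>s\<bar> ^ (N - 2) * cmod (f0 s))"
          by (simp add: distrib_right mult.assoc)
        also have "\<dots> \<le> real N * ?B s + (real N)\<^sup>2 * ?B s"
          by (intro add_mono mult_left_mono prod[OF order.refl bf(1)]) auto
        also have "\<dots> = (real N + (real N)\<^sup>2) * ?B s" by (simp only: distrib_right)
        also have "\<dots> \<le> (real N * (1 + \<bar>s\<bar>) + (real N)\<^sup>2) * ?B s"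
          using B0 by (intro mult_right_mono) (auto simp: distrib_left)
        finally show ?thesis .
      qed
      have "cmod (?H2 s) \<le> (?B s + real N * ?B s) + (real N * ?B s + (real N * (1 + \<bar>s\<bar>) + (real N)\<^sup>2) * ?B s)"
      proof -
        have "cmod (P s) * cmod (f2 s) \<le> ?B s" "cmod (P1 s) * cmod (f1 s) \<le> real N * ?B s"
          using prod[OF bP(1) bf(3)[of s]] P1f[OF bf(2)] by auto
        with P2f show ?thesis
          using norm_triangle_ineq[of "P s * f2 s + P1 s * f1 s" "P1 s * f1 s + P2 s * f0 s"]
            norm_triangle_ineq[of "P s * f2 s" "P1 s * f1 s"] norm_triangle_ineq[of "P1 s * f1 s" "P2 s * f0 s"]
          unfolding norm_mult by linarith
      qed
      also have "\<dots> = (1 + 2 * real N + real N * (1 + \<bar>s\<bar>) + (real N)\<^sup>2) * ?B s" by (simp add: algebra_simps)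
      also have "\<dots> \<le> 4 * (real N)\<^sup>2 * D * h powr \<beta> * (1 + \<bar>s\<bar>) ^ (N + 1)"
      proof (rule fin)
        have sq: "3 * real N \<le> (real N)\<^sup>2"
          using N3 unfolding power2_eq_square by (intro mult_right_mono) auto
        have "2 * real N + real N * (1 + \<bar>s\<bar>) \<le> (real N)\<^sup>2 * (1 + \<bar>s\<bar>)"
        proof -
          have "real N * 1 \<le> real N * (1 + \<bar>s\<bar>)" by (intro mult_left_mono) auto
          moreover have "3 * real N * (1 + \<bar>s\<bar>) \<le> (real N)\<^sup>2 * (1 + \<bar>s\<bar>)"
            using sq by (intro mult_right_mono) auto
          ultimately show ?thesis by linarith
        qed
        moreover have "(real N)\<^sup>2 \<le> (real N)\<^sup>2 * (1 + \<bar>s\<bar>)" by (simp add: distrib_left)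
        ultimately show "1 + 2 * real N + real N * (1 + \<bar>s\<bar>) + (real N)\<^sup>2 \<le> 4 * (real N)\<^sup>2 * (1 + \<bar>s\<bar>)"
          using N2s by simp
      qed
      finally show "cmod (?H2 s) \<le> 4 * (real N)\<^sup>2 * D * h powr \<beta> * (1 + \<bar>s\<bar>) ^ (N + 1)" .
    qed
    also have "\<dots> = C * h powr \<beta> / (1 + (x / h - k)\<^sup>2)" by (simp add: C_def)
    finally have bound: "cmod (LINT s|lborel. iexp (s * (x / h - k)) * (std_normal_density s * ?H s)) \<le> C * h powr \<beta> / (1 + (x / h - k)\<^sup>2)" .
    have "complex_of_real (LINT y|\<epsilon>. bump N ((x - y) / h - k)) = (LINT y|\<epsilon>. complex_of_real (bump N ((x - y) / h - k)))"
      by simp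
    \<comment> \<open>The shift by \<open>k\<close> is moved into the amplitude as the phase
      \<open>iexp (- s * k)\<close> of modulus one, which leaves an exponential of the form required
      by \<open>conv_inversion\<close>; afterwards it is moved back.\<close>
    also have "\<dots> = (1 / sqrt (2 * pi)) * (LINT y|\<epsilon>. LINT s|lborel. iexp (s / h * (x - y)) * (std_normal_density s * (iexp (- s * k) * (1 - iexp s) ^ N)))"
    proof -
      have "iexp (s * (u / h - k)) = iexp (s / h * u) * iexp (- s * k)" for s u
        by (simp add: exp_add[symmetric] right_diff_distrib)
      then show ?thesis
        unfolding bump_inversion integral_mult_right_zero by (simp only: mult_ac)
    qed
    also have "(LINT y|\<epsilon>. LINT s|lborel. iexp (s / h * (x - y)) * (std_normal_density s * (iexp (- s * k) * (1 - iexp s) ^ N)))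
      = (LINT s|lborel. iexp (s / h * x) * (std_normal_density s * ((iexp (- s * k) * (1 - iexp s) ^ N) * (LINT y|\<epsilon>. iexp (- (s / h) * y)))))"
      by (rule conv_inversion[where B="2 ^ N"])
         (auto intro: prob_space_axioms simp: norm_mult norm_power intro!: power_mono cmod_one_minus_iexp_le)
    also have "\<dots> = (LINT s|lborel. iexp (s * (x / h - k)) * (std_normal_density s * ?H s))"
    proof (intro Bochner_Integration.integral_cong refl)
      fix s
      have "iexp (s * (x / h - k)) = iexp (s / h * x) * iexp (- s * k)"
        by (simp add: exp_add[symmetric] right_diff_distrib)
      moreover have "f0 s = (LINT y|\<epsilon>. iexp (- (s / h) * y))"
        by (simp add: f0_def F0)
      ultimately show "iexp (s / h * x) * (std_normal_density s * ((iexp (- s * k) * (1 - iexp s) ^ N) * (LINT y|\<epsilon>. iexp (- (s / h) * y))))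
        = iexp (s * (x / h - k)) * (std_normal_density s * ?H s)"
        by (simp only: P_def e_def mult_ac)
    qed
    finally have "cmod (complex_of_real (LINT y|\<epsilon>. bump N ((x - y) / h - k))) = cmod ((1 / sqrt (2 * pi)) * (LINT s|lborel. iexp (s * (x / h - k)) * (std_normal_density s * ?H s)))"
      by (rule arg_cong)
    then have "\<bar>LINT y|\<epsilon>. bump N ((x - y) / h - k)\<bar> = (1 / sqrt (2 * pi)) * cmod (LINT s|lborel. iexp (s * (x / h - k)) * (std_normal_density s * ?H s))"
      unfolding norm_mult norm_of_real by simp
    also have "\<dots> \<le> 1 * cmod (LINT s|lborel. iexp (s * (x / h - k)) * (std_normal_density s * ?H s))"
      using pi_gt3 by (intro mult_right_mono) (auto simp: divide_le_eq real_le_rsqrt)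
    finally show ?thesis using bound by simp
  qed
  moreover have "0 \<le> C" unfolding C_def using D_nonneg by simp
  ultimately show thesis using that by blast
qed

text \<open>The wave lives at frequencies near \<open>1 / h\<close>, where the characteristic
  function is already small: Peetre's inequality gives \<open>(1 + \<bar>s + 1 / h\<bar>) powr (-
  \<beta>) \<le> h powr \<beta> * (1 + \<bar>s\<bar>) powr \<beta>\<close>. The extra decay of the
  derivatives is discarded, because here the spectrum is translated rather than dilated and the
  chain rule creates no powers of \<open>1 / h\<close>.\<close>

lemma conv_cos:
  obtains C where "0 \<le> C"
    "\<And>h x. 0 < h \<Longrightarrow> \<bar>LINT y|\<epsilon>. cos ((x - y) / h) * std_normal_density (x - y)\<bar> \<le> C * h powr \<beta> / (1 + x\<^sup>2)"
proof -
  define C where "C = (16 * fact (N + 2) * exp 2) * D"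
  have "\<bar>LINT y|\<epsilon>. cos ((x - y) / h) * std_normal_density (x - y)\<bar> \<le> C * h powr \<beta> / (1 + x\<^sup>2)" if h: "0 < h" for h x
  proof -
    define b where "b = 1 / h"
    define H where "H = (\<lambda>s. F0 (- 1 * s + - b))"
    define H1 where "H1 = (\<lambda>s. complex_of_real (- 1) * F1 (- 1 * s + - b))"
    define H2 where "H2 = (\<lambda>s. complex_of_real ((- 1)\<^sup>2) * F2 (- 1 * s + - b))"
    have le: "D * (1 + \<bar>- 1 * s + - b\<bar>) powr (- (\<beta> + c)) \<le> D * h powr \<beta> * (1 + \<bar>s\<bar>) ^ N" if "0 \<le> c" for s c
    proof -
      have "(1 + \<bar>- 1 * s + - b\<bar>) powr (- (\<beta> + c)) \<le> (1 + \<bar>- 1 * s + - b\<bar>) powr (- \<beta>)"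
        using that by (intro powr_mono) auto
      also have "\<dots> \<le> (1 + \<bar>- b\<bar>) powr (- \<beta>) * (1 + \<bar>s\<bar>) powr \<beta>"
        using peetre_minus[of \<beta> "- 1 * s + - b" "- b"] beta by simp
      also have "\<dots> \<le> h powr \<beta> * (1 + \<bar>s\<bar>) powr real N"
      proof (intro mult_mono powr_mono)
        have "(1 + \<bar>- b\<bar>) powr (- \<beta>) \<le> (1 / h) powr (- \<beta>)"
          using h beta by (intro powr_mono2') (auto simp: b_def)
        also have "\<dots> = h powr \<beta>" using h by (simp add: powr_divide powr_minus field_simps)
        finally show "(1 + \<bar>- b\<bar>) powr (- \<beta>) \<le> h powr \<beta>" .
      qed (use N in auto)
      finally have "(1 + \<bar>- 1 * s + - b\<bar>) powr (- (\<beta> + c)) \<le> h powr \<beta> * (1 + \<bar>s\<bar>) ^ N"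
        by (simp add: powr_realpow)
      then show ?thesis using D_nonneg by (simp add: mult.assoc mult_left_mono)
    qed
    have bound: "cmod (LINT s|lborel. iexp (s * x) * (std_normal_density s * H s)) \<le> (16 * fact (N + 2) * exp 2) * (D * h powr \<beta>) / (1 + x\<^sup>2)"
    proof (rule gauss_fourier_decay[where H'=H1 and H''=H2])
      fix s
      show "(H has_vector_derivative H1 s) (at s)" "(H1 has_vector_derivative H2 s) (at s)"
        unfolding H_def H1_def H2_def by (rule dF_affine)+
      show "cmod (H s) \<le> D * h powr \<beta> * (1 + \<bar>s\<bar>) ^ N"
        unfolding H_def using bF(1) le[of 0] by (auto intro: order_trans)
      show "cmod (H1 s) \<le> D * h powr \<beta> * (1 + \<bar>s\<bar>) ^ N"
        unfolding H1_def norm_mult using bF(2)[of "- 1 * s + - b"] le[of 1 s] by (auto intro: order_trans)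
      show "cmod (H2 s) \<le> D * h powr \<beta> * (1 + \<bar>s\<bar>) ^ N"
        unfolding H2_def norm_mult using bF(3)[of "- 1 * s + - b"] le[of 2 s] by (auto intro: order_trans)
    qed
    \<comment> \<open>Modulation shifts the spectrum of the Gaussian by \<open>b = 1 / h\<close>.
      Working with the complex exponential keeps a single shift; the cosine is recovered at the end
      as a real part.\<close>
    have rep: "iexp (u / h) * std_normal_density u = (1 / sqrt (2 * pi)) * (LINT s|lborel. iexp ((s + b) * u) * (std_normal_density s * (1::complex)))" for u
    proof -
      have "(LINT s|lborel. iexp ((s + b) * u) * (std_normal_density s * (1::complex))) = (LINT s|lborel. iexp (u / h) * (iexp (s * u) * std_normal_density s))"
        by (intro Bochner_Integration.integral_cong refl) (simp add: b_def distrib_left distrib_right exp_add mult_ac)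
      also have "\<dots> = iexp (u / h) * (LINT s|lborel. iexp (s * u) * std_normal_density s)"
        by (rule integral_mult_right_zero)
      finally show ?thesis by (subst std_normal_inversion) (simp only: mult_ac)
    qed
    let ?w = "\<lambda>y. iexp ((x - y) / h) * std_normal_density (x - y)"
    have intw: "integrable \<epsilon> ?w"
      by (rule integrable_const_bound[of _ 1])
         (auto simp: norm_mult intro!: order_trans[OF std_normal_density_le])
    have "(LINT y|\<epsilon>. ?w y) = (1 / sqrt (2 * pi)) * (LINT y|\<epsilon>. LINT s|lborel. iexp ((s + b) * (x - y)) * (std_normal_density s * (1::complex)))"
      unfolding rep by (rule integral_mult_right_zero)
    also have "(LINT y|\<epsilon>. LINT s|lborel. iexp ((s + b) * (x - y)) * (std_normal_density s * (1::complex)))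
      = (LINT s|lborel. iexp ((s + b) * x) * (std_normal_density s * (1 * (LINT y|\<epsilon>. iexp (- (s + b) * y)))))"
      by (rule conv_inversion[where B=1]) (auto intro: prob_space_axioms)
    also have "\<dots> = (LINT s|lborel. iexp (b * x) * (iexp (s * x) * (std_normal_density s * H s)))"
      unfolding H_def F0
      by (intro Bochner_Integration.integral_cong refl) (simp add: distrib_left distrib_right exp_add mult_ac)
    also have "\<dots> = iexp (b * x) * (LINT s|lborel. iexp (s * x) * (std_normal_density s * H s))"
      by (rule integral_mult_right_zero)
    finally have "cmod (LINT y|\<epsilon>. ?w y) = (1 / sqrt (2 * pi)) * cmod (LINT s|lborel. iexp (s * x) * (std_normal_density s * H s))"
      by (simp only: norm_mult norm_exp_i_times) (simp add: norm_divide)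
    also have "\<dots> \<le> 1 * cmod (LINT s|lborel. iexp (s * x) * (std_normal_density s * H s))"
      using pi_gt3 by (intro mult_right_mono) (auto simp: divide_le_eq real_le_rsqrt)
    also note bound
    finally have c: "cmod (LINT y|\<epsilon>. ?w y) \<le> C * h powr \<beta> / (1 + x\<^sup>2)" by (simp add: C_def)
    have "(LINT y|\<epsilon>. cos ((x - y) / h) * std_normal_density (x - y)) = (LINT y|\<epsilon>. Re (?w y))"
      by (intro Bochner_Integration.integral_cong refl) (simp add: Re_exp)
    also have "\<dots> = Re (LINT y|\<epsilon>. ?w y)" using intw by (rule integral_Re)
    finally have eq: "(LINT y|\<epsilon>. cos ((x - y) / h) * std_normal_density (x - y)) = Re (LINT y|\<epsilon>. ?w y)" .
    show ?thesis unfolding eq by (rule order_trans[OF abs_Re_le_cmod c])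
  qed
  moreover have "0 \<le> C" unfolding C_def using D_nonneg by simp
  ultimately show thesis using that by blast
qed

end

section \<open>Uniqueness of the Fourier transform\<close>

lemma AE_lborel_scale:
  fixes P :: "'a::euclidean_space \<Rightarrow> bool"
  assumes "c \<noteq> 0" "Measurable.pred borel P" "AE x in lborel. P x"
  shows "AE x in lborel. P (c *\<^sub>R x)"
  using assms
  by (subst lborel_affine[where t=0 and c="1 / c"]) (simp_all add: AE_density AE_distr_iff field_simps)

text \<open>The multiplication formula: by Fubini a transform passes from one factor of an integral
  to the other. In the uniqueness proof it takes the place of Plancherel's theorem.\<close>

lemma integral_mult_trig_transform:
  fixes u :: "'a::euclidean_space \<Rightarrow> real" and Q :: "'a \<Rightarrow> complex"
  assumes u: "integrable lborel u" and Q: "integrable lborel Q"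
  shows "(LINT x|lborel. u x * (LINT s|lborel. iexp (s \<bullet> (h *\<^sub>R x)) * Q s)) = (LINT s|lborel. Q s * fourier u (h *\<^sub>R s))"
proof -
  have [measurable]: "u \<in> borel_measurable borel" "Q \<in> borel_measurable borel" using u Q by auto
  have "integrable (lborel \<Otimes>\<^sub>M lborel) (\<lambda>(x, s). u x * (iexp (s \<bullet> (h *\<^sub>R x)) * Q s))"
  proof (rule lborel_pair.Fubini_integrable)
    show "integrable lborel (\<lambda>x. LINT s|lborel. norm (case (x, s) of (x, s) \<Rightarrow> u x * (iexp (s \<bullet> (h *\<^sub>R x)) * Q s)))"
      using u by (simp add: norm_mult)
    show "AE x in lborel. integrable lborel (\<lambda>s. case (x, s) of (x, s) \<Rightarrow> u x * (iexp (s \<bullet> (h *\<^sub>R x)) * Q s))"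
    proof (rule AE_I2)
      fix x
      have "integrable lborel (\<lambda>s. iexp (s \<bullet> (h *\<^sub>R x)) * Q s)"
        by (rule Bochner_Integration.integrable_bound[OF Q]) (auto simp: norm_mult)
      then show "integrable lborel (\<lambda>s. case (x, s) of (x, s) \<Rightarrow> u x * (iexp (s \<bullet> (h *\<^sub>R x)) * Q s))" by simp
    qed
  qed auto
  from lborel_pair.Fubini_integral[OF this]
  have "(LINT s|lborel. LINT x|lborel. u x * (iexp (s \<bullet> (h *\<^sub>R x)) * Q s)) = (LINT x|lborel. LINT s|lborel. u x * (iexp (s \<bullet> (h *\<^sub>R x)) * Q s))"
    by simp
  moreover have "(LINT x|lborel. u x * (iexp (s \<bullet> (h *\<^sub>R x)) * Q s)) = Q s * fourier u (h *\<^sub>R s)" for s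
    unfolding fourier_def integral_mult_right_zero[symmetric]
    by (intro Bochner_Integration.integral_cong refl) (simp add: mult_ac)
  ultimately show ?thesis by simp
qed

text \<open>The uniform density on the interval convolved with a Gaussian of standard deviation
  \<open>1 / h\<close>, where \<open>h\<close> is going to be large. Written as an integral against
  a probability measure it falls under \<open>conv_inversion\<close>, which yields an integrable
  spectrum.\<close>

definition smooth_box :: "real \<Rightarrow> real \<Rightarrow> real \<Rightarrow> real \<Rightarrow> real" where
  "smooth_box a b h x = (LINT y|uniform_measure lborel {a<..<b}. h * std_normal_density (h * (x - y)))"

lemma prob_space_uniform_Ioo: "a < b \<Longrightarrow> prob_space (uniform_measure lborel {a<..<b::real})"
  by (rule prob_space_uniform_measure) auto

lemma smooth_box_transform:
  assumes "a < b"
  obtains Q :: "real \<Rightarrow> complex" where "integrable lborel Q"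
    "\<And>x. complex_of_real (smooth_box a b h x) = (LINT s|lborel. iexp (s * (h * x)) * Q s)"
proof -
  let ?U = "uniform_measure lborel {a<..<b}"
  interpret prob_space ?U using assms by (rule prob_space_uniform_Ioo)
  define R where "R = (\<lambda>s. LINT y|?U. iexp (- (s * h) * y))"
  define Q where "Q = (\<lambda>s. (h / sqrt (2 * pi)) * (std_normal_density s * R s))"
  have [measurable]: "R \<in> borel_measurable borel" unfolding R_def by measurable
  have R: "cmod (R s) \<le> 1" for s
  proof -
    have "cmod (R s) \<le> (LINT y|?U. cmod (iexp (- (s * h) * y)))" unfolding R_def by (rule integral_norm_bound)
    moreover have "prob UNIV = 1" using prob_space by simp
    ultimately show ?thesis by simp
  qed
  show thesis
  proof
    have "integrable lborel (\<lambda>s. std_normal_density s * R s)"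
      by (rule Bochner_Integration.integrable_bound[of _ std_normal_density])
         (use R in \<open>auto simp: norm_mult mult_left_le\<close>)
    then show "integrable lborel Q" unfolding Q_def by (rule integrable_mult_right)
    fix x
    have "complex_of_real (smooth_box a b h x) = (LINT y|?U. complex_of_real (h * std_normal_density (h * (x - y))))"
      unfolding smooth_box_def by (rule integral_complex_of_real[symmetric])
    also have "\<dots> = (LINT y|?U. (h / sqrt (2 * pi)) * (LINT s|lborel. iexp (s * h * (x - y)) * (std_normal_density s * (1::complex))))"
    proof (intro Bochner_Integration.integral_cong refl)
      fix y
      show "complex_of_real (h * std_normal_density (h * (x - y))) = (h / sqrt (2 * pi)) * (LINT s|lborel. iexp (s * h * (x - y)) * (std_normal_density s * (1::complex)))"
        unfolding of_real_mult by (subst std_normal_inversion) (simp add: mult.assoc)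
    qed
    also have "\<dots> = (h / sqrt (2 * pi)) * (LINT y|?U. LINT s|lborel. iexp (s * h * (x - y)) * (std_normal_density s * (1::complex)))"
      by (rule integral_mult_right_zero)
    also have "(LINT y|?U. LINT s|lborel. iexp (s * h * (x - y)) * (std_normal_density s * (1::complex)))
      = (LINT s|lborel. iexp (s * h * x) * (std_normal_density s * (1 * R s)))"
      unfolding R_def by (rule conv_inversion[where B=1]) (auto intro: prob_space_axioms)
    also have "(h / sqrt (2 * pi)) * \<dots> = (LINT s|lborel. (h / sqrt (2 * pi)) * (iexp (s * h * x) * (std_normal_density s * (1 * R s))))"
      by (rule integral_mult_right_zero[symmetric])
    also have "\<dots> = (LINT s|lborel. iexp (s * (h * x)) * Q s)"
      unfolding Q_def by (intro Bochner_Integration.integral_cong refl) (simp add: mult_ac)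
    finally show "complex_of_real (smooth_box a b h x) = (LINT s|lborel. iexp (s * (h * x)) * Q s)" .
  qed
qed

lemma smooth_box_eq:
  assumes "a < b" "0 < h"
  shows "smooth_box a b h x = (LINT z|lborel. indicator {a<..<b} (x - z / h) * std_normal_density z) / (b - a)"
proof -
  have "smooth_box a b h x = (LINT y|lborel. (indicator {a<..<b} y / (b - a)) * (h * std_normal_density (h * (x - y))))"
  proof -
    have "uniform_measure lborel {a<..<b} = density lborel (\<lambda>y. ennreal (indicator {a<..<b} y / (b - a)))"
      unfolding uniform_measure_def
    proof (intro arg_cong[where f="density lborel"] ext)
      fix y show "indicator {a<..<b} y / emeasure lborel {a<..<b} = ennreal (indicator {a<..<b} y / (b - a))"
        using assms divide_ennreal[of 1 "b - a"] by (cases "y \<in> {a<..<b}") auto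
    qed
    then show ?thesis using assms unfolding smooth_box_def
      by (simp add: integral_density) (simp add: mult.left_commute flip: integral_mult_right_zero)
  qed
  also have "\<dots> = \<bar>- (1 / h)\<bar> *\<^sub>R (LINT z|lborel. (indicator {a<..<b} (x + - (1 / h) * z) / (b - a)) * (h * std_normal_density (h * (x - (x + - (1 / h) * z)))))"
    using assms by (intro lborel_integral_real_affine) auto
  also have "\<dots> = (LINT z|lborel. indicator {a<..<b} (x - z / h) * std_normal_density z / (b - a))"
    using assms by (simp flip: integral_mult_right_zero)
  finally show ?thesis by simp
qed

lemma smooth_box_bounds:
  assumes "a < b" "0 < h"
  shows "0 \<le> smooth_box a b h x" "smooth_box a b h x \<le> 1 / (b - a)"
proof -
  have "(LINT z|lborel. indicator {a<..<b} (x - z / h) * std_normal_density z) \<le> (LINT z|lborel. std_normal_density z)"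
    by (intro integral_mono' integrable_normal_density) (auto simp: indicator_def)
  then show "smooth_box a b h x \<le> 1 / (b - a)"
    using assms by (auto simp: smooth_box_eq intro!: divide_right_mono)
  show "0 \<le> smooth_box a b h x"
    using assms by (auto simp: smooth_box_eq intro!: divide_nonneg_pos integral_nonneg_AE)
qed

lemma measurable_smooth_box [measurable]: "smooth_box a b h \<in> borel_measurable borel"
proof (cases "a < b")
  case True
  then interpret prob_space "uniform_measure lborel {a<..<b}" by (rule prob_space_uniform_Ioo)
  show ?thesis unfolding smooth_box_def by measurable
next
  case False
  then have "uniform_measure lborel {a<..<b} = density lborel (\<lambda>_. 0)"
    by (simp add: uniform_measure_def)
  then have "smooth_box a b h = (\<lambda>_. 0)"
    by (auto simp: smooth_box_def fun_eq_iff integral_density[where g="\<lambda>_. 0", simplified])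
  then show ?thesis by simp
qed

text \<open>The endpoints are excluded because there only half of the Gaussian mass falls inside the
  interval in the limit.\<close>

lemma smooth_box_tendsto:
  assumes "a < b" "x \<noteq> a" "x \<noteq> b"
  shows "(\<lambda>n. smooth_box a b (real (Suc n)) x) \<longlonglongrightarrow> indicator {a<..<b} x / (b - a)"
proof -
  have "(\<lambda>n. LINT z|lborel. indicator {a<..<b} (x - z / real (Suc n)) * std_normal_density z)
     \<longlonglongrightarrow> (LINT z|lborel. indicator {a<..<b} x * std_normal_density z)"
  proof (rule integral_dominated_convergence[where w=std_normal_density])
    show "AE z in lborel. (\<lambda>n. indicator {a<..<b} (x - z / real (Suc n)) * std_normal_density z) \<longlonglongrightarrow> indicator {a<..<b} x * std_normal_density z"
    proof (rule AE_I2)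
      fix z :: real
      have l: "(\<lambda>n. x - z / real (Suc n)) \<longlonglongrightarrow> x - 0"
        by (intro tendsto_diff tendsto_const LIMSEQ_Suc[OF lim_const_over_n])
      have "eventually (\<lambda>n. (indicator {a<..<b} (x - z / real (Suc n)) :: real) = indicator {a<..<b} x) sequentially"
      proof (cases "x \<in> {a<..<b}")
        case True
        have "eventually (\<lambda>n. x - z / real (Suc n) \<in> {a<..<b}) sequentially"
          using topological_tendstoD[OF l, of "{a<..<b}"] True by simp
        then show ?thesis by eventually_elim (use True in simp)
      next
        case False
        have "eventually (\<lambda>n. x - z / real (Suc n) \<in> - {a..b}) sequentially"
          by (intro topological_tendstoD[OF l] open_Compl) (use False assms in auto)
        then show ?thesis by eventually_elim (use False in \<open>auto simp: indicator_def\<close>)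
      qed
      then have "(\<lambda>n. indicator {a<..<b} (x - z / real (Suc n)) :: real) \<longlonglongrightarrow> indicator {a<..<b} x"
        by (rule tendsto_eventually)
      then show "(\<lambda>n. indicator {a<..<b} (x - z / real (Suc n)) * std_normal_density z) \<longlonglongrightarrow> indicator {a<..<b} x * std_normal_density z"
        by (intro tendsto_intros)
    qed
  qed (auto simp: indicator_def)
  then have "(\<lambda>n. (LINT z|lborel. indicator {a<..<b} (x - z / real (Suc n)) * std_normal_density z) / (b - a))
     \<longlonglongrightarrow> (LINT z|lborel. indicator {a<..<b} x * std_normal_density z) / (b - a)"
    using assms by (intro tendsto_divide tendsto_const) auto
  then show ?thesis using assms by (simp add: smooth_box_eq del: of_nat_Suc)
qed

lemma AE_lborel_vec_nth_neq: "AE x in (lborel :: (real ^ 'd) measure). x $ j \<noteq> c"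
proof -
  have "(\<integral>\<^sup>+x. (\<Prod>i\<in>UNIV. if i = j then indicator {c} (x $ i) else 1) \<partial>(lborel :: (real ^ 'd) measure))
     = (\<Prod>i\<in>UNIV. \<integral>\<^sup>+x. (if i = j then indicator {c} x else 1) \<partial>lborel)"
    by (rule nn_integral_lborel_vec_prod) simp
  also have "\<dots> = 0" by (intro prod_zero bexI[of _ j]) auto
  finally have "(\<integral>\<^sup>+x. indicator {c} (x $ j) \<partial>(lborel :: (real ^ 'd) measure)) = 0"
    by (simp add: prod.delta del: nn_integral_indicator)
  then have "AE x in (lborel :: (real ^ 'd) measure). indicator {c} (x $ j) = (0::ennreal)"
    by (subst (asm) nn_integral_0_iff_AE) auto
  then show ?thesis by eventually_elim (auto simp: indicator_def)
qed

text \<open>Products of smoothed intervals have integrable spectra, so the multiplication formula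
  makes \<open>u\<close> integrate to 0 against each of them; removing the smoothing by dominated
  convergence gives the box. Pointwise convergence fails at most on finitely many hyperplanes, which
  are null sets.\<close>

lemma fourier_eq_0_imp_box_integral_0:
  fixes u :: "real ^ 'd \<Rightarrow> real" and a b :: "real ^ 'd"
  assumes u: "integrable lborel u" and 0: "AE t in lborel. fourier u t = 0"
    and ab: "\<And>j. a $ j < b $ j"
  shows "(LINT x|lborel. u x * indicator (box a b) x) = 0"
proof -
  have [measurable]: "u \<in> borel_measurable borel" using u by auto
  have "\<exists>Q. \<forall>j. integrable lborel (Q j :: real \<Rightarrow> complex) \<and>
      (\<forall>x. complex_of_real (smooth_box (a $ j) (b $ j) h x) = (LINT s|lborel. iexp (s * (h * x)) * Q j s))" for h
    by (intro choice allI) (metis smooth_box_transform[OF ab])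
  then obtain Q where Q: "\<And>h j. integrable lborel (Q h j :: real \<Rightarrow> complex)"
    "\<And>h j x. complex_of_real (smooth_box (a $ j) (b $ j) h x) = (LINT s|lborel. iexp (s * (h * x)) * Q h j s)"
    by metis
  have z: "(LINT x|lborel. u x * (\<Prod>j\<in>UNIV. smooth_box (a $ j) (b $ j) h (x $ j))) = 0" if h: "0 < h" for h
  proof -
    have int: "integrable lborel (\<lambda>s. iexp (s * y) * Q h j s)" for y j
      by (rule Bochner_Integration.integrable_bound[OF Q(1)[of h j]])
         (use Q(1)[of h j] in \<open>auto simp: norm_mult\<close>)
    have "complex_of_real (\<Prod>j\<in>UNIV. smooth_box (a $ j) (b $ j) h (x $ j))
      = (LINT s|lborel. (\<Prod>j\<in>UNIV. iexp (s $ j * (h * x $ j)) * Q h j (s $ j)))" for x :: "real ^ 'd"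
      unfolding of_real_prod Q(2) by (rule integral_lborel_vec_prod[symmetric]) (rule int)
    also have "\<dots> x = (LINT s|lborel. iexp (s \<bullet> (h *\<^sub>R x)) * (\<Prod>j\<in>UNIV. Q h j (s $ j)))" for x :: "real ^ 'd"
      by (simp add: prod.distrib exp_sum[symmetric] inner_vec_def sum_distrib_left)
    finally have e: "complex_of_real (\<Prod>j\<in>UNIV. smooth_box (a $ j) (b $ j) h (x $ j))
      = (LINT s|lborel. iexp (s \<bullet> (h *\<^sub>R x)) * (\<Prod>j\<in>UNIV. Q h j (s $ j)))" for x :: "real ^ 'd" .
    have "complex_of_real (LINT x|lborel. u x * (\<Prod>j\<in>UNIV. smooth_box (a $ j) (b $ j) h (x $ j)))
      = (LINT x|lborel. complex_of_real (u x) * complex_of_real (\<Prod>j\<in>UNIV. smooth_box (a $ j) (b $ j) h (x $ j)))"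
      unfolding of_real_mult[symmetric] by (rule integral_complex_of_real[symmetric])
    also have "\<dots> = (LINT s|lborel. (\<Prod>j\<in>UNIV. Q h j (s $ j)) * fourier u (h *\<^sub>R s))"
      unfolding e by (intro integral_mult_trig_transform u integrable_lborel_vec_prod Q)
    also have "\<dots> = 0"
    proof (rule integral_eq_zero_AE)
      have "AE s in lborel. fourier u (h *\<^sub>R s) = 0"
        using h by (intro AE_lborel_scale 0) auto
      then show "AE s in lborel. (\<Prod>j\<in>UNIV. Q h j (s $ j)) * fourier u (h *\<^sub>R s) = 0"
        by eventually_elim simp
    qed
    finally show ?thesis by simp
  qed
  have "(\<lambda>n. LINT x|lborel. u x * (\<Prod>j\<in>UNIV. smooth_box (a $ j) (b $ j) (real (Suc n)) (x $ j)))
      \<longlonglongrightarrow> (LINT x|lborel. u x * (\<Prod>j\<in>UNIV. indicator {a $ j<..<b $ j} (x $ j) / (b $ j - a $ j)))"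
  proof (rule integral_dominated_convergence[where w="\<lambda>x. \<bar>u x\<bar> * (\<Prod>j\<in>UNIV. 1 / (b $ j - a $ j))"])
    have "AE x in lborel. \<forall>j. x $ j \<noteq> a $ j \<and> x $ j \<noteq> b $ j"
      by (subst AE_all_countable) (auto intro: AE_lborel_vec_nth_neq)
    then show "AE x in lborel. (\<lambda>n. u x * (\<Prod>j\<in>UNIV. smooth_box (a $ j) (b $ j) (real (Suc n)) (x $ j))) \<longlonglongrightarrow>
       u x * (\<Prod>j\<in>UNIV. indicator {a $ j<..<b $ j} (x $ j) / (b $ j - a $ j))"
      by eventually_elim (intro tendsto_mult tendsto_const tendsto_prod smooth_box_tendsto ab; simp)
    show "AE x in lborel. norm (u x * (\<Prod>j\<in>UNIV. smooth_box (a $ j) (b $ j) (real (Suc n)) (x $ j))) \<le> \<bar>u x\<bar> * (\<Prod>j\<in>UNIV. 1 / (b $ j - a $ j))" for n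
      unfolding real_norm_def abs_mult abs_prod
      using smooth_box_bounds[OF ab, of "real (Suc n)"]
      by (intro AE_I2 mult_left_mono prod_mono) (auto simp del: of_nat_Suc)
  qed (use u in auto)
  moreover have "(\<lambda>n. LINT x|lborel. u x * (\<Prod>j\<in>UNIV. smooth_box (a $ j) (b $ j) (real (Suc n)) (x $ j))) = (\<lambda>n. 0)"
    using z by (simp del: of_nat_Suc)
  ultimately have "(LINT x|lborel. u x * (\<Prod>j\<in>UNIV. indicator {a $ j<..<b $ j} (x $ j) / (b $ j - a $ j))) = 0"
    by (simp only: LIMSEQ_const_iff)
  moreover have "(\<Prod>j\<in>UNIV. indicator {a $ j<..<b $ j} (x $ j) / (b $ j - a $ j)) = indicator (box a b) x * inverse (\<Prod>j\<in>UNIV. b $ j - a $ j)" for x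
    by (auto simp: prod_dividef divide_inverse indicator_def mem_box_cart prod_inversef[symmetric] o_def)
  ultimately have "(LINT x|lborel. u x * indicator (box a b) x) * inverse (\<Prod>j\<in>UNIV. b $ j - a $ j) = 0"
    by (simp add: mult.assoc flip: integral_mult_left_zero)
  moreover have "(\<Prod>j\<in>UNIV. b $ j - a $ j) \<noteq> 0"
    using ab by (metis (no_types, lifting) diff_gt_0_iff_gt finite prod_zero_iff less_irrefl)
  ultimately show ?thesis by simp
qed

text \<open>Boxes are closed under intersection and generate the Borel sets, so integrals over boxes
  determine the measure. Degenerate boxes are empty and are treated apart, since smoothing needs
  intervals of positive length.\<close>

lemma fourier_eq_imp_density_eq:
  fixes f g :: "real ^ 'd \<Rightarrow> real"
  assumes f: "integrable lborel f" "\<And>x. 0 \<le> f x" and g: "integrable lborel g" "\<And>x. 0 \<le> g x"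
    and eq: "AE t in lborel. fourier f t = fourier g t"
  shows "density lborel (\<lambda>x. ennreal (f x)) = density lborel (\<lambda>x. ennreal (g x))"
proof (rule measure_eqI_generator_eq)
  have [measurable]: "f \<in> borel_measurable borel" "g \<in> borel_measurable borel" using f g by auto
  let ?E = "range (\<lambda>(a, b). box a b :: (real ^ 'd) set)"
  have fin: "emeasure (density lborel (\<lambda>x. ennreal (f x))) (box a b) \<noteq> \<infinity>" for a b
  proof -
    have "(\<integral>\<^sup>+x. ennreal (f x) * indicator (box a b) x \<partial>lborel) \<le> (\<integral>\<^sup>+x. ennreal (f x) \<partial>lborel)"
      by (intro nn_integral_mono) (auto simp: indicator_def)
    also have "\<dots> < \<infinity>" using f by (simp add: nn_integral_eq_integral)
    finally show ?thesis by (simp add: emeasure_density)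
  qed
  show "Int_stable ?E" by (auto simp: Int_stable_def box_Int_box)
  show "?E \<subseteq> Pow UNIV" "sets (density lborel (\<lambda>x. ennreal (f x))) = sigma_sets UNIV ?E"
    "sets (density lborel (\<lambda>x. ennreal (g x))) = sigma_sets UNIV ?E"
    by (simp_all add: borel_eq_box sets_measure_of)
  show "range (\<lambda>n::nat. box (- (real n *\<^sub>R One)) (real n *\<^sub>R One)) \<subseteq> ?E" by auto
  show "(\<Union>n::nat. box (- (real n *\<^sub>R One)) (real n *\<^sub>R One) :: (real ^ 'd) set) = UNIV" by (rule UN_box_eq_UNIV)
  show "emeasure (density lborel (\<lambda>x. ennreal (f x))) (box (- (real n *\<^sub>R One)) (real n *\<^sub>R One)) \<noteq> \<infinity>" for n :: nat by (rule fin)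
  fix X assume "X \<in> ?E"
  then obtain a b where X: "X = box a b" by auto
  show "emeasure (density lborel (\<lambda>x. ennreal (f x))) X = emeasure (density lborel (\<lambda>x. ennreal (g x))) X"
  proof (cases "\<forall>j. a $ j < b $ j")
    case True
    have u: "integrable lborel (\<lambda>x. f x - g x)" using f g by auto
    have "fourier (\<lambda>x. f x - g x) t = fourier f t - fourier g t" for t
      using fourier_add[OF f(1) integrable_mult_right[OF g(1)], of "- 1" t] fourier_cmult[of "- 1" g t] by simp
    then have "(LINT x|lborel. (f x - g x) * indicator (box a b) x) = 0"
      using eq True by (intro fourier_eq_0_imp_box_integral_0 u) auto
    moreover have i: "integrable lborel (\<lambda>x. f x * indicator (box a b) x)" "integrable lborel (\<lambda>x. g x * indicator (box a b) x)"
      by (rule Bochner_Integration.integrable_bound[OF f(1)] Bochner_Integration.integrable_bound[OF g(1)]; simp add: indicator_def)+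
    ultimately have "(LINT x|lborel. f x * indicator (box a b) x) = (LINT x|lborel. g x * indicator (box a b) x)"
      by (simp add: left_diff_distrib)
    moreover have "emeasure (density lborel (\<lambda>x. ennreal (f x))) (box a b) = ennreal (LINT x|lborel. f x * indicator (box a b) x)"
      using i f by (subst nn_integral_eq_integral[symmetric]) (auto simp: emeasure_density indicator_def intro!: nn_integral_cong)
    moreover have "emeasure (density lborel (\<lambda>x. ennreal (g x))) (box a b) = ennreal (LINT x|lborel. g x * indicator (box a b) x)"
      using i g by (subst nn_integral_eq_integral[symmetric]) (auto simp: emeasure_density indicator_def intro!: nn_integral_cong)
    ultimately show ?thesis by (simp add: X)
  next
    case False
    then obtain j where "\<not> a $ j < b $ j" by blast
    then have "x \<notin> box a b" for x by (auto simp: mem_box_cart dest: order_less_trans)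
    then have "box a b = {}" by blast
    then show ?thesis by (simp add: X)
  qed
qed

section \<open>The Sobolev functional and a point strictly inside its ball\<close>

definition sob :: "real \<Rightarrow> (real ^ 'd \<Rightarrow> real) \<Rightarrow> ennreal" where
  "sob \<alpha> f = (\<Sum>j\<in>UNIV. \<integral>\<^sup>+ t. ennreal ((cmod (fourier f t))\<^sup>2 * (1 + (t $ j)\<^sup>2) powr \<alpha>) \<partial>lborel)"

text \<open>The parallelogram identity is exact for this functional: its value at the midpoint plus
  its value at the half difference is the mean of the two given values. The half difference
  contributes a positive amount, because transforms agreeing almost everywhere would force the two
  measures to be equal.\<close>

lemma strict_element:
  fixes \<alpha> L M :: real
  assumes "\<exists>\<mu> \<in> D_class \<alpha> L M. \<exists>\<nu> \<in> (D_class \<alpha> L M :: (real ^ 'd) measure set). \<mu> \<noteq> \<nu>"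
  obtains f where "integrable lborel f" "\<And>x. 0 \<le> f x" "(\<integral>\<^sup>+x. ennreal (f x) \<partial>lborel) = 1"
    "(\<integral>\<^sup>+x. ennreal (norm x * f x) \<partial>lborel) \<le> ennreal M" "sob \<alpha> (f :: real ^ 'd \<Rightarrow> real) < ennreal (L\<^sup>2)"
proof -
  obtain \<mu> \<nu> :: "(real ^ 'd) measure" where mn: "\<mu> \<in> D_class \<alpha> L M" "\<nu> \<in> D_class \<alpha> L M" "\<mu> \<noteq> \<nu>"
    using assms by blast
  have el: "\<exists>f. integrable lborel f \<and> (\<forall>x. 0 \<le> f x) \<and> (\<integral>\<^sup>+x. ennreal (f x) \<partial>lborel) = 1 \<and>
    (\<integral>\<^sup>+x. ennreal (norm x * f x) \<partial>lborel) \<le> ennreal M \<and> sob \<alpha> f \<le> ennreal (L\<^sup>2) \<and> \<mu> = density lborel (\<lambda>x. ennreal (f x))"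
    if mu: "\<mu> \<in> D_class \<alpha> L M" for \<mu> :: "(real ^ 'd) measure"
  proof -
    obtain f where f: "f \<in> sobolev_class \<alpha> L" "\<And>x. 0 \<le> f x" "\<mu> = density lborel (\<lambda>x. ennreal (f x))"
      using mu by (auto simp: D_class_def)
    have i: "integrable lborel f" using f by (simp add: sobolev_class_def)
    then have [measurable]: "f \<in> borel_measurable borel" by auto
    interpret prob_space \<mu> using mu by (simp add: D_class_def P1_class_def)
    have "(\<integral>\<^sup>+x. ennreal (f x) \<partial>lborel) = 1"
      using emeasure_space_1 unfolding f by (simp add: emeasure_density)
    moreover have "(\<integral>\<^sup>+x. ennreal (norm x * f x) \<partial>lborel) \<le> ennreal M"
      using mu f(2) unfolding D_class_def P1_class_def f(3)
      by (simp add: nn_integral_density ennreal_mult mult.commute)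
    ultimately show ?thesis using f i by (auto simp: sobolev_class_def sob_def)
  qed
  from el[OF mn(1)] obtain f where f: "integrable lborel f" "\<And>x. 0 \<le> f x" "(\<integral>\<^sup>+x. ennreal (f x) \<partial>lborel) = 1"
    "(\<integral>\<^sup>+x. ennreal (norm x * f x) \<partial>lborel) \<le> ennreal M" "sob \<alpha> f \<le> ennreal (L\<^sup>2)" "\<mu> = density lborel (\<lambda>x. ennreal (f x))" by blast
  from el[OF mn(2)] obtain g where g: "integrable lborel g" "\<And>x. 0 \<le> g x" "(\<integral>\<^sup>+x. ennreal (g x) \<partial>lborel) = 1"
    "(\<integral>\<^sup>+x. ennreal (norm x * g x) \<partial>lborel) \<le> ennreal M" "sob \<alpha> g \<le> ennreal (L\<^sup>2)" "\<nu> = density lborel (\<lambda>x. ennreal (g x))" by blast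
  have [measurable]: "f \<in> borel_measurable borel" "g \<in> borel_measurable borel" using f g by auto
  define m where "m = (\<lambda>x. 1/2 * f x + 1/2 * g x)"
  define u where "u = (\<lambda>x. 1/2 * f x + (- 1/2) * g x)"
  have fm: "fourier m t = (1/2) * (fourier f t + fourier g t)" for t
    unfolding m_def using fourier_add[OF integrable_mult_right[OF f(1)] integrable_mult_right[OF g(1)]]
    by (simp only: fourier_cmult) (simp add: algebra_simps)
  have fu: "fourier u t = (1/2) * (fourier f t - fourier g t)" for t
    unfolding u_def using fourier_add[OF integrable_mult_right[OF f(1)] integrable_mult_right[OF g(1)]]
    by (simp only: fourier_cmult) (simp add: algebra_simps)
  have half: "ennreal (1/2) * x + ennreal (1/2) * x = x" for x
  proof -
    have "ennreal (1/2) + ennreal (1/2) = 1" by (subst ennreal_plus[symmetric]) auto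
    then show ?thesis by (metis distrib_right mult_1)
  qed
  have comb: "ennreal (1/2 * p + 1/2 * q) = ennreal (1/2) * ennreal p + ennreal (1/2) * ennreal q" if "0 \<le> p" "0 \<le> q" for p q
    by (simp only: ennreal_mult[symmetric] ennreal_plus[symmetric] that mult_nonneg_nonneg zero_le_divide_1_iff zero_le_numeral)
  have "sob \<alpha> m + sob \<alpha> u = ennreal (1/2) * sob \<alpha> f + ennreal (1/2) * sob \<alpha> g"
  proof -
    have pw: "ennreal ((cmod (fourier m t))\<^sup>2 * w) + ennreal ((cmod (fourier u t))\<^sup>2 * w)
      = ennreal (1/2) * ennreal ((cmod (fourier f t))\<^sup>2 * w) + ennreal (1/2) * ennreal ((cmod (fourier g t))\<^sup>2 * w)" if "0 \<le> w" for t w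
    proof -
      have "(cmod (fourier m t))\<^sup>2 + (cmod (fourier u t))\<^sup>2 = 1/2 * (cmod (fourier f t))\<^sup>2 + 1/2 * (cmod (fourier g t))\<^sup>2"
      proof -
        have "(cmod (z + w))\<^sup>2 + (cmod (z - w))\<^sup>2 = 2 * (cmod z)\<^sup>2 + 2 * (cmod w)\<^sup>2" for z w
          unfolding cmod_power2 by (simp add: power2_eq_square algebra_simps)
        from this[of "fourier f t" "fourier g t"] show ?thesis
          unfolding fm fu norm_mult power_mult_distrib by (simp add: power2_eq_square)
      qed
      then have "(cmod (fourier m t))\<^sup>2 * w + (cmod (fourier u t))\<^sup>2 * w = 1/2 * ((cmod (fourier f t))\<^sup>2 * w) + 1/2 * ((cmod (fourier g t))\<^sup>2 * w)"
        by (metis (no_types) distrib_right mult.assoc)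
      then show ?thesis using that
        by (simp only: comb[symmetric] ennreal_plus[symmetric] mult_nonneg_nonneg zero_le_power2)
    qed
    have [measurable]: "m \<in> borel_measurable borel" "u \<in> borel_measurable borel" by (auto simp: m_def u_def)
    show ?thesis
      unfolding sob_def sum.distrib[symmetric] sum_distrib_left
      by (intro sum.cong refl) (simp add: pw nn_integral_add[symmetric] nn_integral_cmult[symmetric])
  qed
  also have "\<dots> \<le> ennreal (1/2) * ennreal (L\<^sup>2) + ennreal (1/2) * ennreal (L\<^sup>2)"
    by (intro add_mono mult_left_mono f g) auto
  finally have le: "sob \<alpha> m + sob \<alpha> u \<le> ennreal (L\<^sup>2)" by (simp only: half)
  have "sob \<alpha> u \<noteq> 0"
  proof
    assume "sob \<alpha> u = 0"
    then have "(\<integral>\<^sup>+ t. ennreal ((cmod (fourier u t))\<^sup>2 * (1 + (t $ j)\<^sup>2) powr \<alpha>) \<partial>lborel) = 0" for j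
      by (simp add: sob_def sum_nonneg_eq_0_iff)
    \<comment> \<open>Any coordinate serves, and \<open>undefined\<close> is one of them. The weight
      is positive, so only the transform can vanish.\<close>
    then have "AE t in lborel. ennreal ((cmod (fourier u t))\<^sup>2 * (1 + (t $ undefined)\<^sup>2) powr \<alpha>) = 0"
      by (subst (asm) nn_integral_0_iff_AE) (auto simp: u_def)
    then have "AE t in lborel. fourier f t = fourier g t"
    proof eventually_elim
      fix t :: "real ^ 'd" assume a: "ennreal ((cmod (fourier u t))\<^sup>2 * (1 + (t $ undefined)\<^sup>2) powr \<alpha>) = 0"
      have "0 < 1 + (t $ undefined)\<^sup>2" by (simp add: add_pos_nonneg)
      then have "0 < (1 + (t $ undefined)\<^sup>2) powr \<alpha>" by simp
      with a have "cmod (fourier u t) = 0"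
        by (simp add: ennreal_eq_0_iff mult_le_0_iff)
      then show "fourier f t = fourier g t" by (simp add: fu)
    qed
    then show False using mn(3) fourier_eq_imp_density_eq[OF f(1,2) g(1,2)] by (simp add: f g)
  qed
  \<comment> \<open>Adding a positive amount is strict in \<open>ennreal\<close> only for finite
    \<open>sob \<alpha> m\<close>; finiteness follows from \<open>le\<close>.\<close>
  then have "sob \<alpha> m < sob \<alpha> m + sob \<alpha> u"
    using order_le_less_trans[OF order_trans[OF _ le] ennreal_less_top, of "sob \<alpha> m"]
      ennreal_add_left_cancel_less[of "sob \<alpha> m" 0 "sob \<alpha> u"] by (simp add: zero_less_iff_neq_zero less_top)
  then have "sob \<alpha> m < ennreal (L\<^sup>2)" using le by (rule order_less_le_trans)
  moreover have lin: "(\<integral>\<^sup>+x. ennreal (w x * m x) \<partial>lborel) = ennreal (1/2) * (\<integral>\<^sup>+x. ennreal (w x * f x) \<partial>lborel) + ennreal (1/2) * (\<integral>\<^sup>+x. ennreal (w x * g x) \<partial>lborel)"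
    if [measurable]: "w \<in> borel_measurable borel" and w: "\<And>x. 0 \<le> w x" for w :: "real ^ 'd \<Rightarrow> real"
  proof -
    have "ennreal (w x * m x) = ennreal (1/2) * ennreal (w x * f x) + ennreal (1/2) * ennreal (w x * g x)" for x
      using f(2)[of x] g(2)[of x] w[of x]
      by (subst comb[symmetric]) (auto simp: m_def algebra_simps)
    then show ?thesis by (simp add: nn_integral_add nn_integral_cmult)
  qed
  have "(\<integral>\<^sup>+x. ennreal (m x) \<partial>lborel) = 1"
    using lin[of "\<lambda>_. 1"] half[of 1] by (simp add: f g)
  moreover have "(\<integral>\<^sup>+x. ennreal (norm x * m x) \<partial>lborel) \<le> ennreal M"
  proof -
    have "(\<integral>\<^sup>+x. ennreal (norm x * m x) \<partial>lborel) \<le> ennreal (1/2) * ennreal M + ennreal (1/2) * ennreal M"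
      by (subst lin) (auto intro!: add_mono mult_left_mono f(4) g(4))
    then show ?thesis by (simp only: half)
  qed
  moreover have "integrable lborel m" "\<And>x. 0 \<le> m x"
    using f g by (auto simp: m_def)
  ultimately show thesis using that[of m] by blast
qed

section \<open>Sobolev norms of tensor products\<close>

text \<open>The one-dimensional building block. At \<open>a = 0\<close> it is the squared
  \<open>L\<^sup>2\<close> norm of the transform.\<close>

definition sob1 :: "real \<Rightarrow> (real \<Rightarrow> real) \<Rightarrow> ennreal" where
  "sob1 a f = (\<integral>\<^sup>+t. ennreal ((cmod (fourier f t))\<^sup>2 * (1 + t\<^sup>2) powr a) \<partial>lborel)"

lemma sob_prod:
  fixes f :: "'d::finite \<Rightarrow> real \<Rightarrow> real"
  assumes "\<And>j. integrable lborel (f j)"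
  shows "sob \<alpha> (\<lambda>x::real ^ 'd. \<Prod>j\<in>UNIV. f j (x $ j)) = (\<Sum>i\<in>UNIV. \<Prod>j\<in>UNIV. sob1 (if j = i then \<alpha> else 0) (f j))"
  unfolding sob_def
proof (intro sum.cong refl)
  fix i :: 'd
  have [measurable]: "f j \<in> borel_measurable borel" for j using assms[of j] by auto
  \<comment> \<open>\<open>0 powr 0\<close> is 0, so a weight with exponent 0 equals 1 only once its
    base is known to be nonzero.\<close>
  have one: "1 + t\<^sup>2 \<noteq> 0" for t :: real by (metis add_pos_nonneg less_irrefl zero_le_power2 zero_less_one)
  have "ennreal ((cmod (fourier (\<lambda>x::real ^ 'd. \<Prod>j\<in>UNIV. f j (x $ j)) t))\<^sup>2 * (1 + (t $ i)\<^sup>2) powr \<alpha>)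
    = (\<Prod>j\<in>UNIV. ennreal ((cmod (fourier (f j) (t $ j)))\<^sup>2 * (1 + (t $ j)\<^sup>2) powr (if j = i then \<alpha> else 0)))" for t
  proof -
    have "(\<Prod>j\<in>UNIV. (1 + (t $ j)\<^sup>2) powr (if j = i then \<alpha> else 0)) = (\<Prod>j\<in>UNIV. if j = i then (1 + (t $ j)\<^sup>2) powr \<alpha> else 1)"
      using one by (intro prod.cong) auto
    then have "(\<Prod>j\<in>UNIV. (1 + (t $ j)\<^sup>2) powr (if j = i then \<alpha> else 0)) = (1 + (t $ i)\<^sup>2) powr \<alpha>"
      by (simp add: prod.delta)
    then show ?thesis
      unfolding fourier_prod[OF assms] by (simp add: prod_ennreal prod.distrib prod_norm[symmetric] prod_power_distrib)
  qed
  then show "(\<integral>\<^sup>+ t. ennreal ((cmod (fourier (\<lambda>x::real ^ 'd. \<Prod>j\<in>UNIV. f j (x $ j)) t))\<^sup>2 * (1 + (t $ i)\<^sup>2) powr \<alpha>) \<partial>lborel)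
    = (\<Prod>j\<in>UNIV. sob1 (if j = i then \<alpha> else 0) (f j))"
    unfolding sob1_def by (simp add: nn_integral_lborel_vec_prod[symmetric])
qed

lemma powr_gauss_le:
  fixes a :: real
  assumes "0 \<le> a"
  obtains C where "0 < C" "\<And>u. (1 + \<bar>u\<bar>) powr a * exp (- u\<^sup>2) \<le> C * exp (- u\<^sup>2 / 2)"
proof -
  obtain K where K: "a \<le> real K" using real_arch_simple by blast
  have "(1 + \<bar>u\<bar>) powr a * exp (- u\<^sup>2) \<le> (fact K * exp 2) * exp (- u\<^sup>2 / 2)" for u
  proof -
    have "(1 + \<bar>u\<bar>) powr a \<le> (1 + \<bar>u\<bar>) powr real K" using K by (intro powr_mono) auto
    also have "\<dots> = (1 + \<bar>u\<bar>) ^ K" by (simp add: powr_realpow)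
    finally have "(1 + \<bar>u\<bar>) powr a * exp (- u\<^sup>2 / 2) \<le> (1 + \<bar>u\<bar>) ^ K * exp (- u\<^sup>2 / 2)" by (intro mult_right_mono) auto
    also have "\<dots> \<le> fact K * exp 2 * exp (- u\<^sup>2 / 4)" by (rule power_gauss_le)
    also have "\<dots> \<le> fact K * exp 2 * 1" by (intro mult_left_mono) auto
    finally have "(1 + \<bar>u\<bar>) powr a * exp (- u\<^sup>2 / 2) * exp (- u\<^sup>2 / 2) \<le> fact K * exp 2 * exp (- u\<^sup>2 / 2)"
      by (intro mult_right_mono) auto
    then show ?thesis by (simp add: mult.assoc flip: exp_add)
  qed
  then show thesis by (intro that[of "fact K * exp 2"]) auto
qed

lemma one_plus_sq_powr_le:
  fixes a t :: real
  assumes "0 \<le> a"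
  shows "(1 + t\<^sup>2) powr a \<le> (1 + \<bar>t\<bar>) powr (2 * a)"
proof -
  have "1 + t\<^sup>2 \<le> (1 + \<bar>t\<bar>)\<^sup>2" by (simp add: power2_eq_square algebra_simps)
  then have "(1 + t\<^sup>2) powr a \<le> ((1 + \<bar>t\<bar>)\<^sup>2) powr a" using assms by (intro powr_mono2) auto
  also have "(1 + \<bar>t\<bar>)\<^sup>2 = (1 + \<bar>t\<bar>) powr 2" by (simp add: powr_numeral)
  finally show ?thesis by (simp only: powr_powr)
qed

text \<open>For \<open>h \<le> 1\<close> one has
  \<open>1 + \<bar>t\<bar> \<le> (1 + \<bar>t * h\<bar>) / h\<close>. The Sobolev weight thus costs
  \<open>h powr (- (2 * a))\<close> and a power of \<open>1 + \<bar>t * h\<bar>\<close>, which half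
  of the Gaussian absorbs.\<close>

lemma scaled_gauss_le:
  fixes a :: real
  assumes "0 \<le> a"
  obtains C where "0 < C" "\<And>h t. 0 < h \<Longrightarrow> h \<le> 1 \<Longrightarrow>
    (1 + t\<^sup>2) powr a * exp (- (t * h)\<^sup>2) \<le> C * h powr (- (2 * a)) * exp (- (t * h)\<^sup>2 / 2)"
proof -
  obtain C where C: "0 < C" "\<And>u. (1 + \<bar>u\<bar>) powr (2 * a) * exp (- u\<^sup>2) \<le> C * exp (- u\<^sup>2 / 2)"
    using powr_gauss_le[of "2 * a"] assms by auto
  have "(1 + t\<^sup>2) powr a * exp (- (t * h)\<^sup>2) \<le> C * h powr (- (2 * a)) * exp (- (t * h)\<^sup>2 / 2)" if h: "0 < h" "h \<le> 1" for h t
  proof -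
    have "(1 + t\<^sup>2) powr a \<le> (1 + \<bar>t\<bar>) powr (2 * a)" using assms by (rule one_plus_sq_powr_le)
    also have "\<dots> \<le> ((1 + \<bar>t * h\<bar>) / h) powr (2 * a)"
      using h assms by (intro powr_mono2) (auto simp: field_simps abs_mult)
    also have "\<dots> = (1 + \<bar>t * h\<bar>) powr (2 * a) * h powr (- (2 * a))"
      using h by (subst powr_divide) (auto simp: powr_minus_divide)
    finally have le: "(1 + t\<^sup>2) powr a \<le> (1 + \<bar>t * h\<bar>) powr (2 * a) * h powr (- (2 * a))" .
    have "(1 + t\<^sup>2) powr a * exp (- (t * h)\<^sup>2) \<le> h powr (- (2 * a)) * ((1 + \<bar>t * h\<bar>) powr (2 * a) * exp (- (t * h)\<^sup>2))"
      using mult_right_mono[OF le, of "exp (- (t * h)\<^sup>2)"] by (simp add: mult_ac)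
    also have "\<dots> \<le> h powr (- (2 * a)) * (C * exp (- (t * h)\<^sup>2 / 2))"
      by (intro mult_left_mono C) auto
    finally show ?thesis by (simp add: mult_ac)
  qed
  with C(1) show thesis using that by blast
qed

lemma std_normal_density_exp: "exp (- u\<^sup>2 / 2) = sqrt (2 * pi) * std_normal_density u"
  by (simp add: std_normal_density_def)

lemma nn_integral_scale:
  fixes f :: "real \<Rightarrow> ennreal"
  assumes "f \<in> borel_measurable borel" "0 < h"
  shows "(\<integral>\<^sup>+t. f (t * h) \<partial>lborel) = ennreal (1 / h) * (\<integral>\<^sup>+u. f u \<partial>lborel)"
proof -
  have "(\<integral>\<^sup>+u. f u \<partial>lborel) = ennreal \<bar>h\<bar> * (\<integral>\<^sup>+t. f (0 + h * t) \<partial>lborel)"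
    using assms by (intro nn_integral_real_affine) auto
  then have "ennreal (1 / h) * (\<integral>\<^sup>+u. f u \<partial>lborel) = (ennreal (1 / h) * ennreal h) * (\<integral>\<^sup>+t. f (t * h) \<partial>lborel)"
    using assms by (simp add: mult_ac)
  also have "ennreal (1 / h) * ennreal h = 1"
    using assms by (subst ennreal_mult[symmetric]) auto
  finally show ?thesis by simp
qed

lemma sob1_gauss_finite:
  assumes "0 \<le> a" "0 < s" "s \<le> 1" and f: "\<And>t. cmod (fourier f t) \<le> exp (- (t * s)\<^sup>2 / 2)"
  shows "sob1 a f < \<infinity>"
proof -
  obtain C where C: "0 < C" "\<And>h t. 0 < h \<Longrightarrow> h \<le> 1 \<Longrightarrow>
    (1 + t\<^sup>2) powr a * exp (- (t * h)\<^sup>2) \<le> C * h powr (- (2 * a)) * exp (- (t * h)\<^sup>2 / 2)"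
    using scaled_gauss_le[OF assms(1)] by blast
  let ?K = "C * s powr (- (2 * a)) * sqrt (2 * pi)"
  have "sob1 a f \<le> (\<integral>\<^sup>+t. ennreal ?K * ennreal (std_normal_density (t * s)) \<partial>lborel)"
    unfolding sob1_def
  proof (intro nn_integral_mono)
    fix t
    have "(cmod (fourier f t))\<^sup>2 * (1 + t\<^sup>2) powr a \<le> (exp (- (t * s)\<^sup>2 / 2))\<^sup>2 * (1 + t\<^sup>2) powr a"
      by (intro mult_right_mono power_mono f) auto
    also have "(exp (- (t * s)\<^sup>2 / 2))\<^sup>2 = exp (- (t * s)\<^sup>2)"
      by (simp add: power2_eq_square[of "exp _"] flip: exp_add)
    also have "exp (- (t * s)\<^sup>2) * (1 + t\<^sup>2) powr a \<le> C * s powr (- (2 * a)) * exp (- (t * s)\<^sup>2 / 2)"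
      using C(2)[OF assms(2,3), of t] by (simp add: mult.commute)
    also have "\<dots> = ?K * std_normal_density (t * s)" by (simp only: std_normal_density_exp mult_ac)
    finally show "ennreal ((cmod (fourier f t))\<^sup>2 * (1 + t\<^sup>2) powr a) \<le> ennreal ?K * ennreal (std_normal_density (t * s))"
      using C(1) by (simp add: ennreal_mult[symmetric] ennreal_leI)
  qed
  also have "\<dots> = ennreal ?K * (ennreal (1 / s) * (\<integral>\<^sup>+u. ennreal (std_normal_density u) \<partial>lborel))"
    using assms by (simp add: nn_integral_cmult nn_integral_scale[of "\<lambda>u. ennreal (std_normal_density u)"])
  also have "\<dots> < \<infinity>" by (simp add: nn_integral_eq_integral ennreal_mult_less_top)
  finally show ?thesis .
qed

section \<open>A heavy-tailed density with Gaussian Fourier decay\<close>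

text \<open>
  The exponent \<open>5 / 2\<close> is small enough for the squares of functions with decay \<open>1 / x\<^sup>2\<close> (two
  integrations by parts) to be integrable against the inverse of the density, and large enough for a first moment.
\<close>

lemma heavy_tail_density:
  assumes "0 < m"
  obtains \<phi> :: "real \<Rightarrow> real" and c s :: real where
    "integrable lborel \<phi>" "\<And>x. 0 \<le> \<phi> x" "(\<integral>\<^sup>+x. ennreal (\<phi> x) \<partial>lborel) = 1"
    "(\<integral>\<^sup>+x. ennreal (\<bar>x\<bar> * \<phi> x) \<partial>lborel) \<le> ennreal m"
    "0 < c" "\<And>x. c * (1 + \<bar>x\<bar>) powr (- (5/2)) \<le> \<phi> x"
    "0 < s" "s \<le> 1" "\<And>t. cmod (fourier \<phi> t) \<le> exp (- (t * s)\<^sup>2 / 2)"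
proof -
  let ?w = "\<lambda>x::real. (1 + \<bar>x\<bar>) powr (- (5/2))" and ?G = std_normal_density
  have wle: "?w x \<le> (1 + \<bar>x\<bar>) powr (- (3/2))" for x by (intro powr_mono) auto
  have xw: "\<bar>x\<bar> * ?w x \<le> (1 + \<bar>x\<bar>) powr (- (3/2))" for x
  proof -
    have "\<bar>x\<bar> * ?w x \<le> (1 + \<bar>x\<bar>) powr 1 * ?w x" by (intro mult_right_mono) auto
    also have "\<dots> = (1 + \<bar>x\<bar>) powr (1 + - (5/2))" by (simp only: powr_add)
    finally show ?thesis by simp
  qed
  have iw: "integrable lborel ?w" and ixw: "integrable lborel (\<lambda>x. \<bar>x\<bar> * ?w x)"
    by (rule Bochner_Integration.integrable_bound[OF integrable_weight], measurable, rule AE_I2,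
        simp only: real_norm_def abs_mult abs_abs abs_of_nonneg[OF powr_ge_zero] wle xw)+
  define W where "W = (LINT x|lborel. ?w x)"
  have pos_int: "0 < (LINT x|lborel. g x)" if "integrable lborel g" "\<And>x. 0 < g x" for g :: "real \<Rightarrow> real"
  proof -
    have "0 \<le> (LINT x|lborel. g x)" using that by (intro integral_nonneg_AE) (auto intro: less_imp_le)
    moreover have "(LINT x|lborel. g x) \<noteq> 0"
    proof
      assume "(LINT x|lborel. g x) = 0"
      then have "AE x in lborel. g x = 0"
        using that by (subst (asm) integral_nonneg_eq_0_iff_AE) (auto intro: less_imp_le)
      then have "AE x in (lborel :: real measure). False" by eventually_elim (metis that(2) less_irrefl)
      then show False by (simp add: AE_iff_null ) (simp add: null_sets_def)
    qed
    ultimately show ?thesis by linarith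
  qed
  have W: "0 < W" unfolding W_def using iw by (intro pos_int) auto
  define q where "q = (\<lambda>x. ?w x / W)"
  have iq: "integrable lborel q" unfolding q_def using iw by auto
  have q0: "0 \<le> q x" for x using W by (simp add: q_def)
  have [measurable]: "q \<in> borel_measurable borel" unfolding q_def by measurable
  have q1: "(LINT x|lborel. q x) = 1" using W by (simp add: q_def W_def)
  define \<epsilon> where "\<epsilon> = density lborel (\<lambda>x. ennreal (q x))"
  have "(\<integral>\<^sup>+x. ennreal (q x) \<partial>lborel) = 1" using iq q0 q1 by (simp add: nn_integral_eq_integral)
  then interpret prob_space \<epsilon> by (intro prob_spaceI) (simp add: \<epsilon>_def emeasure_density)
  have [measurable_cong]: "sets \<epsilon> = sets borel" by (simp add: \<epsilon>_def)
  interpret pair_sigma_finite lborel \<epsilon> by unfold_locales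
  \<comment> \<open>Convolving the normalised weight with a Gaussian keeps the polynomial tail and
    gives the transform the factor \<open>exp (- t\<^sup>2 / 2)\<close>.\<close>
  define p where "p = (\<lambda>x. LINT y|\<epsilon>. ?G (x - y))"
  have G1: "?G x \<le> 1" for x by (rule order_trans[OF std_normal_density_le]) simp
  have iG: "integrable \<epsilon> (\<lambda>y. ?G (x - y))" for x
    using G1 by (intro integrable_const_bound[of _ 1]) auto
  have [measurable]: "p \<in> borel_measurable borel" unfolding p_def by measurable
  have p0: "0 \<le> p x" for x unfolding p_def by (intro integral_nonneg_AE) auto
  have pe: "ennreal (p x) = (\<integral>\<^sup>+y. ennreal (?G (x - y)) \<partial>\<epsilon>)" for x
    unfolding p_def using iG by (intro nn_integral_eq_integral[symmetric]) auto
  have Gy: "(\<integral>\<^sup>+x. f (x - y) * ennreal (?G (x - y)) \<partial>lborel) = (\<integral>\<^sup>+x. f x * ennreal (?G x) \<partial>lborel)"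
    if [measurable]: "f \<in> borel_measurable borel" for f y
    using nn_integral_shift_lborel[of "\<lambda>x. f x * ennreal (?G x)" "- y"] by simp
  have Gn: "(\<integral>\<^sup>+x. ennreal (?G x) \<partial>lborel) = 1" by (simp add: nn_integral_eq_integral)
  have p1: "(\<integral>\<^sup>+x. ennreal (p x) \<partial>lborel) = 1"
  proof -
    have "(\<integral>\<^sup>+x. ennreal (p x) \<partial>lborel) = (\<integral>\<^sup>+y. \<integral>\<^sup>+x. ennreal (?G (x - y)) \<partial>lborel \<partial>\<epsilon>)"
      unfolding pe by (rule Fubini'[symmetric]) simp
    also have "\<dots> = 1" using Gy[of "\<lambda>_. 1"] by (simp add: Gn emeasure_space_1)
    finally show ?thesis .
  qed
  have ip: "integrable lborel p" by (rule integrableI_nn_integral_finite[where x=1]) (auto simp: p0 p1)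
  \<comment> \<open>By the triangle inequality the first moment of the convolution is at most the
    sum of the first moments of its two factors.\<close>
  define m0 where "m0 = (LINT y|lborel. q y * \<bar>y\<bar>) + (LINT x|lborel. ?G x * \<bar>x\<bar>)"
  have m00: "0 \<le> m0" unfolding m0_def using q0 by (intro add_nonneg_nonneg integral_nonneg_AE) auto
  have pm: "(\<integral>\<^sup>+x. ennreal (\<bar>x\<bar> * p x) \<partial>lborel) \<le> ennreal m0"
  proof -
    have iqx: "integrable lborel (\<lambda>y. q y * \<bar>y\<bar>)" using ixw W by (simp add: q_def mult.commute)
    have iGx: "integrable lborel (\<lambda>y. ?G y * \<bar>y\<bar>)" using integrable_std_normal_moment_abs[of 1] by simp
    have "(\<integral>\<^sup>+x. ennreal (\<bar>x\<bar> * p x) \<partial>lborel) = (\<integral>\<^sup>+x. \<integral>\<^sup>+y. ennreal \<bar>x\<bar> * ennreal (?G (x - y)) \<partial>\<epsilon> \<partial>lborel)"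
      using p0 by (simp add: ennreal_mult pe nn_integral_cmult)
    also have "\<dots> = (\<integral>\<^sup>+y. \<integral>\<^sup>+x. ennreal \<bar>x\<bar> * ennreal (?G (x - y)) \<partial>lborel \<partial>\<epsilon>)"
      by (rule Fubini'[symmetric]) simp
    also have "\<dots> \<le> (\<integral>\<^sup>+y. \<integral>\<^sup>+x. ennreal \<bar>y\<bar> * ennreal (?G (x - y)) + ennreal \<bar>x - y\<bar> * ennreal (?G (x - y)) \<partial>lborel \<partial>\<epsilon>)"
    proof (intro nn_integral_mono)
      fix x y :: real
      have "\<bar>x\<bar> * ?G (x - y) \<le> (\<bar>y\<bar> + \<bar>x - y\<bar>) * ?G (x - y)" by (intro mult_right_mono) auto
      then show "ennreal \<bar>x\<bar> * ennreal (?G (x - y)) \<le> ennreal \<bar>y\<bar> * ennreal (?G (x - y)) + ennreal \<bar>x - y\<bar> * ennreal (?G (x - y))"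
        by (simp add: ennreal_mult[symmetric] ennreal_plus[symmetric] distrib_right del: ennreal_plus)
    qed
    also have "\<dots> = (\<integral>\<^sup>+y. ennreal \<bar>y\<bar> + (\<integral>\<^sup>+x. ennreal \<bar>x\<bar> * ennreal (?G x) \<partial>lborel) \<partial>\<epsilon>)"
      using Gy[of "\<lambda>_. 1"] Gy[of "\<lambda>x. ennreal \<bar>x\<bar>"] by (simp add: nn_integral_add nn_integral_cmult Gn)
    also have "\<dots> = (\<integral>\<^sup>+y. ennreal (q y * \<bar>y\<bar>) \<partial>lborel) + (\<integral>\<^sup>+x. ennreal (?G x * \<bar>x\<bar>) \<partial>lborel)"
      using q0 by (simp add: nn_integral_add emeasure_space_1 ennreal_mult mult.commute)
        (simp add: \<epsilon>_def nn_integral_density mult.commute)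
    also have "\<dots> = ennreal m0"
      unfolding m0_def using iqx iGx q0
      by (subst (1 2) nn_integral_eq_integral) (auto simp: ennreal_plus integral_nonneg_AE)
    finally show ?thesis .
  qed
  have pf: "cmod (fourier p t) \<le> exp (- t\<^sup>2 / 2)" for t
  proof -
    have "integrable (lborel \<Otimes>\<^sub>M \<epsilon>) (\<lambda>(x, y). iexp (t * x) * ?G (x - y))"
    proof (rule Fubini_integrable)
      have "(\<lambda>x. LINT y|\<epsilon>. cmod (case (x, y) of (x, y) \<Rightarrow> iexp (t * x) * ?G (x - y))) = p"
        by (auto simp: p_def norm_mult)
      then show "integrable lborel (\<lambda>x. LINT y|\<epsilon>. cmod (case (x, y) of (x, y) \<Rightarrow> iexp (t * x) * ?G (x - y)))"
        using ip by simp
      show "AE x in lborel. integrable \<epsilon> (\<lambda>y. case (x, y) of (x, y) \<Rightarrow> iexp (t * x) * ?G (x - y))"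
        using iG by (intro AE_I2) (auto intro!: integrable_mult_right integrable_of_real)
    qed auto
    from Fubini_integral[OF this]
    have "(LINT x|lborel. LINT y|\<epsilon>. iexp (t * x) * ?G (x - y)) = (LINT y|\<epsilon>. LINT x|lborel. iexp (t * x) * ?G (x - y))"
      by simp
    also have "(LINT x|lborel. LINT y|\<epsilon>. iexp (t * x) * ?G (x - y)) = fourier p t"
      unfolding fourier_def p_def by (simp add: integral_mult_right_zero)
    also have "(LINT y|\<epsilon>. LINT x|lborel. iexp (t * x) * ?G (x - y)) = (LINT y|\<epsilon>. iexp (t * y) * exp (- t\<^sup>2 / 2))"
    proof (intro Bochner_Integration.integral_cong refl)
      fix y
      show "(LINT x|lborel. iexp (t * x) * ?G (x - y)) = iexp (t * y) * exp (- t\<^sup>2 / 2)"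
        using fourier_affine[of 1 ?G y t] by (simp add: fourier_def fourier_std_normal[unfolded fourier_def, simplified])
    qed
    also have "cmod \<dots> \<le> (LINT y|\<epsilon>. cmod (iexp (t * y) * exp (- t\<^sup>2 / 2)))" by (rule integral_norm_bound)
    finally show ?thesis using prob_space by (simp add: norm_mult)
  qed
  \<comment> \<open>Peetre's inequality gives \<open>?w x * ?w (x - y) \<le> ?w y\<close>.
    Integrated against the Gaussian in \<open>x - y\<close> this leaves the factor
    \<open>\<kappa>\<close> in the lower bound for \<open>p\<close>.\<close>
  define \<kappa> where "\<kappa> = (LINT z|lborel. ?G z * ?w z) / W"
  have iGw: "integrable lborel (\<lambda>z. ?G z * ?w z)"
    by (rule Bochner_Integration.integrable_bound[OF iw]) (use G1 in \<open>auto simp: abs_mult mult_left_le_one_le\<close>)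
  have kappa: "0 < \<kappa>" unfolding \<kappa>_def using W
    by (intro divide_pos_pos pos_int iGw mult_pos_pos normal_density_pos) auto
  have plow: "\<kappa> * ?w x \<le> p x" for x
  proof -
    have "(LINT z|lborel. ?G z * ?w z) = \<bar>- 1\<bar> *\<^sub>R (LINT y|lborel. ?G (x + (- 1) * y) * ?w (x + (- 1) * y))"
      by (rule lborel_integral_real_affine) simp
    then have "\<kappa> * ?w x = (LINT y|lborel. ?w x / W * (?G (x - y) * ?w (x - y)))"
      unfolding \<kappa>_def integral_mult_right_zero by simp
    also have "\<dots> \<le> (LINT y|lborel. q y * ?G (x - y))"
    proof (rule integral_mono)
      show "integrable lborel (\<lambda>y. ?w x / W * (?G (x - y) * ?w (x - y)))"
        using lborel_integrable_real_affine[OF iGw, of "- 1" x] by (intro integrable_mult_right) simp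
      show "integrable lborel (\<lambda>y. q y * ?G (x - y))"
        by (rule Bochner_Integration.integrable_bound[OF iq]) (use G1 q0 in \<open>auto simp: abs_mult mult_left_le\<close>)
      fix y
      have "?w x * ?w (x - y) \<le> ?w y * ((1 + \<bar>x - y\<bar>) powr (5/2) * ?w (x - y))"
        using mult_right_mono[OF peetre_minus[of "5/2" x y], of "?w (x - y)"] by (simp add: mult.assoc)
      also have "(1 + \<bar>x - y\<bar>) powr (5/2) * ?w (x - y) = 1" by (simp add: abs_ge_zero add_pos_nonneg flip: powr_add)
      finally have "?w x * ?w (x - y) \<le> ?w y" by simp
      then have "(?G (x - y) / W) * (?w x * ?w (x - y)) \<le> (?G (x - y) / W) * ?w y"
        using W by (intro mult_left_mono) auto
      then show "?w x / W * (?G (x - y) * ?w (x - y)) \<le> q y * ?G (x - y)"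
        by (simp add: q_def mult_ac)
    qed
    also have "\<dots> = p x" unfolding p_def \<epsilon>_def using q0 by (simp add: integral_density)
    finally show ?thesis .
  qed
  \<comment> \<open>Contraction by \<open>s\<close> brings the first moment below \<open>m\<close>,
    and the denominator \<open>m0 + 1\<close> avoids a division by 0. Since
    \<open>s \<le> 1\<close>, the lower bound on the tail loses only the factor
    \<open>s powr (5/2)\<close>.\<close>
  define s where "s = min 1 (m / (m0 + 1))"
  have s: "0 < s" "s \<le> 1" unfolding s_def using assms m00 by auto
  have sm: "s * m0 \<le> m"
  proof -
    have "s * m0 \<le> m / (m0 + 1) * m0" using m00 by (intro mult_right_mono) (auto simp: s_def)
    also have "\<dots> \<le> m" using m00 assms by (simp add: field_simps)
    finally show ?thesis .
  qed
  define \<phi> where "\<phi> = (\<lambda>x. p (x / s) * (1 / s))"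
  have [measurable]: "\<phi> \<in> borel_measurable borel" unfolding \<phi>_def by measurable
  show thesis
  proof (rule that[of \<phi> "\<kappa> * s powr (5/2)" s])
    show "0 < s" "s \<le> 1" by fact+
    show phi0: "0 \<le> \<phi> x" for x using p0 s by (simp add: \<phi>_def)
    show "(\<integral>\<^sup>+x. ennreal (\<phi> x) \<partial>lborel) = 1"
    proof -
      have "(\<integral>\<^sup>+x. ennreal (\<phi> x) \<partial>lborel) = (\<integral>\<^sup>+x. ennreal (1 / s) * ennreal (p (x * (1 / s))) \<partial>lborel)"
        using s p0 by (simp add: \<phi>_def ennreal_mult[symmetric])
      also have "\<dots> = ennreal (1 / s) * ennreal s"
        using s p1 nn_integral_scale[of "\<lambda>u. ennreal (p u)" "1 / s"] by (simp add: nn_integral_cmult)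
      also have "\<dots> = 1" using s by (subst ennreal_mult[symmetric]) auto
      finally show ?thesis .
    qed
    then show "integrable lborel \<phi>" by (intro integrableI_nn_integral_finite[where x=1]) (auto simp: phi0)
    have "(\<integral>\<^sup>+x. ennreal (\<bar>x\<bar> * \<phi> x) \<partial>lborel) = (\<integral>\<^sup>+x. ennreal (\<bar>x * (1 / s)\<bar> * p (x * (1 / s))) \<partial>lborel)"
      using s by (simp add: \<phi>_def abs_mult)
    also have "\<dots> = ennreal s * (\<integral>\<^sup>+x. ennreal (\<bar>x\<bar> * p x) \<partial>lborel)"
      using s nn_integral_scale[of "\<lambda>u. ennreal (\<bar>u\<bar> * p u)" "1 / s"] by simp
    also have "\<dots> \<le> ennreal s * ennreal m0" by (intro mult_left_mono pm) auto
    also have "\<dots> \<le> ennreal m" using s m00 sm by (simp add: ennreal_mult[symmetric] ennreal_leI)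
    finally show "(\<integral>\<^sup>+x. ennreal (\<bar>x\<bar> * \<phi> x) \<partial>lborel) \<le> ennreal m" .
    show "0 < \<kappa> * s powr (5/2)" using kappa s by simp
    show "\<kappa> * s powr (5/2) * ?w x \<le> \<phi> x" for x
    proof -
      have "?w x = ((1 + \<bar>x\<bar>) / s) powr (- (5/2)) * s powr (- (5/2))"
        using s by (simp add: powr_divide)
      also have "\<dots> \<le> ?w (x / s) * s powr (- (5/2))"
        using s by (intro mult_right_mono powr_mono2') (auto simp: field_simps)
      finally have "s powr (5/2) * ?w x \<le> ?w (x / s) * (s powr (5/2) * s powr (- (5/2)))"
        using s by (simp add: mult_left_mono mult.left_commute)
      also have "s powr (5/2) * s powr (- (5/2)) = 1" using s by (simp flip: powr_add)
      finally have "\<kappa> * (s powr (5/2) * ?w x) \<le> \<kappa> * ?w (x / s)" using kappa by simp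
      also have "\<dots> \<le> p (x / s)" by (rule plow)
      also have "\<dots> \<le> \<phi> x" using s p0[of "x / s"] by (simp add: \<phi>_def field_simps mult_left_le_one_le)
      finally show ?thesis by (simp add: mult.assoc)
    qed
    show "cmod (fourier \<phi> t) \<le> exp (- (t * s)\<^sup>2 / 2)" for t
    proof -
      have "fourier \<phi> t = (1 / s) * fourier (\<lambda>x. p (x / s - 0)) t"
        using fourier_cmult[of "1 / s" "\<lambda>x. p (x / s - 0)" t] by (simp add: \<phi>_def mult.commute)
      also have "\<dots> = fourier p (t * s)" using s by (subst fourier_affine) auto
      finally show ?thesis using pf by simp
    qed
  qed
qed

section \<open>The base density\<close>

lemma sob_cmult:
  assumes [measurable]: "f \<in> borel_measurable borel"
  shows "sob \<alpha> (\<lambda>x. c * f x) = ennreal (c\<^sup>2) * sob \<alpha> f"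
  unfolding sob_def fourier_cmult sum_distrib_left
  by (intro sum.cong refl, subst nn_integral_cmult[symmetric])
     (auto simp: norm_mult power_mult_distrib ennreal_mult mult.assoc)

text \<open>Young's inequality with a free parameter. A small \<open>\<eta>\<close> spends little of
  the slack of \<open>f\<close>; a value matched to mixture weights recovers convexity of the
  functional.\<close>

lemma sob_add_le:
  assumes f: "integrable lborel f" and g: "integrable lborel g" and "0 < \<eta>"
  shows "sob \<alpha> (\<lambda>x. f x + g x) \<le> ennreal (1 + \<eta>) * sob \<alpha> f + ennreal (1 + 1 / \<eta>) * sob \<alpha> g"
proof -
  have [measurable]: "f \<in> borel_measurable borel" "g \<in> borel_measurable borel" using f g by auto
  have sq: "(cmod (a + b))\<^sup>2 \<le> (1 + \<eta>) * (cmod a)\<^sup>2 + (1 + 1 / \<eta>) * (cmod b)\<^sup>2" for a b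
  proof -
    have "(cmod (a + b))\<^sup>2 \<le> (cmod a + cmod b)\<^sup>2" by (intro power_mono norm_triangle_ineq) auto
    moreover have "0 \<le> (\<eta> * cmod a - cmod b)\<^sup>2 / \<eta>" using assms by simp
    moreover have "(\<eta> * cmod a - cmod b)\<^sup>2 / \<eta> = \<eta> * (cmod a)\<^sup>2 + (cmod b)\<^sup>2 / \<eta> - 2 * (cmod a * cmod b)"
      using assms by (simp add: power2_eq_square field_simps)
    ultimately show ?thesis by (simp add: power2_eq_square algebra_simps)
  qed
  show ?thesis
    unfolding sob_def sum_distrib_left sum.distrib[symmetric] fourier_add[OF f g]
  proof (intro sum_mono)
    fix i
    have "(\<integral>\<^sup>+ t. ennreal ((cmod (fourier f t + fourier g t))\<^sup>2 * (1 + (t $ i)\<^sup>2) powr \<alpha>) \<partial>lborel)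
      \<le> (\<integral>\<^sup>+ t. ennreal (1 + \<eta>) * ennreal ((cmod (fourier f t))\<^sup>2 * (1 + (t $ i)\<^sup>2) powr \<alpha>) +
            ennreal (1 + 1 / \<eta>) * ennreal ((cmod (fourier g t))\<^sup>2 * (1 + (t $ i)\<^sup>2) powr \<alpha>) \<partial>lborel)"
    proof (intro nn_integral_mono)
      fix t
      have "(cmod (fourier f t + fourier g t))\<^sup>2 * (1 + (t $ i)\<^sup>2) powr \<alpha>
        \<le> ((1 + \<eta>) * (cmod (fourier f t))\<^sup>2 + (1 + 1 / \<eta>) * (cmod (fourier g t))\<^sup>2) * (1 + (t $ i)\<^sup>2) powr \<alpha>"
        by (intro mult_right_mono sq) auto
      then show "ennreal ((cmod (fourier f t + fourier g t))\<^sup>2 * (1 + (t $ i)\<^sup>2) powr \<alpha>)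
         \<le> ennreal (1 + \<eta>) * ennreal ((cmod (fourier f t))\<^sup>2 * (1 + (t $ i)\<^sup>2) powr \<alpha>) +
            ennreal (1 + 1 / \<eta>) * ennreal ((cmod (fourier g t))\<^sup>2 * (1 + (t $ i)\<^sup>2) powr \<alpha>)"
        using assms(3) by (simp add: ennreal_mult[symmetric] ennreal_plus[symmetric] distrib_right mult.assoc ennreal_leI del: ennreal_plus)
    qed
    also have "\<dots> = ennreal (1 + \<eta>) * (\<integral>\<^sup>+ t. ennreal ((cmod (fourier f t))\<^sup>2 * (1 + (t $ i)\<^sup>2) powr \<alpha>) \<partial>lborel) +
       ennreal (1 + 1 / \<eta>) * (\<integral>\<^sup>+ t. ennreal ((cmod (fourier g t))\<^sup>2 * (1 + (t $ i)\<^sup>2) powr \<alpha>) \<partial>lborel)"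
      by (simp add: nn_integral_add nn_integral_cmult)
    finally show "(\<integral>\<^sup>+ t. ennreal ((cmod (fourier f t + fourier g t))\<^sup>2 * (1 + (t $ i)\<^sup>2) powr \<alpha>) \<partial>lborel)
      \<le> ennreal (1 + \<eta>) * (\<integral>\<^sup>+ t. ennreal ((cmod (fourier f t))\<^sup>2 * (1 + (t $ i)\<^sup>2) powr \<alpha>) \<partial>lborel) +
       ennreal (1 + 1 / \<eta>) * (\<integral>\<^sup>+ t. ennreal ((cmod (fourier g t))\<^sup>2 * (1 + (t $ i)\<^sup>2) powr \<alpha>) \<partial>lborel)" .
  qed
qed

text \<open>The Euclidean norm is at most the sum of the absolute values of the coordinates, and
  each summand factors with mass one in all other coordinates.\<close>

lemma nn_integral_norm_prod_le:
  fixes \<phi> :: "real \<Rightarrow> real"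
  assumes [measurable]: "\<phi> \<in> borel_measurable borel" and p: "\<And>x. 0 \<le> \<phi> x"
    and p1: "(\<integral>\<^sup>+x. ennreal (\<phi> x) \<partial>lborel) = 1"
    and m: "(\<integral>\<^sup>+x. ennreal (\<bar>x\<bar> * \<phi> x) \<partial>lborel) \<le> ennreal m" "0 \<le> m"
  shows "(\<integral>\<^sup>+x. ennreal (norm x * (\<Prod>j\<in>UNIV. \<phi> (x $ j))) \<partial>(lborel :: (real ^ 'd) measure)) \<le> ennreal (real CARD('d) * m)"
proof -
  have "(\<integral>\<^sup>+x. ennreal (norm x * (\<Prod>j\<in>UNIV. \<phi> (x $ j))) \<partial>(lborel :: (real ^ 'd) measure))
    \<le> (\<integral>\<^sup>+x. (\<Sum>i\<in>UNIV. \<Prod>j\<in>UNIV. ennreal ((if j = i then \<bar>x $ j\<bar> else 1) * \<phi> (x $ j))) \<partial>(lborel :: (real ^ 'd) measure))"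
  proof (intro nn_integral_mono)
    fix x :: "real ^ 'd"
    have "norm x * (\<Prod>j\<in>UNIV. \<phi> (x $ j)) \<le> (\<Sum>i\<in>UNIV. \<bar>x $ i\<bar>) * (\<Prod>j\<in>UNIV. \<phi> (x $ j))"
      by (intro mult_right_mono norm_le_l1_cart prod_nonneg) (auto simp: p)
    also have "\<dots> = (\<Sum>i\<in>UNIV. \<Prod>j\<in>UNIV. (if j = i then \<bar>x $ j\<bar> else 1) * \<phi> (x $ j))"
      unfolding sum_distrib_right by (intro sum.cong refl) (simp add: prod.distrib prod.delta)
    finally have "ennreal (norm x * (\<Prod>j\<in>UNIV. \<phi> (x $ j))) \<le> ennreal (\<Sum>i\<in>UNIV. \<Prod>j\<in>UNIV. (if j = i then \<bar>x $ j\<bar> else 1) * \<phi> (x $ j))"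
      by (rule ennreal_leI)
    also have "\<dots> = (\<Sum>i\<in>UNIV. \<Prod>j\<in>UNIV. ennreal ((if j = i then \<bar>x $ j\<bar> else 1) * \<phi> (x $ j)))"
      by (subst sum_ennreal[symmetric]) (auto simp: p prod_ennreal intro!: prod_nonneg)
    finally show "ennreal (norm x * (\<Prod>j\<in>UNIV. \<phi> (x $ j))) \<le> (\<Sum>i\<in>UNIV. \<Prod>j\<in>UNIV. ennreal ((if j = i then \<bar>x $ j\<bar> else 1) * \<phi> (x $ j)))" .
  qed
  also have "\<dots> = (\<Sum>i\<in>(UNIV::'d set). \<integral>\<^sup>+x. (\<Prod>j\<in>UNIV. ennreal ((if j = i then \<bar>x $ j\<bar> else 1) * \<phi> (x $ j))) \<partial>(lborel :: (real ^ 'd) measure))"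
    by (rule nn_integral_sum) measurable
  also have "\<dots> = (\<Sum>i\<in>(UNIV::'d set). \<Prod>j\<in>(UNIV::'d set). \<integral>\<^sup>+x. ennreal ((if j = i then \<bar>x\<bar> else 1) * \<phi> x) \<partial>lborel)"
    by (intro sum.cong refl nn_integral_lborel_vec_prod) measurable
  also have "\<dots> \<le> (\<Sum>i\<in>(UNIV::'d set). ennreal m)"
  proof (intro sum_mono)
    fix i :: 'd
    have "(\<Prod>j\<in>(UNIV::'d set). \<integral>\<^sup>+x. ennreal ((if j = i then \<bar>x\<bar> else 1) * \<phi> x) \<partial>lborel)
      = (\<Prod>j\<in>(UNIV::'d set). if j = i then \<integral>\<^sup>+x. ennreal (\<bar>x\<bar> * \<phi> x) \<partial>lborel else 1)"
      by (intro prod.cong refl) (auto simp: p1)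
    then show "(\<Prod>j\<in>(UNIV::'d set). \<integral>\<^sup>+x. ennreal ((if j = i then \<bar>x\<bar> else 1) * \<phi> x) \<partial>lborel) \<le> ennreal m"
      using m by (simp add: prod.delta)
  qed
  also have "\<dots> = ennreal (real CARD('d) * m)"
    using m by (simp add: ennreal_mult ennreal_of_nat_eq_real_of_nat)
  finally show ?thesis .
qed

lemma base_density:
  fixes \<alpha> L M :: real
  assumes nd: "\<exists>\<mu> \<in> D_class \<alpha> L M. \<exists>\<nu> \<in> (D_class \<alpha> L M :: (real ^ 'd) measure set). \<mu> \<noteq> \<nu>"
    and "0 \<le> \<alpha>" "0 < M"
  obtains f :: "real ^ 'd \<Rightarrow> real" and c where "integrable lborel f" "\<And>x. 0 \<le> f x" "(\<integral>\<^sup>+x. ennreal (f x) \<partial>lborel) = 1"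
    "(\<integral>\<^sup>+x. ennreal (norm x * f x) \<partial>lborel) < ennreal M" "sob \<alpha> f < ennreal (L\<^sup>2)"
    "0 < c" "\<And>x. c * (\<Prod>j\<in>UNIV. (1 + \<bar>x $ j\<bar>) powr (- (5/2))) \<le> f x"
proof -
  let ?d = "real CARD('d)"
  obtain f0 :: "real ^ 'd \<Rightarrow> real" where f0: "integrable lborel f0" "\<And>x. 0 \<le> f0 x" "(\<integral>\<^sup>+x. ennreal (f0 x) \<partial>lborel) = 1"
    "(\<integral>\<^sup>+x. ennreal (norm x * f0 x) \<partial>lborel) \<le> ennreal M" "sob \<alpha> f0 < ennreal (L\<^sup>2)"
    using strict_element[OF nd] by blast
  have d: "0 < ?d" by simp
  \<comment> \<open>With this bound per coordinate the product density has first moment at most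
    \<open>M / 2\<close>, so the mixture falls strictly below \<open>M\<close>.\<close>
  have "0 < M / (2 * ?d)" using d \<open>0 < M\<close> by simp
  from heavy_tail_density[OF this]
  obtain \<phi> c s where phi: "integrable lborel \<phi>" "\<And>x. 0 \<le> \<phi> x" "(\<integral>\<^sup>+x. ennreal (\<phi> x) \<partial>lborel) = 1"
    "(\<integral>\<^sup>+x. ennreal (\<bar>x\<bar> * \<phi> x) \<partial>lborel) \<le> ennreal (M / (2 * ?d))"
    "0 < c" "\<And>x. c * (1 + \<bar>x\<bar>) powr (- (5/2)) \<le> \<phi> x"
    "0 < s" "s \<le> 1" "\<And>t. cmod (fourier \<phi> t) \<le> exp (- (t * s)\<^sup>2 / 2)"
    by blast
  have [measurable]: "f0 \<in> borel_measurable borel" "\<phi> \<in> borel_measurable borel" using f0 phi by auto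
  define \<Phi> where "\<Phi> = (\<lambda>x::real ^ 'd. \<Prod>j\<in>UNIV. \<phi> (x $ j))"
  have [measurable]: "\<Phi> \<in> borel_measurable borel" unfolding \<Phi>_def by measurable
  have P0: "0 \<le> \<Phi> x" for x unfolding \<Phi>_def by (intro prod_nonneg) (simp add: phi)
  have iP: "integrable lborel \<Phi>" unfolding \<Phi>_def by (intro integrable_lborel_vec_prod phi)
  have P1: "(\<integral>\<^sup>+x. ennreal (\<Phi> x) \<partial>lborel) = 1"
    using nn_integral_lborel_vec_prod[of "\<lambda>j::'d. \<lambda>x. ennreal (\<phi> x)"] phi(3)
    by (simp add: \<Phi>_def prod_ennreal phi)
  have Pm: "(\<integral>\<^sup>+x. ennreal (norm x * \<Phi> x) \<partial>lborel) \<le> ennreal (M / 2)"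
  proof -
    have "(\<integral>\<^sup>+x. ennreal (norm x * \<Phi> x) \<partial>lborel) \<le> ennreal (?d * (M / (2 * ?d)))"
      unfolding \<Phi>_def using \<open>0 < M\<close> by (intro nn_integral_norm_prod_le phi) auto
    then show ?thesis by simp
  qed
  have "sob \<alpha> \<Phi> < \<infinity>"
  proof -
    have "sob1 a \<phi> < \<infinity>" if "0 \<le> a" for a by (rule sob1_gauss_finite[OF that phi(7,8,9)])
    then show ?thesis
      unfolding \<Phi>_def sob_prod[OF phi(1)] using \<open>0 \<le> \<alpha>\<close>
      by (auto simp: less_top[symmetric] ennreal_prod_eq_top)
  qed
  then obtain S1 where S1: "0 \<le> S1" "sob \<alpha> \<Phi> = ennreal S1"
    by (cases "sob \<alpha> \<Phi>") auto
  obtain S0 where S0: "0 \<le> S0" "sob \<alpha> f0 = ennreal S0"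
    using f0(5) by (cases "sob \<alpha> f0") auto
  have S0L: "S0 < L\<^sup>2" using f0(5) S0 by (simp add: ennreal_less_iff)
  \<comment> \<open>Small enough that the contribution \<open>\<delta> * S1\<close> uses at most
    half of the Sobolev slack \<open>L\<^sup>2 - S0\<close>.\<close>
  define \<delta> where "\<delta> = min (1/2) ((L\<^sup>2 - S0) / (2 * (S1 + 1)))"
  have del: "0 < \<delta>" "\<delta> < 1" using S0L S1 by (auto simp: \<delta>_def)
  define f where "f = (\<lambda>x. (1 - \<delta>) * f0 x + \<delta> * \<Phi> x)"
  have lin: "(\<integral>\<^sup>+x. ennreal (w x * f x) \<partial>lborel) = ennreal (1 - \<delta>) * (\<integral>\<^sup>+x. ennreal (w x * f0 x) \<partial>lborel) + ennreal \<delta> * (\<integral>\<^sup>+x. ennreal (w x * \<Phi> x) \<partial>lborel)"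
    if [measurable]: "w \<in> borel_measurable borel" and w: "\<And>x. 0 \<le> w x" for w :: "real ^ 'd \<Rightarrow> real"
  proof -
    have "ennreal (w x * f x) = ennreal (1 - \<delta>) * ennreal (w x * f0 x) + ennreal \<delta> * ennreal (w x * \<Phi> x)" for x
    proof -
      have "ennreal ((1 - \<delta>) * p + \<delta> * q) = ennreal (1 - \<delta>) * ennreal p + ennreal \<delta> * ennreal q" if "0 \<le> p" "0 \<le> q" for p q
        using del that by (simp add: ennreal_mult ennreal_plus)
      from this[of "w x * f0 x" "w x * \<Phi> x"] show ?thesis
        using f0(2)[of x] P0[of x] w[of x] by (simp add: f_def algebra_simps)
    qed
    then show ?thesis by (simp add: nn_integral_add nn_integral_cmult)
  qed
  show thesis
  proof (rule that[of f "\<delta> * c ^ CARD('d)"])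
    show "integrable lborel f" using f0 iP by (simp add: f_def)
    show "0 \<le> f x" for x using f0(2)[of x] P0[of x] del by (simp add: f_def)
    show "(\<integral>\<^sup>+x. ennreal (f x) \<partial>lborel) = 1"
      using lin[of "\<lambda>_. 1"] del by (simp add: f0 P1 ennreal_plus[symmetric] del: ennreal_plus)
    have "(\<integral>\<^sup>+x. ennreal (norm x * f x) \<partial>lborel) \<le> ennreal (1 - \<delta>) * ennreal M + ennreal \<delta> * ennreal (M / 2)"
      by (subst lin) (auto intro!: add_mono mult_left_mono f0 Pm)
    also have "\<dots> = ennreal ((1 - \<delta>) * M + \<delta> * (M / 2))"
      using del \<open>0 < M\<close> by (simp add: ennreal_mult[symmetric] ennreal_plus[symmetric] del: ennreal_plus)
    also have "\<dots> < ennreal M"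
      using del \<open>0 < M\<close> by (intro ennreal_lessI) (auto simp: algebra_simps)
    finally show "(\<integral>\<^sup>+x. ennreal (norm x * f x) \<partial>lborel) < ennreal M" .
    \<comment> \<open>The choice \<open>\<eta> = \<delta> / (1 - \<delta>)\<close> makes the two
      coefficients equal to \<open>1 - \<delta>\<close> and \<open>\<delta>\<close> after the
      squares are included, which is convexity along the mixture.\<close>
    have "sob \<alpha> f \<le> ennreal (1 + \<delta> / (1 - \<delta>)) * sob \<alpha> (\<lambda>x. (1 - \<delta>) * f0 x) + ennreal (1 + 1 / (\<delta> / (1 - \<delta>))) * sob \<alpha> (\<lambda>x. \<delta> * \<Phi> x)"
      unfolding f_def using del f0 iP by (intro sob_add_le) auto
    also have "\<dots> = ennreal ((1 + \<delta> / (1 - \<delta>)) * ((1 - \<delta>)\<^sup>2 * S0) + (1 + 1 / (\<delta> / (1 - \<delta>))) * (\<delta>\<^sup>2 * S1))"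
      using del S0 S1 by (simp add: sob_cmult ennreal_mult ennreal_plus)
    also have "(1 + \<delta> / (1 - \<delta>)) * ((1 - \<delta>)\<^sup>2 * S0) + (1 + 1 / (\<delta> / (1 - \<delta>))) * (\<delta>\<^sup>2 * S1) = (1 - \<delta>) * S0 + \<delta> * S1"
      using del by (simp add: field_simps power2_eq_square)
    also have "ennreal \<dots> < ennreal (L\<^sup>2)"
    proof -
      have "\<delta> * S1 \<le> (L\<^sup>2 - S0) / (2 * (S1 + 1)) * (S1 + 1)"
        using S1 S0L by (intro mult_mono) (auto simp: \<delta>_def)
      also have "\<dots> = (L\<^sup>2 - S0) / 2" using S1 by (simp add: field_simps)
      finally have "\<delta> * S1 \<le> (L\<^sup>2 - S0) / 2" .
      moreover have "(1 - \<delta>) * S0 \<le> S0" using del S0 by (simp add: mult_left_le_one_le)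
      ultimately have "(1 - \<delta>) * S0 + \<delta> * S1 \<le> S0 + (L\<^sup>2 - S0) / 2" by (intro add_mono)
      also have "\<dots> < L\<^sup>2" using S0L by (simp add: field_simps)
      finally show ?thesis using S0L S0 by (intro ennreal_lessI) auto
    qed
    finally show "sob \<alpha> f < ennreal (L\<^sup>2)" .
    show "0 < \<delta> * c ^ CARD('d)" using del phi by simp
    show "\<delta> * c ^ CARD('d) * (\<Prod>j\<in>UNIV. (1 + \<bar>x $ j\<bar>) powr (- (5/2))) \<le> f x" for x
    proof -
      have "c ^ CARD('d) * (\<Prod>j\<in>UNIV. (1 + \<bar>x $ j\<bar>) powr (- (5/2))) = (\<Prod>j\<in>UNIV. c * (1 + \<bar>x $ j\<bar>) powr (- (5/2)))"
        by (simp add: prod.distrib)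
      also have "\<dots> \<le> \<Phi> x" unfolding \<Phi>_def using phi by (intro prod_mono) auto
      finally have "\<delta> * (c ^ CARD('d) * (\<Prod>j\<in>UNIV. (1 + \<bar>x $ j\<bar>) powr (- (5/2)))) \<le> \<delta> * \<Phi> x"
        using del by (intro mult_left_mono) auto
      also have "\<dots> \<le> f x" using del f0(2)[of x] by (simp add: f_def)
      finally show ?thesis by (simp add: mult.assoc)
    qed
  qed
qed

section \<open>One-dimensional perturbations\<close>

definition bump_sum :: "nat \<Rightarrow> real \<Rightarrow> nat set \<Rightarrow> real \<Rightarrow> real" where
  "bump_sum N h T x = (\<Sum>k\<in>T. bump N (x / h - real k))"

definition wave :: "real \<Rightarrow> real \<Rightarrow> real" where
  "wave h x = cos (x / h) * std_normal_density x"

lemma measurable_bump_sum [measurable]: "bump_sum N h T \<in> borel_measurable borel"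
  unfolding bump_sum_def by measurable

lemma measurable_wave [measurable]: "wave h \<in> borel_measurable borel"
  unfolding wave_def by measurable

lemma integrable_bump_affine:
  assumes "0 < h"
  shows "integrable lborel (\<lambda>x. bump N (x / h - c))"
  using lborel_integrable_real_affine[OF integrable_bump, of "1 / h" N "- c"] assms by simp

lemma integrable_bump_sum: "0 < h \<Longrightarrow> integrable lborel (bump_sum N h T)"
  unfolding bump_sum_def by (intro Bochner_Integration.integrable_sum integrable_bump_affine)

lemma integrable_wave: "integrable lborel (wave h)"
  by (rule Bochner_Integration.integrable_bound[of _ std_normal_density])
     (auto simp: wave_def abs_mult mult_left_le_one_le)

lemma std_normal_density_le_weight:
  obtains C where "0 \<le> C" "\<And>x. std_normal_density x \<le> C * (1 + \<bar>x\<bar>) powr (- (5/2))"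
proof -
  \<comment> \<open>The difference of order 0 is the Gaussian itself.\<close>
  obtain C where C: "0 \<le> C" "\<And>z. \<bar>bump 0 z\<bar> \<le> C * (1 + \<bar>z\<bar>) powr (- 4)" using bump_le[of 0] by blast
  have "std_normal_density x \<le> C * (1 + \<bar>x\<bar>) powr (- (5/2))" for x
  proof -
    have "std_normal_density x \<le> C * (1 + \<bar>x\<bar>) powr (- 4)" using C(2)[of x] by (simp add: bump_def)
    also have "\<dots> \<le> C * (1 + \<bar>x\<bar>) powr (- (5/2))" using C(1) by (intro mult_left_mono powr_mono) auto
    finally show ?thesis .
  qed
  with C(1) show thesis by (rule that)
qed

lemma wave_le:
  obtains C where "0 \<le> C" "\<And>h x. \<bar>wave h x\<bar> \<le> C * (1 + \<bar>x\<bar>) powr (- (5/2))"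
proof -
  obtain C where C: "0 \<le> C" "\<And>x. std_normal_density x \<le> C * (1 + \<bar>x\<bar>) powr (- (5/2))"
    by (rule std_normal_density_le_weight) blast
  have "\<bar>wave h x\<bar> \<le> std_normal_density x" for h x
    by (simp add: wave_def abs_mult mult_left_le_one_le)
  then have "\<bar>wave h x\<bar> \<le> C * (1 + \<bar>x\<bar>) powr (- (5/2))" for h x
    using C(2) by (rule order_trans)
  with C(1) show thesis by (rule that)
qed

text \<open>Of the decay exponent 4, the part \<open>5/2\<close> becomes the weight in
  \<open>x\<close>, since all centres lie in the unit interval, and the part \<open>3/2\<close> sums
  over the blocks to at most 16. Hence the constant depends on neither \<open>h\<close>,
  \<open>T\<close> nor \<open>m\<close>; 128 is 8 * 16.\<close>

lemma bump_sum_le: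
  obtains C where "0 \<le> C" "\<And>h T m x. 0 < h \<Longrightarrow> h \<le> 1 \<Longrightarrow> T \<subseteq> {..<m} \<Longrightarrow> real m * h \<le> 1 \<Longrightarrow>
    \<bar>bump_sum N h T x\<bar> \<le> C * (1 + \<bar>x\<bar>) powr (- (5/2))"
proof -
  obtain C where C: "0 \<le> C" "\<And>z. \<bar>bump N z\<bar> \<le> C * (1 + \<bar>z\<bar>) powr (- 4)" using bump_le[of N] by blast
  have "\<bar>bump_sum N h T x\<bar> \<le> (128 * C) * (1 + \<bar>x\<bar>) powr (- (5/2))"
    if h: "0 < h" "h \<le> 1" "T \<subseteq> {..<m}" "real m * h \<le> 1" for h T m x
  proof -
    have b: "\<bar>bump N (x / h - real k)\<bar> \<le> C * (8 * (1 + \<bar>x\<bar>) powr (- (5/2))) * (1 + \<bar>x / h - real k\<bar>) powr (- (3/2))" if k: "k < m" for k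
    proof -
      let ?z = "x / h - real k"
      have kh: "real k * h \<le> 1" using k h by (meson less_imp_le mult_right_mono of_nat_le_iff order_trans)
      have "x = h * ?z + real k * h" using h by (simp add: field_simps)
      then have "\<bar>x\<bar> = \<bar>h * ?z + real k * h\<bar>" by (rule arg_cong)
      also have "\<dots> \<le> \<bar>h * ?z\<bar> + \<bar>real k * h\<bar>" by (rule abs_triangle_ineq)
      also have "\<dots> \<le> \<bar>?z\<bar> + 1" using h kh by (intro add_mono) (auto simp: abs_mult mult_left_le_one_le)
      finally have xz: "\<bar>x\<bar> \<le> \<bar>?z\<bar> + 1" .
      have "p \<le> q + 1 \<Longrightarrow> 0 \<le> q \<Longrightarrow> 1 + p \<le> 2 * (1 + q)" for p q :: real by simp
      from this[OF xz abs_ge_zero] have "1 + \<bar>x\<bar> \<le> 2 * (1 + \<bar>?z\<bar>)" .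
      then have "(1 + \<bar>?z\<bar>) powr (- (5/2)) \<le> ((1 + \<bar>x\<bar>) / 2) powr (- (5/2))" by (intro powr_mono2') auto
      also have "\<dots> = 2 powr (5/2) * (1 + \<bar>x\<bar>) powr (- (5/2))"
        by (subst powr_divide) (auto simp: powr_minus_divide)
      also have "\<dots> \<le> 8 * (1 + \<bar>x\<bar>) powr (- (5/2))"
        using powr_mono[of "5/2" 3 "2::real"] by (intro mult_right_mono) (simp_all add: powr_numeral)
      finally have w: "(1 + \<bar>?z\<bar>) powr (- (5/2)) \<le> 8 * (1 + \<bar>x\<bar>) powr (- (5/2))" .
      have "\<bar>bump N ?z\<bar> \<le> C * (1 + \<bar>?z\<bar>) powr (- (5/2) + - (3/2))" using C(2)[of ?z] by simp
      also have "\<dots> = C * (1 + \<bar>?z\<bar>) powr (- (5/2)) * (1 + \<bar>?z\<bar>) powr (- (3/2))" by (simp only: powr_add mult.assoc)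
      also have "\<dots> \<le> C * (8 * (1 + \<bar>x\<bar>) powr (- (5/2))) * (1 + \<bar>?z\<bar>) powr (- (3/2))"
        using C(1) w by (intro mult_right_mono mult_left_mono) auto
      finally show ?thesis .
    qed
    have "\<bar>bump_sum N h T x\<bar> \<le> (\<Sum>k\<in>T. \<bar>bump N (x / h - real k)\<bar>)" unfolding bump_sum_def by (rule sum_abs)
    also have "\<dots> \<le> (\<Sum>k<m. \<bar>bump N (x / h - real k)\<bar>)" using h(3) by (intro sum_mono2) auto
    also have "\<dots> \<le> (\<Sum>k<m. C * (8 * (1 + \<bar>x\<bar>) powr (- (5/2))) * (1 + \<bar>x / h - real k\<bar>) powr (- (3/2)))"
      by (intro sum_mono b) auto
    also have "\<dots> = C * (8 * (1 + \<bar>x\<bar>) powr (- (5/2))) * (\<Sum>k<m. (1 + \<bar>x / h - real k\<bar>) powr (- (3/2)))"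
      by (rule sum_distrib_left[symmetric])
    also have "\<dots> \<le> C * (8 * (1 + \<bar>x\<bar>) powr (- (5/2))) * 16"
      using C(1) by (intro mult_left_mono sum_weight_le) auto
    finally show ?thesis by simp
  qed
  with C(1) show thesis by (intro that[of "128 * C"]) auto
qed

text \<open>Near-orthogonality of the blocks: expanding the square gives the Gaussian Gram entries
  \<open>exp (- (real k - real l)\<^sup>2 / 2)\<close>, whose row sums are bounded. The result
  therefore grows like \<open>m\<close> and not like \<open>m\<^sup>2\<close>.\<close>

lemma integral_gauss_trig_poly_le:
  obtains C where "0 \<le> C" "\<And>T m. T \<subseteq> {..<m} \<Longrightarrow>
    (\<integral>\<^sup>+u. ennreal (std_normal_density u * (cmod (\<Sum>k\<in>T. iexp (u * real k)))\<^sup>2) \<partial>lborel) \<le> ennreal (C * real m)"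
proof -
  have e: "exp (- u\<^sup>2 / 2) \<le> 2 * exp 2 * (1 + \<bar>u\<bar>) powr (- (3/2))" for u :: real
  proof -
    have "(1 + \<bar>u\<bar>) ^ 2 * exp (- u\<^sup>2 / 2) \<le> fact 2 * exp 2 * exp (- u\<^sup>2 / 4)" by (rule power_gauss_le)
    also have "\<dots> \<le> fact 2 * exp 2 * 1" by (intro mult_left_mono) auto
    finally have "(1 + \<bar>u\<bar>)\<^sup>2 * exp (- u\<^sup>2 / 2) \<le> 2 * exp 2" by simp
    moreover have "(1 + \<bar>u\<bar>) powr (3/2) \<le> (1 + \<bar>u\<bar>)\<^sup>2"
      using powr_mono[of "3/2" 2 "1 + \<bar>u\<bar>"] by (simp add: powr_numeral)
    ultimately have "(1 + \<bar>u\<bar>) powr (3/2) * exp (- u\<^sup>2 / 2) \<le> 2 * exp 2"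
      by (blast intro: order_trans mult_right_mono exp_ge_zero)
    moreover have "(1 + \<bar>u\<bar>) powr (- (3/2)) = 1 / (1 + \<bar>u\<bar>) powr (3/2)" by (rule powr_minus_divide)
    ultimately show ?thesis by (simp add: pos_le_divide_eq mult.commute add_pos_nonneg)
  qed
  let ?G = std_normal_density
  have "(\<integral>\<^sup>+u. ennreal (?G u * (cmod (\<Sum>k\<in>T. iexp (u * real k)))\<^sup>2) \<partial>lborel) \<le> ennreal (32 * exp 2 * real m)"
    if T: "T \<subseteq> {..<m}" for T m
  proof -
    have fT: "finite T" using T finite_subset by blast
    have expand: "?G u * (cmod (\<Sum>k\<in>T. iexp (u * real k)))\<^sup>2 = Re (\<Sum>k\<in>T. \<Sum>l\<in>T. iexp ((real k - real l) * u) * ?G u)" for u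
    proof -
      have "complex_of_real ((cmod (\<Sum>k\<in>T. iexp (u * real k)))\<^sup>2) = (\<Sum>k\<in>T. iexp (u * real k)) * cnj (\<Sum>l\<in>T. iexp (u * real l))"
        by (rule complex_norm_square)
      also have "\<dots> = (\<Sum>k\<in>T. \<Sum>l\<in>T. iexp ((real k - real l) * u))"
        by (simp add: sum_product exp_cnj exp_add[symmetric] algebra_simps)
      finally have "complex_of_real (?G u * (cmod (\<Sum>k\<in>T. iexp (u * real k)))\<^sup>2) = (\<Sum>k\<in>T. \<Sum>l\<in>T. iexp ((real k - real l) * u) * ?G u)"
        by (simp add: sum_distrib_left mult.commute)
      then show ?thesis by (metis Re_complex_of_real)
    qed
    have i: "integrable lborel (\<lambda>u. iexp ((real k - real l) * u) * ?G u)" for k l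
      using integrable_std_normal_iexp[of "real k - real l"] by (simp add: mult.commute)
    have int: "integrable lborel (\<lambda>u. \<Sum>k\<in>T. \<Sum>l\<in>T. iexp ((real k - real l) * u) * ?G u)"
      by (intro Bochner_Integration.integrable_sum i)
    have "(\<integral>\<^sup>+u. ennreal (?G u * (cmod (\<Sum>k\<in>T. iexp (u * real k)))\<^sup>2) \<partial>lborel)
      = ennreal (LINT u|lborel. ?G u * (cmod (\<Sum>k\<in>T. iexp (u * real k)))\<^sup>2)"
    proof (rule nn_integral_eq_integral)
      show "integrable lborel (\<lambda>u. ?G u * (cmod (\<Sum>k\<in>T. iexp (u * real k)))\<^sup>2)"
        unfolding expand using int by (rule integrable_Re)
    qed simp
    also have "(LINT u|lborel. ?G u * (cmod (\<Sum>k\<in>T. iexp (u * real k)))\<^sup>2) = Re (LINT u|lborel. (\<Sum>k\<in>T. \<Sum>l\<in>T. iexp ((real k - real l) * u) * ?G u))"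
      unfolding expand using int by (rule integral_Re)
    also have "(LINT u|lborel. (\<Sum>k\<in>T. \<Sum>l\<in>T. iexp ((real k - real l) * u) * ?G u)) = (\<Sum>k\<in>T. \<Sum>l\<in>T. fourier ?G (real k - real l))"
      unfolding fourier_def inner_real_def using i by simp
    also have "Re \<dots> = (\<Sum>k\<in>T. \<Sum>l\<in>T. exp (- (real k - real l)\<^sup>2 / 2))"
      unfolding fourier_std_normal by simp
    also have "\<dots> \<le> (\<Sum>k<m. \<Sum>l<m. exp (- (real k - real l)\<^sup>2 / 2))"
      using T by (intro order_trans[OF sum_mono sum_mono2] sum_mono2) (auto intro!: sum_nonneg)
    also have "\<dots> \<le> (\<Sum>k<m. \<Sum>l<m. 2 * exp 2 * (1 + \<bar>real k - real l\<bar>) powr (- (3/2)))"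
      by (intro sum_mono e)
    also have "\<dots> = (\<Sum>k<m. 2 * exp 2 * (\<Sum>l<m. (1 + \<bar>real k - real l\<bar>) powr (- (3/2))))"
      by (simp only: sum_distrib_left)
    also have "\<dots> \<le> (\<Sum>k<m. 2 * exp 2 * 16)"
      by (intro sum_mono mult_left_mono sum_weight_le) auto
    also have "\<dots> = 32 * exp 2 * real m" by simp
    finally show ?thesis by (simp add: ennreal_leI)
  qed
  then show thesis by (intro that[of "32 * exp 2"]) auto
qed

text \<open>The transform is \<open>h\<close> times a trigonometric polynomial times the transform
  of one bump, both at \<open>t * h\<close>. Squaring gives \<open>h\<^sup>2\<close>, the
  substitution \<open>1 / h\<close>, and near-orthogonality \<open>m\<close>; as
  \<open>real m * h \<le> 1\<close>, only the factor from the weight is left. The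
  \<open>4 ^ N\<close> stems from \<open>cmod (1 - iexp s) \<le> 2\<close>.\<close>

lemma sob1_bump_sum_le:
  fixes a :: real
  assumes a: "0 \<le> a"
  obtains C where "0 \<le> C" "\<And>h T m. 0 < h \<Longrightarrow> h \<le> 1 \<Longrightarrow> T \<subseteq> {..<m} \<Longrightarrow> real m * h \<le> 1 \<Longrightarrow>
    sob1 a (bump_sum N h T) \<le> ennreal (C * h powr (- (2 * a)))"
proof -
  obtain C where C: "0 < C" "\<And>h t. 0 < h \<Longrightarrow> h \<le> 1 \<Longrightarrow>
    (1 + t\<^sup>2) powr a * exp (- (t * h)\<^sup>2) \<le> C * h powr (- (2 * a)) * exp (- (t * h)\<^sup>2 / 2)"
    using scaled_gauss_le[OF a] by blast
  obtain C1 where C1: "0 \<le> C1" "\<And>T m. T \<subseteq> {..<m} \<Longrightarrow>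
    (\<integral>\<^sup>+u. ennreal (std_normal_density u * (cmod (\<Sum>k\<in>T. iexp (u * real k)))\<^sup>2) \<partial>lborel) \<le> ennreal (C1 * real m)"
    by (rule integral_gauss_trig_poly_le) blast
  define C2 where "C2 = 4 ^ N * C * sqrt (2 * pi) * C1"
  have "sob1 a (bump_sum N h T) \<le> ennreal (C2 * h powr (- (2 * a)))"
    if h: "0 < h" "h \<le> 1" "T \<subseteq> {..<m}" "real m * h \<le> 1" for h T m
  proof -
    let ?S = "\<lambda>u. \<Sum>k\<in>T. iexp (u * real k)"
    let ?K = "h\<^sup>2 * 4 ^ N * (C * h powr (- (2 * a)) * sqrt (2 * pi))"
    have ft: "fourier (bump_sum N h T) t = h * ?S (t * h) * fourier (bump N) (t * h)" for t
      unfolding bump_sum_def using h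
      by (subst fourier_sum) (simp_all add: integrable_bump_affine fourier_affine sum_distrib_left sum_distrib_right mult_ac)
    have bd: "(cmod (fourier (bump_sum N h T) t))\<^sup>2 * (1 + t\<^sup>2) powr a \<le> ?K * (std_normal_density (t * h) * (cmod (?S (t * h)))\<^sup>2)" for t
    proof -
      have "(cmod (fourier (bump N) (t * h)))\<^sup>2 \<le> (2 ^ N * exp (- (t * h)\<^sup>2 / 2))\<^sup>2"
        unfolding fourier_bump norm_mult norm_power
        by (intro power_mono mult_mono cmod_one_minus_iexp_le) auto
      also have "\<dots> = 4 ^ N * exp (- (t * h)\<^sup>2)"
        by (simp add: power_mult_distrib power2_eq_square[of "exp _"] power_even_eq[symmetric] mult.commute[of N] flip: exp_add)
           (simp add: power_mult)
      finally have b: "(cmod (fourier (bump N) (t * h)))\<^sup>2 \<le> 4 ^ N * exp (- (t * h)\<^sup>2)" .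
      have "(cmod (fourier (bump_sum N h T) t))\<^sup>2 * (1 + t\<^sup>2) powr a
        = h\<^sup>2 * (cmod (?S (t * h)))\<^sup>2 * ((cmod (fourier (bump N) (t * h)))\<^sup>2 * (1 + t\<^sup>2) powr a)"
        unfolding ft norm_mult power_mult_distrib norm_of_real by simp
      also have "\<dots> \<le> h\<^sup>2 * (cmod (?S (t * h)))\<^sup>2 * (4 ^ N * exp (- (t * h)\<^sup>2) * (1 + t\<^sup>2) powr a)"
        by (intro mult_left_mono mult_right_mono b) auto
      also have "\<dots> = h\<^sup>2 * (cmod (?S (t * h)))\<^sup>2 * 4 ^ N * ((1 + t\<^sup>2) powr a * exp (- (t * h)\<^sup>2))"
        by (simp only: mult_ac)
      also have "\<dots> \<le> h\<^sup>2 * (cmod (?S (t * h)))\<^sup>2 * 4 ^ N * (C * h powr (- (2 * a)) * exp (- (t * h)\<^sup>2 / 2))"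
        using h by (intro mult_left_mono C) auto
      also have "\<dots> = ?K * (std_normal_density (t * h) * (cmod (?S (t * h)))\<^sup>2)"
        by (simp only: std_normal_density_exp mult_ac)
      finally show ?thesis .
    qed
    have "sob1 a (bump_sum N h T) \<le> (\<integral>\<^sup>+t. ennreal ?K * ennreal (std_normal_density (t * h) * (cmod (?S (t * h)))\<^sup>2) \<partial>lborel)"
      unfolding sob1_def using C(1) bd
      by (intro nn_integral_mono) (auto simp: ennreal_mult[symmetric] intro!: ennreal_leI)
    also have "\<dots> = ennreal ?K * (ennreal (1 / h) * (\<integral>\<^sup>+u. ennreal (std_normal_density u * (cmod (?S u))\<^sup>2) \<partial>lborel))"
      using h nn_integral_scale[of "\<lambda>u. ennreal (std_normal_density u * (cmod (?S u))\<^sup>2)" h]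
      by (subst nn_integral_cmult) auto
    also have "\<dots> \<le> ennreal ?K * (ennreal (1 / h) * ennreal (C1 * real m))"
      by (intro mult_left_mono C1 h) auto
    also have "\<dots> = ennreal (?K * ((1 / h) * (C1 * real m)))"
      using h C(1) C1(1) by (simp add: ennreal_mult[symmetric])
    also have "?K * ((1 / h) * (C1 * real m)) = C2 * h powr (- (2 * a)) * (real m * h)"
      unfolding C2_def using h by (simp add: power2_eq_square)
    also have "\<dots> \<le> C2 * h powr (- (2 * a)) * 1"
      using h C(1) C1(1) by (intro mult_left_mono) (auto simp: C2_def)
    finally show ?thesis by (simp add: ennreal_leI)
  qed
  moreover have "0 \<le> C2" using C(1) C1(1) by (simp add: C2_def)
  ultimately show thesis using that by blast
qed

text \<open>The spectrum consists of two half-height Gaussians centred at \<open>1 / h\<close> and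
  \<open>- 1 / h\<close>. Peetre's inequality moves the Sobolev weight from there to the origin at
  the price \<open>(1 + 1 / h) powr (2 * a)\<close>, which for \<open>h \<le> 1\<close> is of order
  \<open>h powr (- (2 * a))\<close>.\<close>

lemma sob1_wave_le:
  fixes a :: real
  assumes a: "0 \<le> a"
  obtains C where "0 \<le> C" "\<And>h. 0 < h \<Longrightarrow> h \<le> 1 \<Longrightarrow> sob1 a (wave h) \<le> ennreal (C * h powr (- (2 * a)))"
proof -
  obtain C where C: "0 < C" "\<And>u. (1 + \<bar>u\<bar>) powr (2 * a) * exp (- u\<^sup>2) \<le> C * exp (- u\<^sup>2 / 2)"
    using powr_gauss_le[of "2 * a"] a by auto
  let ?G = std_normal_density
  define K where "K = C * sqrt (2 * pi) * 2 powr (2 * a)"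
  have "sob1 a (wave h) \<le> ennreal (K * h powr (- (2 * a)))" if h: "0 < h" "h \<le> 1" for h
  proof -
    define b where "b = 1 / h"
    have b: "1 \<le> b" using h by (simp add: b_def)
    have ft: "fourier (wave h) t = (1/2) * (exp (- (t + b)\<^sup>2 / 2) + exp (- (t - b)\<^sup>2 / 2))" for t
    proof -
      have "iexp (t * x) * wave h x = (1/2) * (iexp ((t + b) * x) * ?G x) + (1/2) * (iexp ((t - b) * x) * ?G x)" for x
      proof -
        have aux: "A * ((B + B') / 2 * g) = (1/2) * ((A * B) * g) + (1/2) * ((A * B') * g)" for A B B' g :: complex
          by (simp add: field_simps)
        have c: "complex_of_real (cos (x / h)) = (iexp (b * x) + iexp (- (b * x))) / 2"
          by (simp add: cos_of_real[symmetric] cos_exp_eq b_def)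
        have e: "iexp ((t + b) * x) = iexp (t * x) * iexp (b * x)" "iexp ((t - b) * x) = iexp (t * x) * iexp (- (b * x))"
          by (simp_all add: exp_add[symmetric] algebra_simps)
        have "complex_of_real (wave h x) = complex_of_real (cos (x / h)) * ?G x" by (simp only: wave_def of_real_mult)
        then show ?thesis unfolding e by (simp only: c aux)
      qed
      then have "fourier (wave h) t = (LINT x|lborel. (1/2) * (iexp ((t + b) * x) * ?G x) + (1/2) * (iexp ((t - b) * x) * ?G x))"
        unfolding fourier_def inner_real_def by (intro Bochner_Integration.integral_cong refl)
      also have "\<dots> = (LINT x|lborel. (1/2) * (iexp ((t + b) * x) * ?G x)) + (LINT x|lborel. (1/2) * (iexp ((t - b) * x) * ?G x))"
        by (rule Bochner_Integration.integral_add; rule integrable_mult_right;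
            use integrable_std_normal_iexp[of "t + b"] integrable_std_normal_iexp[of "t - b"] in \<open>simp add: mult.commute\<close>)
      also have "\<dots> = (1/2) * fourier ?G (t + b) + (1/2) * fourier ?G (t - b)"
        unfolding fourier_def inner_real_def integral_mult_right_zero ..
      finally show ?thesis unfolding fourier_std_normal by (simp add: field_simps)
    qed
    have one: "(exp (- u\<^sup>2 / 2))\<^sup>2 * (1 + t\<^sup>2) powr a \<le> K * h powr (- (2 * a)) * ?G u" if "u = t + b \<or> u = t - b" for u t
    proof -
      have "(1 + t\<^sup>2) powr a \<le> (1 + \<bar>t\<bar>) powr (2 * a)" using a by (rule one_plus_sq_powr_le)
      also have "\<dots> \<le> (1 + \<bar>u\<bar>) powr (2 * a) * (1 + b) powr (2 * a)"
        using peetre[of "2 * a" t u] a b that by auto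
      also have "\<dots> \<le> (1 + \<bar>u\<bar>) powr (2 * a) * (2 * b) powr (2 * a)"
        using a b by (intro mult_left_mono powr_mono2) auto
      also have "(2 * b) powr (2 * a) = 2 powr (2 * a) * h powr (- (2 * a))"
        using h by (simp add: b_def powr_mult powr_divide powr_minus_divide)
      finally have t: "(1 + t\<^sup>2) powr a \<le> (1 + \<bar>u\<bar>) powr (2 * a) * (2 powr (2 * a) * h powr (- (2 * a)))" .
      have "(exp (- u\<^sup>2 / 2))\<^sup>2 = exp (- u\<^sup>2)" by (simp add: power2_eq_square[of "exp _"] flip: exp_add)
      then have "(exp (- u\<^sup>2 / 2))\<^sup>2 * (1 + t\<^sup>2) powr a \<le> exp (- u\<^sup>2) * ((1 + \<bar>u\<bar>) powr (2 * a) * (2 powr (2 * a) * h powr (- (2 * a))))"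
        using t by (simp add: mult_left_mono)
      also have "\<dots> = (2 powr (2 * a) * h powr (- (2 * a))) * ((1 + \<bar>u\<bar>) powr (2 * a) * exp (- u\<^sup>2))" by (simp only: mult_ac)
      also have "\<dots> \<le> (2 powr (2 * a) * h powr (- (2 * a))) * (C * exp (- u\<^sup>2 / 2))"
        by (intro mult_left_mono C) auto
      also have "\<dots> = K * h powr (- (2 * a)) * ?G u" unfolding std_normal_density_exp K_def by (simp only: mult_ac)
      finally show ?thesis .
    qed
    have K0: "0 \<le> K * h powr (- (2 * a))" using C(1) by (simp add: K_def)
    have bd: "(cmod (fourier (wave h) t))\<^sup>2 * (1 + t\<^sup>2) powr a \<le> (K * h powr (- (2 * a)) / 2) * (?G (t + b) + ?G (t - b))" for t
    proof -
      let ?p = "exp (- (t + b)\<^sup>2 / 2)" and ?q = "exp (- (t - b)\<^sup>2 / 2)"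
      have "cmod (fourier (wave h) t) = (?p + ?q) / 2"
        unfolding ft of_real_add[symmetric] by (simp only: norm_mult norm_of_real) (simp add: norm_divide)
      then have "(cmod (fourier (wave h) t))\<^sup>2 = ((?p + ?q) / 2)\<^sup>2" by simp
      also have "\<dots> \<le> (?p\<^sup>2 + ?q\<^sup>2) / 2"
        using zero_le_power2[of "?p - ?q"] by (simp add: power2_eq_square algebra_simps)
      finally have "(cmod (fourier (wave h) t))\<^sup>2 * (1 + t\<^sup>2) powr a \<le> (?p\<^sup>2 + ?q\<^sup>2) / 2 * (1 + t\<^sup>2) powr a"
        by (intro mult_right_mono) auto
      also have "\<dots> = (?p\<^sup>2 * (1 + t\<^sup>2) powr a + ?q\<^sup>2 * (1 + t\<^sup>2) powr a) / 2" by (simp add: field_simps)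
      also have "\<dots> \<le> (K * h powr (- (2 * a)) * ?G (t + b) + K * h powr (- (2 * a)) * ?G (t - b)) / 2"
        by (intro divide_right_mono add_mono one) auto
      also have "\<dots> = (K * h powr (- (2 * a)) / 2) * (?G (t + b) + ?G (t - b))"
        by (simp only: distrib_left times_divide_eq_left add_divide_distrib)
      finally show ?thesis .
    qed
    have "sob1 a (wave h) \<le> (\<integral>\<^sup>+t. ennreal (K * h powr (- (2 * a)) / 2) * (ennreal (?G (t + b)) + ennreal (?G (t + - b))) \<partial>lborel)"
      unfolding sob1_def
    proof (intro nn_integral_mono)
      fix t
      show "ennreal ((cmod (fourier (wave h) t))\<^sup>2 * (1 + t\<^sup>2) powr a) \<le> ennreal (K * h powr (- (2 * a)) / 2) * (ennreal (?G (t + b)) + ennreal (?G (t + - b)))"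
        using bd[of t] K0 by (subst ennreal_plus[symmetric], simp, simp, subst ennreal_mult[symmetric]) (auto intro!: ennreal_leI)
    qed
    also have "\<dots> = ennreal (K * h powr (- (2 * a)) / 2) * ((\<integral>\<^sup>+t. ennreal (?G (t + b)) \<partial>lborel) + (\<integral>\<^sup>+t. ennreal (?G (t + - b)) \<partial>lborel))"
      by (subst nn_integral_cmult, measurable, subst nn_integral_add) auto
    also have "\<dots> = ennreal (K * h powr (- (2 * a)) / 2) * (1 + 1)"
    proof -
      have "(\<integral>\<^sup>+t. ennreal (?G (t + c)) \<partial>lborel) = 1" for c
        using nn_integral_shift_lborel[of "\<lambda>t. ennreal (?G t)" c] by (simp add: nn_integral_eq_integral)
      then show ?thesis by (simp only:)
    qed
    also have "ennreal (K * h powr (- (2 * a)) / 2) * (1 + 1) = ennreal (K * h powr (- (2 * a)))"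
    proof -
      have "(1::ennreal) + 1 = ennreal 2" by simp
      then show ?thesis using K0 by (simp only: ennreal_mult[symmetric]) simp
    qed
    finally show ?thesis .
  qed
  moreover have "0 \<le> K" using C(1) by (simp add: K_def)
  ultimately show thesis using that by blast
qed

section \<open>Test functions\<close>

text \<open>The prefactor \<open>h\<close> normalises the slope to 1, so the height is
  \<open>h * r\<close>. For \<open>r \<le> 1/2\<close> at most one tent is nonzero at any point, and
  \<open>z0\<close> places the peak where the bump has a definite sign.\<close>

definition tent :: "real \<Rightarrow> real \<Rightarrow> real \<Rightarrow> nat \<Rightarrow> real \<Rightarrow> real" where
  "tent z0 r h k x = h * max 0 (r - \<bar>x / h - real k - z0\<bar>)"

lemma measurable_tent [measurable]: "tent z0 r h k \<in> borel_measurable borel"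
  unfolding tent_def by measurable

lemma tent_bounds: "0 < h \<Longrightarrow> 0 \<le> r \<Longrightarrow> 0 \<le> tent z0 r h k x" "0 < h \<Longrightarrow> 0 \<le> r \<Longrightarrow> tent z0 r h k x \<le> h * r"
  unfolding tent_def by (auto intro!: mult_left_mono)

lemma tent_lipschitz:
  assumes "0 < h"
  shows "\<bar>tent z0 r h k x - tent z0 r h k y\<bar> \<le> \<bar>x - y\<bar>"
proof -
  have "\<bar>max 0 (r - \<bar>x / h - real k - z0\<bar>) - max 0 (r - \<bar>y / h - real k - z0\<bar>)\<bar> \<le> \<bar>x / h - y / h\<bar>"
    by (auto simp: max_def abs_if)
  then have "h * \<bar>max 0 (r - \<bar>x / h - real k - z0\<bar>) - max 0 (r - \<bar>y / h - real k - z0\<bar>)\<bar> \<le> h * \<bar>x / h - y / h\<bar>"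
    using assms by (intro mult_left_mono) auto
  moreover have "h * \<bar>x / h - y / h\<bar> = \<bar>x - y\<bar>"
    using assms by (simp add: diff_divide_distrib[symmetric])
  moreover have "\<bar>tent z0 r h k x - tent z0 r h k y\<bar> = h * \<bar>max 0 (r - \<bar>x / h - real k - z0\<bar>) - max 0 (r - \<bar>y / h - real k - z0\<bar>)\<bar>"
    using assms unfolding tent_def right_diff_distrib[symmetric] abs_mult by simp
  ultimately show ?thesis by simp
qed

lemma card_tent_support:
  assumes "r \<le> 1/2"
  shows "card {k\<in>{..<m}. tent z0 r h k x \<noteq> 0} \<le> 1"
proof (rule card_le_Suc0_iff_eq[THEN iffD2, unfolded One_nat_def[symmetric]])
  show "\<forall>k\<in>{k\<in>{..<m}. tent z0 r h k x \<noteq> 0}. \<forall>l\<in>{k\<in>{..<m}. tent z0 r h k x \<noteq> 0}. k = l"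
  proof (intro ballI)
    fix k l assume k: "k \<in> {k\<in>{..<m}. tent z0 r h k x \<noteq> 0}" and l: "l \<in> {k\<in>{..<m}. tent z0 r h k x \<noteq> 0}"
    have "\<bar>x / h - real k - z0\<bar> < r" "\<bar>x / h - real l - z0\<bar> < r"
      using k l by (auto simp: tent_def max_def split: if_splits)
    then have "\<bar>real k - real l\<bar> < 1" using assms by linarith
    then show "k = l" by linarith
  qed
qed simp

lemma sum_tent_le:
  assumes "0 < h" "0 \<le> r" "r \<le> 1/2"
  shows "(\<Sum>k<m. tent z0 r h k x) \<le> h * r"
proof -
  let ?K = "{k\<in>{..<m}. tent z0 r h k x \<noteq> 0}"
  have "(\<Sum>k<m. tent z0 r h k x) = (\<Sum>k\<in>?K. tent z0 r h k x)"
    by (rule sum.mono_neutral_right) auto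
  also have "\<dots> \<le> (\<Sum>k\<in>?K. h * r)" using assms by (intro sum_mono tent_bounds) auto
  also have "\<dots> \<le> 1 * (h * r)"
    using card_tent_support[OF assms(3), of m z0 h x] assms unfolding sum_constant by (intro mult_right_mono) auto
  finally show ?thesis by simp
qed

text \<open>At each of the two points at most one tent is nonzero, so at most two summands
  contribute, whatever \<open>m\<close> is.\<close>

lemma sum_tent_diff_le:
  assumes "0 < h" "0 \<le> r" "r \<le> 1/2"
  shows "(\<Sum>k<m. \<bar>tent z0 r h k x - tent z0 r h k y\<bar>) \<le> 2 * \<bar>x - y\<bar>"
proof -
  let ?K = "\<lambda>x. {k\<in>{..<m}. tent z0 r h k x \<noteq> 0}"
  have "(\<Sum>k<m. \<bar>tent z0 r h k x - tent z0 r h k y\<bar>) = (\<Sum>k\<in>?K x \<union> ?K y. \<bar>tent z0 r h k x - tent z0 r h k y\<bar>)"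
    by (rule sum.mono_neutral_right) auto
  also have "\<dots> \<le> (\<Sum>k\<in>?K x \<union> ?K y. \<bar>x - y\<bar>)" using assms by (intro sum_mono tent_lipschitz)
  also have "\<dots> = real (card (?K x \<union> ?K y)) * \<bar>x - y\<bar>" by simp
  also have "\<dots> \<le> 2 * \<bar>x - y\<bar>"
  proof (intro mult_right_mono)
    have "card (?K x \<union> ?K y) \<le> card (?K x) + card (?K y)" by (rule card_Un_le)
    also have "\<dots> \<le> 1 + 1" using assms by (intro add_mono card_tent_support)
    finally show "real (card (?K x \<union> ?K y)) \<le> 2" by simp
  qed simp
  finally show ?thesis .
qed

lemma abs_cos_diff_le: "\<bar>cos a - cos b\<bar> \<le> \<bar>a - b\<bar>" for a b :: real
proof -
  have "\<bar>cos a - cos b\<bar> = \<bar>Re (iexp b * (iexp (a - b) - 1))\<bar>"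
    by (simp add: right_diff_distrib flip: exp_add) (simp add: Re_exp)
  also have "\<dots> \<le> cmod (iexp b * (iexp (a - b) - 1))" by (rule abs_Re_le_cmod)
  also have "\<dots> = cmod (1 - iexp (a - b))" by (simp add: norm_mult norm_minus_commute)
  also have "\<dots> \<le> \<bar>a - b\<bar>" by (rule cmod_one_minus_iexp_le)
  finally show ?thesis .
qed

text \<open>Shaped like the perturbation: a tent in coordinate \<open>i\<close> and a cosine of the
  same frequency in every other one. The correlation of the two then factors into integrals bounded
  away from 0.\<close>

definition test_fun :: "'d \<Rightarrow> real \<Rightarrow> real \<Rightarrow> real \<Rightarrow> nat \<Rightarrow> real ^ 'd \<Rightarrow> real" where
  "test_fun i z0 r h k x = tent z0 r h k (x $ i) * (\<Prod>j\<in>UNIV - {i}. cos (x $ j / h))"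

lemma measurable_test_fun [measurable]: "test_fun i z0 r h k \<in> borel_measurable (borel :: (real ^ 'd) measure)"
  unfolding test_fun_def by measurable

lemma abs_prod_cos_le: "\<bar>\<Prod>j\<in>J. cos (x j)\<bar> \<le> (1::real)"
  unfolding abs_prod by (intro prod_le_1) auto

lemma test_fun_bound: "0 < h \<Longrightarrow> 0 \<le> r \<Longrightarrow> \<bar>test_fun i z0 r h k x\<bar> \<le> h * r"
proof -
  assume "0 < h" "0 \<le> r"
  then have "\<bar>tent z0 r h k (x $ i)\<bar> \<le> h * r" "0 \<le> h * r" using tent_bounds[of h r z0 k "x $ i"] by auto
  then have "\<bar>tent z0 r h k (x $ i)\<bar> * \<bar>\<Prod>j\<in>UNIV - {i}. cos (x $ j / h)\<bar> \<le> (h * r) * 1"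
    by (intro mult_mono abs_prod_cos_le) auto
  then show ?thesis by (simp add: test_fun_def abs_mult)
qed

text \<open>The cosines have slope \<open>1 / h\<close>, but they are multiplied by tents whose sum
  is at most \<open>h * r\<close>, and the two scales cancel. Oscillation at frequency
  \<open>1 / h\<close> in all other coordinates thus costs only a factor depending on the
  dimension.\<close>

lemma sum_test_fun_diff_le:
  fixes x y :: "real ^ 'd"
  assumes h: "0 < h" and r: "0 \<le> r" "r \<le> 1/2"
  shows "(\<Sum>k<m. \<bar>test_fun i z0 r h k x - test_fun i z0 r h k y\<bar>) \<le> (2 + real CARD('d)) * dist x y"
proof -
  let ?P = "\<lambda>x::real ^ 'd. \<Prod>j\<in>UNIV - {i}. cos (x $ j / h)"
  have comp: "\<bar>x $ j - y $ j\<bar> \<le> dist x y" for j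
    using component_le_norm_cart[of "x - y" j] by (simp add: dist_norm)
  have P: "\<bar>?P x - ?P y\<bar> \<le> real CARD('d) * dist x y / h"
  proof -
    have "\<bar>?P x - ?P y\<bar> \<le> (\<Sum>j\<in>UNIV - {i}. \<bar>cos (x $ j / h) - cos (y $ j / h)\<bar>)"
      using norm_prod_diff[of "UNIV - {i}" "\<lambda>j. cos (x $ j / h)" "\<lambda>j. cos (y $ j / h)"] by simp
    also have "\<dots> \<le> (\<Sum>j\<in>UNIV - {i}. dist x y / h)"
    proof (intro sum_mono)
      fix j
      have "\<bar>cos (x $ j / h) - cos (y $ j / h)\<bar> \<le> \<bar>x $ j / h - y $ j / h\<bar>" by (rule abs_cos_diff_le)
      also have "\<dots> = \<bar>x $ j - y $ j\<bar> / h" using h by (simp add: diff_divide_distrib[symmetric])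
      also have "\<dots> \<le> dist x y / h" using h by (intro divide_right_mono comp) auto
      finally show "\<bar>cos (x $ j / h) - cos (y $ j / h)\<bar> \<le> dist x y / h" .
    qed
    also have "\<dots> \<le> (\<Sum>j\<in>(UNIV :: 'd set). dist x y / h)" using h by (intro sum_mono2) auto
    finally show ?thesis by simp
  qed
  have "\<bar>test_fun i z0 r h k x - test_fun i z0 r h k y\<bar>
    \<le> \<bar>tent z0 r h k (x $ i) - tent z0 r h k (y $ i)\<bar> + tent z0 r h k (y $ i) * (real CARD('d) * dist x y / h)" for k
  proof -
    have "test_fun i z0 r h k x - test_fun i z0 r h k y
      = (tent z0 r h k (x $ i) - tent z0 r h k (y $ i)) * ?P x + tent z0 r h k (y $ i) * (?P x - ?P y)"
      by (simp add: test_fun_def algebra_simps)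
    then have "\<bar>test_fun i z0 r h k x - test_fun i z0 r h k y\<bar>
      \<le> \<bar>tent z0 r h k (x $ i) - tent z0 r h k (y $ i)\<bar> * \<bar>?P x\<bar> + \<bar>tent z0 r h k (y $ i)\<bar> * \<bar>?P x - ?P y\<bar>"
      using abs_triangle_ineq by (simp only: abs_mult[symmetric])
    also have "\<dots> \<le> \<bar>tent z0 r h k (x $ i) - tent z0 r h k (y $ i)\<bar> * 1 + tent z0 r h k (y $ i) * (real CARD('d) * dist x y / h)"
      using h r P tent_bounds(1)[of h r] by (intro add_mono mult_mono abs_prod_cos_le) auto
    finally show ?thesis by simp
  qed
  then have "(\<Sum>k<m. \<bar>test_fun i z0 r h k x - test_fun i z0 r h k y\<bar>)
    \<le> (\<Sum>k<m. \<bar>tent z0 r h k (x $ i) - tent z0 r h k (y $ i)\<bar> + tent z0 r h k (y $ i) * (real CARD('d) * dist x y / h))"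
    by (intro sum_mono)
  also have "\<dots> = (\<Sum>k<m. \<bar>tent z0 r h k (x $ i) - tent z0 r h k (y $ i)\<bar>) + (\<Sum>k<m. tent z0 r h k (y $ i)) * (real CARD('d) * dist x y / h)"
    by (simp only: sum.distrib sum_distrib_right)
  also have "\<dots> \<le> 2 * \<bar>x $ i - y $ i\<bar> + (h * r) * (real CARD('d) * dist x y / h)"
    using h r by (intro add_mono mult_right_mono sum_tent_diff_le sum_tent_le) auto
  also have "\<dots> \<le> 2 * dist x y + 1 * (real CARD('d) * dist x y)"
  proof (intro add_mono mult_left_mono comp)
    have "(h * r) * (real CARD('d) * dist x y / h) = r * (real CARD('d) * dist x y)" using h by simp
    also have "\<dots> \<le> 1 * (real CARD('d) * dist x y)" using r by (intro mult_right_mono) auto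
    finally show "(h * r) * (real CARD('d) * dist x y / h) \<le> 1 * (real CARD('d) * dist x y)" .
  qed simp
  finally show ?thesis by (simp add: algebra_simps)
qed

text \<open>By continuity the bump keeps its sign near a point where it is nonzero, so a narrow tent
  placed there correlates with it. One factor \<open>h\<close> is the height of the tent, the other
  the width of the block. Blocks need not be orthogonal, since neighbouring hypotheses differ in
  block \<open>k\<close> alone.\<close>

lemma bump_tent_integral:
  obtains z0 r c where "0 < r" "r \<le> 1/2" "0 < c"
    "\<And>h k. 0 < h \<Longrightarrow> \<bar>LINT x|lborel. tent z0 r h k x * bump N (x / h - real k)\<bar> = h\<^sup>2 * c"
proof -
  obtain z0 where z0: "bump N z0 \<noteq> 0" using bump_nonzero by blast
  define \<sigma> where "\<sigma> = sgn (bump N z0)"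
  have pos: "0 < \<sigma> * bump N z0" using z0 by (auto simp: \<sigma>_def sgn_if)
  have "isCont (\<lambda>z. \<sigma> * bump N z) z0" by (intro continuous_intros isCont_bump)
  then have "((\<lambda>z. \<sigma> * bump N z) \<longlongrightarrow> \<sigma> * bump N z0) (at z0)" by (simp add: isCont_def)
  then have "eventually (\<lambda>z. 0 < \<sigma> * bump N z) (at z0)" using pos by (rule order_tendstoD)
  then obtain r' where r': "0 < r'" "\<And>z. z \<noteq> z0 \<Longrightarrow> dist z z0 < r' \<Longrightarrow> 0 < \<sigma> * bump N z"
    by (auto simp: eventually_at)
  define r where "r = min r' (1/2)"
  have r: "0 < r" "r \<le> 1/2" using r' by (auto simp: r_def)
  have rz: "0 < \<sigma> * bump N z" if "\<bar>z - z0\<bar> < r" for z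
    using r'(2)[of z] pos that by (cases "z = z0") (auto simp: dist_real_def r_def)
  let ?q = "\<lambda>z. max 0 (r - \<bar>z - z0\<bar>)"
  define I where "I = (LINT z|lborel. ?q z * bump N z)"
  have int: "integrable lborel (\<lambda>z. ?q z * bump N z)"
    by (rule Bochner_Integration.integrable_bound[OF integrable_bump[of N]])
       (use r in \<open>auto simp: abs_mult max_def intro!: mult_left_le_one_le\<close>)
  have nn: "0 \<le> \<sigma> * (?q z * bump N z)" for z
  proof (cases "\<bar>z - z0\<bar> < r")
    case True
    then have "0 \<le> ?q z * (\<sigma> * bump N z)"
      by (rule mult_nonneg_nonneg[OF max.cobounded1 less_imp_le[OF rz]])
    then show ?thesis by (simp only: mult.left_commute)
  qed (simp add: max_def)
  have "\<sigma> * I \<noteq> 0"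
  proof
    assume "\<sigma> * I = 0"
    then have "(LINT z|lborel. \<sigma> * (?q z * bump N z)) = 0" by (simp add: I_def)
    then have "AE z in lborel. \<sigma> * (?q z * bump N z) = 0"
      using int nn by (subst (asm) integral_nonneg_eq_0_iff_AE) auto
    moreover have "z \<notin> {z0 - r<..<z0 + r}" if "\<sigma> * (?q z * bump N z) = 0" for z
    proof
      assume "z \<in> {z0 - r<..<z0 + r}"
      then have "\<bar>z - z0\<bar> < r" by auto
      then show False using rz[of z] that by (auto simp: max_def)
    qed
    ultimately have "AE z in lborel. z \<notin> {z0 - r<..<z0 + r}" by (rule eventually_mono)
    then have "emeasure lborel {z0 - r<..<z0 + r} = 0" by (subst (asm) AE_iff_measurable[of "{z0 - r<..<z0 + r}"]) auto
    then show False using r by simp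
  qed
  then have I: "0 < \<bar>I\<bar>" by auto
  have "\<bar>LINT x|lborel. tent z0 r h k x * bump N (x / h - real k)\<bar> = h\<^sup>2 * \<bar>I\<bar>" if h: "0 < h" for h k
  proof -
    have "(LINT x|lborel. tent z0 r h k x * bump N (x / h - real k))
      = \<bar>h\<bar> *\<^sub>R (LINT z|lborel. tent z0 r h k (h * real k + h * z) * bump N ((h * real k + h * z) / h - real k))"
      using h by (intro lborel_integral_real_affine) auto
    also have "\<dots> = h * (LINT z|lborel. h * (?q z * bump N z))"
      using h by (simp add: tent_def add_divide_distrib mult.assoc)
    also have "\<dots> = h\<^sup>2 * I" by (simp add: I_def power2_eq_square)
    finally show ?thesis by (simp add: abs_mult)
  qed
  with r I show thesis using that by blast
qed

text \<open>The double angle formula leaves half the Gaussian mass plus half a value of the Gaussian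
  transform. The latter is positive, so the bound is uniform in \<open>h\<close>.\<close>

lemma cos_wave_integral: "1/2 \<le> (LINT x|lborel. cos (x / h) * wave h x)"
proof -
  let ?G = std_normal_density
  have i: "integrable lborel (\<lambda>x. iexp (x * (2 / h)) * ?G x)" by (rule integrable_std_normal_iexp)
  have "cos (x / h) * wave h x = 1/2 * ?G x + 1/2 * Re (iexp (x * (2 / h)) * ?G x)" for x
  proof -
    have R: "Re (iexp (x * (2 / h)) * ?G x) = cos (2 * (x / h)) * ?G x" by (simp add: Re_exp mult.commute)
    show ?thesis unfolding wave_def R cos_double_cos power2_eq_square by (simp add: algebra_simps)
  qed
  then have "(LINT x|lborel. cos (x / h) * wave h x) = (LINT x|lborel. 1/2 * ?G x + 1/2 * Re (iexp (x * (2 / h)) * ?G x))"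
    by simp
  also have "\<dots> = 1/2 + 1/2 * Re (LINT x|lborel. iexp (x * (2 / h)) * ?G x)"
    using i integral_Re[OF i] integrable_Re[OF i] by (subst Bochner_Integration.integral_add) auto
  also have "(LINT x|lborel. iexp (x * (2 / h)) * ?G x) = fourier ?G (2 / h)"
    by (simp add: fourier_def mult.commute)
  also have "Re (fourier ?G (2 / h)) = exp (- (2 / h)\<^sup>2 / 2)" unfolding fourier_std_normal by simp
  finally show ?thesis by simp
qed

section \<open>Product perturbations\<close>

definition factor :: "nat \<Rightarrow> 'd \<Rightarrow> real \<Rightarrow> nat set \<Rightarrow> 'd \<Rightarrow> real \<Rightarrow> real" where
  "factor N i h T j = (if j = i then bump_sum N h T else wave h)"

definition perturb :: "nat \<Rightarrow> 'd \<Rightarrow> real \<Rightarrow> nat set \<Rightarrow> real ^ 'd \<Rightarrow> real" where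
  "perturb N i h T x = (\<Prod>j\<in>UNIV. factor N i h T j (x $ j))"

lemma measurable_factor [measurable]: "factor N i h T j \<in> borel_measurable borel"
  unfolding factor_def by auto

lemma measurable_perturb [measurable]: "perturb N i h T \<in> borel_measurable (borel :: (real ^ 'd) measure)"
  unfolding perturb_def by measurable

lemma integrable_factor: "0 < h \<Longrightarrow> integrable lborel (factor N i h T j)"
  unfolding factor_def by (auto intro: integrable_bump_sum integrable_wave)

lemma integrable_perturb: "0 < h \<Longrightarrow> integrable lborel (perturb N i h T :: real ^ 'd \<Rightarrow> real)"
  unfolding perturb_def by (intro integrable_lborel_vec_prod integrable_factor)

text \<open>Only the factor in coordinate \<open>i\<close> depends on \<open>T\<close>, and it does
  so additively; hence neighbouring hypotheses differ by a perturbation with a single block.\<close>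

lemma perturb_insert:
  assumes "finite T" "k \<notin> T"
  shows "perturb N i h (insert k T) x = perturb N i h {k} x + perturb N i h T x"
proof -
  have "perturb N i h T x = bump_sum N h T (x $ i) * (\<Prod>j\<in>UNIV - {i}. wave h (x $ j))" for T
    unfolding perturb_def factor_def by (subst prod.remove[of UNIV i]) auto
  then show ?thesis using assms by (simp add: bump_sum_def algebra_simps)
qed

text \<open>The envelope has the shape of the lower bound on the base density, with a constant
  independent of \<open>h\<close>, \<open>T\<close> and \<open>m\<close>. Positivity of the
  perturbed density becomes a condition on the amplitude only.\<close>

lemma perturb_le:
  obtains C where "0 \<le> C" "\<And>h T m (x :: real ^ 'd). 0 < h \<Longrightarrow> h \<le> 1 \<Longrightarrow> T \<subseteq> {..<m} \<Longrightarrow> real m * h \<le> 1 \<Longrightarrow>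
    \<bar>perturb N i h T x\<bar> \<le> C * (\<Prod>j\<in>UNIV. (1 + \<bar>x $ j\<bar>) powr (- (5/2)))"
proof -
  obtain C1 where C1: "0 \<le> C1" "\<And>h T m x. 0 < h \<Longrightarrow> h \<le> 1 \<Longrightarrow> T \<subseteq> {..<m} \<Longrightarrow> real m * h \<le> 1 \<Longrightarrow>
    \<bar>bump_sum N h T x\<bar> \<le> C1 * (1 + \<bar>x\<bar>) powr (- (5/2))"
    using bump_sum_le[of N] by blast
  obtain C2 where C2: "0 \<le> C2" "\<And>h x. \<bar>wave h x\<bar> \<le> C2 * (1 + \<bar>x\<bar>) powr (- (5/2))"
    using wave_le by blast
  have "\<bar>perturb N i h T x\<bar> \<le> max C1 C2 ^ CARD('d) * (\<Prod>j\<in>UNIV. (1 + \<bar>x $ j\<bar>) powr (- (5/2)))"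
    if h: "0 < h" "h \<le> 1" "T \<subseteq> {..<m}" "real m * h \<le> 1" for h T m and x :: "real ^ 'd"
  proof -
    have "\<bar>factor N i h T j y\<bar> \<le> max C1 C2 * (1 + \<bar>y\<bar>) powr (- (5/2))" for j y
    proof -
      have "C1 * (1 + \<bar>y\<bar>) powr (- (5/2)) \<le> max C1 C2 * (1 + \<bar>y\<bar>) powr (- (5/2))"
        "C2 * (1 + \<bar>y\<bar>) powr (- (5/2)) \<le> max C1 C2 * (1 + \<bar>y\<bar>) powr (- (5/2))" by (intro mult_right_mono; simp)+
      then show ?thesis using C1(2)[OF h, of y] C2(2)[of h y] unfolding factor_def by (auto intro: order_trans)
    qed
    then have "(\<Prod>j\<in>UNIV. \<bar>factor N i h T j (x $ j)\<bar>) \<le> (\<Prod>j\<in>UNIV. max C1 C2 * (1 + \<bar>x $ j\<bar>) powr (- (5/2)))"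
      by (intro prod_mono) auto
    then show ?thesis unfolding perturb_def abs_prod by (simp add: prod.distrib)
  qed
  moreover have "0 \<le> max C1 C2 ^ CARD('d)" using C1(1) by simp
  ultimately show thesis using that by blast
qed

text \<open>At frequency 0 the factor from coordinate \<open>i\<close> contains
  \<open>(1 - 1) ^ N\<close>, so perturbing preserves the total mass.\<close>

lemma integral_perturb:
  assumes "0 < h" "0 < N"
  shows "(LINT x|lborel. perturb N i h T (x :: real ^ 'd)) = 0"
proof -
  have "fourier (bump_sum N h T) 0 = 0"
    unfolding bump_sum_def using assms
    by (subst fourier_sum) (auto simp: integrable_bump_affine fourier_affine fourier_bump zero_power)
  then have "fourier (perturb N i h T :: real ^ 'd \<Rightarrow> real) 0 = 0"
    unfolding perturb_def using assms
    by (subst fourier_prod) (auto simp: integrable_bump_sum integrable_wave factor_def intro!: prod_zero bexI[of _ i])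
  then show ?thesis by (simp add: fourier_0)
qed

text \<open>In each summand of the functional a single coordinate carries the exponent
  \<open>\<alpha>\<close> while the others contribute bounded \<open>L\<^sup>2\<close> norms. The
  price is therefore one factor \<open>h powr (- (2 * \<alpha>))\<close>, whatever the
  dimension.\<close>

lemma sob_perturb_le:
  fixes \<alpha> :: real
  assumes a: "0 \<le> \<alpha>"
  obtains C where "0 \<le> C" "\<And>h T m. 0 < h \<Longrightarrow> h \<le> 1 \<Longrightarrow> T \<subseteq> {..<m} \<Longrightarrow> real m * h \<le> 1 \<Longrightarrow>
    sob \<alpha> (perturb N i h T :: real ^ 'd \<Rightarrow> real) \<le> ennreal (C * h powr (- (2 * \<alpha>)))"
proof -
  \<comment> \<open>\<open>P\<close> packages the uniform bound for both kinds of factors, so that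
    it can be obtained once and used at the exponents \<open>\<alpha>\<close> and 0.\<close>
  define P where "P a C \<longleftrightarrow> 0 \<le> C \<and> (\<forall>h T m j. 0 < h \<longrightarrow> h \<le> 1 \<longrightarrow> T \<subseteq> {..<m} \<longrightarrow> real m * h \<le> 1 \<longrightarrow>
     sob1 a (factor N i h T (j::'d)) \<le> ennreal (C * h powr (- (2 * a))))" for a C
  have ex: "\<exists>C. P a C" if a: "0 \<le> a" for a
  proof -
    obtain C1 where C1: "0 \<le> C1" "\<And>h T m. 0 < h \<Longrightarrow> h \<le> 1 \<Longrightarrow> T \<subseteq> {..<m} \<Longrightarrow> real m * h \<le> 1 \<Longrightarrow>
      sob1 a (bump_sum N h T) \<le> ennreal (C1 * h powr (- (2 * a)))" using sob1_bump_sum_le[OF a, of N] by blast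
    obtain C2 where C2: "0 \<le> C2" "\<And>h. 0 < h \<Longrightarrow> h \<le> 1 \<Longrightarrow> sob1 a (wave h) \<le> ennreal (C2 * h powr (- (2 * a)))"
      using sob1_wave_le[OF a] by blast
    have m: "ennreal (C1 * p) \<le> ennreal (max C1 C2 * p)" "ennreal (C2 * p) \<le> ennreal (max C1 C2 * p)" if "0 \<le> p" for p
      using that by (auto intro!: ennreal_leI mult_right_mono)
    show ?thesis
      unfolding P_def
    proof (intro exI[of _ "max C1 C2"] conjI allI impI)
      fix h :: real and T :: "nat set" and m :: nat and j :: 'd
      assume h: "0 < h" "h \<le> 1" "T \<subseteq> {..<m}" "real m * h \<le> 1"
      show "sob1 a (factor N i h T j) \<le> ennreal (max C1 C2 * h powr (- (2 * a)))"
        using order_trans[OF C1(2)[OF h] m(1)] order_trans[OF C2(2)[OF h(1,2)] m(2)]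
        by (simp add: factor_def)
    qed (use C1(1) in simp)
  qed
  from ex[OF a] ex[OF order.refl] obtain A B where "P \<alpha> A" "P 0 B" by blast
  note A = \<open>P \<alpha> A\<close>[unfolded P_def, THEN conjunct1] \<open>P \<alpha> A\<close>[unfolded P_def, THEN conjunct2, rule_format]
  note B = \<open>P 0 B\<close>[unfolded P_def, THEN conjunct1] \<open>P 0 B\<close>[unfolded P_def, THEN conjunct2, rule_format]
  define C where "C = max A B"
  have C: "0 \<le> C" "A \<le> C" "B \<le> C" using A(1) by (auto simp: C_def)
  have "sob \<alpha> (perturb N i h T :: real ^ 'd \<Rightarrow> real) \<le> ennreal ((real CARD('d) * C ^ CARD('d)) * h powr (- (2 * \<alpha>)))"
    if h: "0 < h" "h \<le> 1" "T \<subseteq> {..<m}" "real m * h \<le> 1" for h T m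
  proof -
    have "sob \<alpha> (perturb N i h T :: real ^ 'd \<Rightarrow> real) = (\<Sum>i'\<in>UNIV. \<Prod>j\<in>UNIV. sob1 (if j = i' then \<alpha> else 0) (factor N i h T j))"
      unfolding perturb_def using h by (intro sob_prod integrable_factor)
    also have "\<dots> \<le> (\<Sum>i'\<in>(UNIV::'d set). \<Prod>j\<in>(UNIV::'d set). ennreal (C * (if j = i' then h powr (- (2 * \<alpha>)) else 1)))"
    proof (intro sum_mono prod_mono_ennreal)
      fix i' j :: 'd
      have "ennreal (A * h powr (- (2 * \<alpha>))) \<le> ennreal (C * h powr (- (2 * \<alpha>)))" "ennreal (B * h powr (- (2 * 0))) \<le> ennreal (C * 1)"
        using C h by (intro ennreal_leI; simp add: mult_right_mono)+
      then show "sob1 (if j = i' then \<alpha> else 0) (factor N i h T j) \<le> ennreal (C * (if j = i' then h powr (- (2 * \<alpha>)) else 1))"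
        using A(2)[OF h, of j] B(2)[OF h, of j] by (auto intro: order_trans)
    qed
    also have "\<dots> = (\<Sum>i'\<in>(UNIV::'d set). ennreal (C ^ CARD('d) * h powr (- (2 * \<alpha>))))"
      using C by (intro sum.cong refl, subst prod_ennreal) (auto simp: prod.distrib prod.delta)
    also have "\<dots> = ennreal ((real CARD('d) * C ^ CARD('d)) * h powr (- (2 * \<alpha>)))"
      using C by (simp add: ennreal_mult ennreal_of_nat_eq_real_of_nat mult.assoc)
    finally show ?thesis .
  qed
  moreover have "0 \<le> real CARD('d) * C ^ CARD('d)" using C by simp
  ultimately show thesis using that by blast
qed

text \<open>The integral factors over the coordinates: \<open>h\<^sup>2 * c\<close> from the tent
  against the bump and at least 1/2 from every cosine against a wave. The power
  \<open>CARD('d)\<close> in place of one less is a harmless weakening.\<close>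

lemma test_fun_perturb_integral:
  assumes h: "0 < h" and c: "\<bar>LINT x|lborel. tent z0 r h k x * bump N (x / h - real k)\<bar> = h\<^sup>2 * c" "0 \<le> c"
    and r: "0 \<le> r"
  shows "h\<^sup>2 * c / 2 ^ CARD('d) \<le> \<bar>LINT x|lborel. test_fun i z0 r h k x * perturb N i h {k} (x :: real ^ 'd)\<bar>"
proof -
  define b where "b = (\<lambda>j x. (if j = i then tent z0 r h k x else cos (x / h)) * factor N i h {k} j x)"
  have ib: "integrable lborel (b j)" for j
  proof -
    have t: "\<bar>tent z0 r h k x\<bar> \<le> h * r" for x using tent_bounds[OF h r, of z0 k x] by simp
    have "integrable lborel (\<lambda>x. tent z0 r h k x * factor N i h {k} j x)"
      by (rule Bochner_Integration.integrable_bound[OF integrable_mult_right[OF integrable_factor[OF h, of N i "{k}" j], of "h * r"]])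
         (use t h r in \<open>auto simp: abs_mult intro!: mult_right_mono order_trans[OF t]\<close>)
    moreover have "integrable lborel (\<lambda>x. cos (x / h) * factor N i h {k} j x)"
      by (rule Bochner_Integration.integrable_bound[OF integrable_factor[OF h, of N i "{k}" j]])
         (auto simp: abs_mult intro!: mult_left_le_one_le)
    ultimately show ?thesis by (cases "j = i") (auto simp: b_def)
  qed
  have "test_fun i z0 r h k x * perturb N i h {k} x = (\<Prod>j\<in>UNIV. b j (x $ j))" for x :: "real ^ 'd"
  proof -
    have "test_fun i z0 r h k x = (\<Prod>j\<in>UNIV. if j = i then tent z0 r h k (x $ j) else cos (x $ j / h))"
      unfolding test_fun_def by (subst prod.remove[of UNIV i]) auto
    then show ?thesis by (simp add: perturb_def b_def prod.distrib)
  qed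
  then have "(LINT x|lborel. test_fun i z0 r h k x * perturb N i h {k} (x :: real ^ 'd)) = (\<Prod>j\<in>UNIV. LINT x|lborel. b j x)"
    by (simp add: integral_lborel_vec_prod ib)
  then have eq: "\<bar>LINT x|lborel. test_fun i z0 r h k x * perturb N i h {k} (x :: real ^ 'd)\<bar>
    = \<bar>LINT x|lborel. b i x\<bar> * (\<Prod>j\<in>UNIV - {i}. \<bar>LINT x|lborel. b j x\<bar>)"
    unfolding abs_prod[symmetric] abs_mult[symmetric] by (simp add: prod.remove[of UNIV i])
  have "h\<^sup>2 * c / 2 ^ CARD('d) = h\<^sup>2 * c * (1/2) ^ CARD('d)" by (simp add: power_one_over)
  also have "\<dots> \<le> h\<^sup>2 * c * (1/2) ^ card (UNIV - {i})"
    using c by (intro mult_left_mono power_decreasing) (auto intro!: card_mono)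
  also have "\<dots> = h\<^sup>2 * c * (\<Prod>j\<in>UNIV - {i}. 1/2)" by simp
  also have "\<dots> \<le> \<bar>LINT x|lborel. b i x\<bar> * (\<Prod>j\<in>UNIV - {i}. \<bar>LINT x|lborel. b j x\<bar>)"
  proof (intro mult_mono prod_mono)
    show "h\<^sup>2 * c \<le> \<bar>LINT x|lborel. b i x\<bar>" using c by (simp add: b_def factor_def bump_sum_def)
    fix j assume "j \<in> UNIV - {i}"
    then have "b j = (\<lambda>x. cos (x / h) * wave h x)" by (auto simp: b_def factor_def)
    then show "0 \<le> (1/2::real) \<and> 1/2 \<le> \<bar>LINT x|lborel. b j x\<bar>" using cos_wave_integral[of h] by simp
  qed (auto intro!: prod_nonneg)
  finally show ?thesis unfolding eq .
qed

section \<open>The minimax lower bound\<close>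

lemma weight_le_1: "0 \<le> q \<Longrightarrow> (1 + \<bar>z\<bar>) powr (- q) \<le> 1" for z q :: real
proof -
  assume "0 \<le> q"
  moreover have "1 + \<bar>z\<bar> \<noteq> 0" by linarith
  ultimately show ?thesis using powr_mono[of "- q" 0 "1 + \<bar>z\<bar>"] by simp
qed

text \<open>The density \<open>f\<close> may be unbounded, so the convolution can be infinite at
  exceptional points. There the Bochner integral takes its default value 0; the identification with
  the convolution holds almost everywhere, which is enough for densities.\<close>

lemma convolution_real_density:
  fixes f :: "real ^ 'd \<Rightarrow> real"
  assumes f: "integrable lborel f" "\<And>x. 0 \<le> f x" "(\<integral>\<^sup>+x. ennreal (f x) \<partial>lborel) = 1"
    and "prob_space E" and [measurable_cong]: "sets E = sets borel"
  shows "density lborel (\<lambda>x. ennreal (f x)) \<star> E = density lborel (\<lambda>x. ennreal (LINT y|E. f (x - y)))"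
    and "AE x in lborel. integrable E (\<lambda>y. f (x - y))"
    and "(\<integral>\<^sup>+x. ennreal (LINT y|E. f (x - y)) \<partial>lborel) = 1"
    and "(\<lambda>x. LINT y|E. f (x - y)) \<in> borel_measurable borel"
proof -
  interpret E: prob_space E by fact
  interpret pair_sigma_finite lborel E by unfold_locales
  have [measurable]: "f \<in> borel_measurable borel" using f by auto
  show meas[measurable]: "(\<lambda>x. LINT y|E. f (x - y)) \<in> borel_measurable borel" by measurable
  let ?q = "\<lambda>x. \<integral>\<^sup>+y. ennreal (f (x - y)) \<partial>E"
  have "(\<integral>\<^sup>+x. ?q x \<partial>lborel) = (\<integral>\<^sup>+y. \<integral>\<^sup>+x. ennreal (f (x - y)) \<partial>lborel \<partial>E)"
    by (rule Fubini'[symmetric]) simp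
  also have "\<dots> = 1"
    using nn_integral_shift_lborel[of "\<lambda>x. ennreal (f x)" "- y" for y] by (simp add: f E.emeasure_space_1)
  finally have q1: "(\<integral>\<^sup>+x. ?q x \<partial>lborel) = 1" .
  then have "AE x in lborel. ?q x \<noteq> \<infinity>" by (intro nn_integral_PInf_AE) auto
  then show int: "AE x in lborel. integrable E (\<lambda>y. f (x - y))"
    by eventually_elim (intro integrableI_nonneg, auto simp: f less_top)
  from int have eq: "AE x in lborel. ?q x = ennreal (LINT y|E. f (x - y))"
    by eventually_elim (intro nn_integral_eq_integral, auto simp: f)
  show "(\<integral>\<^sup>+x. ennreal (LINT y|E. f (x - y)) \<partial>lborel) = 1"
    using nn_integral_cong_AE[OF eq] q1 by simp
  have "finite_measure (density lborel (\<lambda>x. ennreal (f x)))"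
    by (intro finite_measureI) (simp add: emeasure_density f)
  then have "density lborel (\<lambda>x. ennreal (f x)) \<star> E = density lborel ?q"
    by (intro convolution_density_left) (auto simp: \<open>sets E = sets borel\<close> E.finite_measure_axioms)
  also have "\<dots> = density lborel (\<lambda>x. ennreal (LINT y|E. f (x - y)))"
    using eq by (intro density_cong) auto
  finally show "density lborel (\<lambda>x. ennreal (f x)) \<star> E = density lborel (\<lambda>x. ennreal (LINT y|E. f (x - y)))" .
qed

context smooth_error
begin

lemma prob_space_product_eps: "prob_space (product_power \<epsilon> :: (real ^ 'd) measure)"
  by (rule prob_space_product_power) (auto intro: prob_space_axioms)

lemma sigma_finite_eps: "sigma_finite_measure \<epsilon>"
  by (rule prob_space_imp_sigma_finite) (rule prob_space_axioms)

lemma factor_singleton_bounded: "\<exists>B. \<forall>x. \<bar>factor N i h {k} j x\<bar> \<le> B"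
proof -
  obtain C where C: "0 \<le> C" "\<And>z. \<bar>bump N z\<bar> \<le> C * (1 + \<bar>z\<bar>) powr (- 4)" using bump_le[of N] by blast
  obtain C' where C': "0 \<le> C'" "\<And>h x. \<bar>wave h x\<bar> \<le> C' * (1 + \<bar>x\<bar>) powr (- (5/2))" using wave_le by blast
  have "\<bar>bump N z\<bar> \<le> C * 1" "\<bar>wave h z\<bar> \<le> C' * 1" for z
    by (rule order_trans[OF C(2) mult_left_mono[OF weight_le_1 C(1)]], simp)
       (rule order_trans[OF C'(2) mult_left_mono[OF weight_le_1 C'(1)]], simp)
  then show ?thesis unfolding factor_def bump_sum_def
    by (cases "j = i") auto
qed

lemma integrable_factor_shift: "integrable \<epsilon> (\<lambda>y. factor N i h {k} j (x - y))"
proof -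
  obtain B where "\<And>x. \<bar>factor N i h {k} j x\<bar> \<le> B" using factor_singleton_bounded[of i h k j] by blast
  then show ?thesis by (intro integrable_const_bound[of _ B]) auto
qed

text \<open>Squaring turns the smoothing factor into \<open>h powr (2 * \<beta>)\<close> in every
  coordinate, and the localised coordinate gains the further \<open>h\<close>. The waves fall under
  the same weighted estimate, taken at scale 1 with centre 0.\<close>

lemma conv_factor_weight:
  obtains C where "0 \<le> C" "\<And>h k (j::'d). 0 < h \<Longrightarrow> h \<le> 1 \<Longrightarrow> real k * h \<le> 1 \<Longrightarrow>
    (\<integral>\<^sup>+x. ennreal ((LINT y|\<epsilon>. factor N i h {k} j (x - y))\<^sup>2 * (1 + \<bar>x\<bar>) powr (5/2)) \<partial>lborel)
      \<le> ennreal (C * h powr (2 * \<beta>) * (if j = i then h else 1))"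
proof -
  obtain C1 where C1: "0 \<le> C1"
    "\<And>h k x. 0 < h \<Longrightarrow> \<bar>LINT y|\<epsilon>. bump N ((x - y) / h - k)\<bar> \<le> C1 * h powr \<beta> / (1 + (x / h - k)\<^sup>2)"
    using conv_bump by blast
  obtain C2 where C2: "0 \<le> C2"
    "\<And>h x. 0 < h \<Longrightarrow> \<bar>LINT y|\<epsilon>. cos ((x - y) / h) * std_normal_density (x - y)\<bar> \<le> C2 * h powr \<beta> / (1 + x\<^sup>2)"
    using conv_cos by blast
  define C where "C = 128 * (max C1 C2)\<^sup>2"
  have sq: "128 * (c * h powr \<beta>)\<^sup>2 \<le> C * h powr (2 * \<beta>)" if "0 \<le> c" "c \<le> max C1 C2" "0 < h" for c h
  proof -
    have "(h powr \<beta>)\<^sup>2 = h powr (2 * \<beta>)" using that by (simp add: powr_power mult.commute)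
    then have "128 * (c * h powr \<beta>)\<^sup>2 = 128 * c\<^sup>2 * h powr (2 * \<beta>)" by (simp add: power_mult_distrib)
    also have "\<dots> \<le> 128 * (max C1 C2)\<^sup>2 * h powr (2 * \<beta>)"
      using that by (intro mult_right_mono mult_left_mono power_mono) auto
    finally show ?thesis by (simp add: C_def)
  qed
  have "(\<integral>\<^sup>+x. ennreal ((LINT y|\<epsilon>. factor N i h {k} j (x - y))\<^sup>2 * (1 + \<bar>x\<bar>) powr (5/2)) \<partial>lborel)
      \<le> ennreal (C * h powr (2 * \<beta>) * (if j = i then h else 1))"
    if h: "0 < h" "h \<le> 1" "real k * h \<le> 1" for h k and j :: 'd
  proof (cases "j = i")
    case True
    have "(\<integral>\<^sup>+x. ennreal ((LINT y|\<epsilon>. factor N i h {k} j (x - y))\<^sup>2 * (1 + \<bar>x\<bar>) powr (5/2)) \<partial>lborel)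
      \<le> ennreal (128 * (C1 * h powr \<beta>)\<^sup>2 * h)"
    proof (rule nn_integral_decay_weight[where k="real k"])
      show "\<bar>LINT y|\<epsilon>. factor N i h {k} j (x - y)\<bar> \<le> C1 * h powr \<beta> / (1 + (x / h - real k)\<^sup>2)" for x
        using C1(2)[OF h(1), of x "real k"] True by (simp add: factor_def bump_sum_def)
    qed (use h in auto)
    also have "\<dots> \<le> ennreal (C * h powr (2 * \<beta>) * h)"
      using h sq[of C1 h] C1(1) by (intro ennreal_leI mult_right_mono) auto
    finally show ?thesis using True by simp
  next
    case False
    have "(\<integral>\<^sup>+x. ennreal ((LINT y|\<epsilon>. factor N i h {k} j (x - y))\<^sup>2 * (1 + \<bar>x\<bar>) powr (5/2)) \<partial>lborel)
      \<le> ennreal (128 * (C2 * h powr \<beta>)\<^sup>2 * 1)"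
    proof (rule nn_integral_decay_weight[where k=0])
      show "\<bar>LINT y|\<epsilon>. factor N i h {k} j (x - y)\<bar> \<le> C2 * h powr \<beta> / (1 + (x / 1 - 0)\<^sup>2)" for x
        using C2(2)[OF h(1), of x] False by (simp add: factor_def wave_def)
    qed auto
    also have "\<dots> \<le> ennreal (C * h powr (2 * \<beta>) * 1)"
      using h sq[of C2 h] C2(1) by (intro ennreal_leI) auto
    finally show ?thesis using False by simp
  qed
  moreover have "0 \<le> C" by (simp add: C_def)
  ultimately show thesis using that by blast
qed

text \<open>The numerator of the chi-square distance, divided by the weight. The error law is a
  product, so the smoothed perturbation factors, and the gains of the coordinates multiply.\<close>

lemma conv_perturb_weight:
  obtains C where "0 \<le> C" "\<And>h k. 0 < h \<Longrightarrow> h \<le> 1 \<Longrightarrow> real k * h \<le> 1 \<Longrightarrow>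
    (\<integral>\<^sup>+x. ennreal ((LINT y|product_power \<epsilon>. perturb N i h {k} (x - y))\<^sup>2 * (\<Prod>j\<in>UNIV. (1 + \<bar>x $ j\<bar>) powr (5/2))) \<partial>(lborel :: (real ^ 'd) measure))
      \<le> ennreal (C * h powr (2 * \<beta> * real CARD('d) + 1))"
proof -
  obtain C where C: "0 \<le> C" "\<And>h k (j::'d). 0 < h \<Longrightarrow> h \<le> 1 \<Longrightarrow> real k * h \<le> 1 \<Longrightarrow>
    (\<integral>\<^sup>+x. ennreal ((LINT y|\<epsilon>. factor N i h {k} j (x - y))\<^sup>2 * (1 + \<bar>x\<bar>) powr (5/2)) \<partial>lborel)
      \<le> ennreal (C * h powr (2 * \<beta>) * (if j = i then h else 1))"
    by (rule conv_factor_weight) blast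
  have "(\<integral>\<^sup>+x. ennreal ((LINT y|product_power \<epsilon>. perturb N i h {k} (x - y))\<^sup>2 * (\<Prod>j\<in>UNIV. (1 + \<bar>x $ j\<bar>) powr (5/2))) \<partial>(lborel :: (real ^ 'd) measure))
      \<le> ennreal (C ^ CARD('d) * h powr (2 * \<beta> * real CARD('d) + 1))"
    if h: "0 < h" "h \<le> 1" "real k * h \<le> 1" for h k
  proof -
    let ?\<Delta> = "\<lambda>j x. LINT y|\<epsilon>. factor N i h {k} j (x - y)"
    have "(LINT y|product_power \<epsilon>. perturb N i h {k} (x - y)) = (\<Prod>j\<in>UNIV. ?\<Delta> j (x $ j))" for x :: "real ^ 'd"
      unfolding perturb_def vector_minus_component
      by (rule integral_product_power_prod[OF sigma_finite_eps sets_eps integrable_factor_shift])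
    then have "(\<integral>\<^sup>+x. ennreal ((LINT y|product_power \<epsilon>. perturb N i h {k} (x - y))\<^sup>2 * (\<Prod>j\<in>UNIV. (1 + \<bar>x $ j\<bar>) powr (5/2))) \<partial>(lborel :: (real ^ 'd) measure))
      = (\<integral>\<^sup>+x. (\<Prod>j\<in>UNIV. ennreal ((?\<Delta> j (x $ j))\<^sup>2 * (1 + \<bar>x $ j\<bar>) powr (5/2))) \<partial>(lborel :: (real ^ 'd) measure))"
      by (simp add: prod_ennreal prod.distrib prod_power_distrib)
    also have "\<dots> = (\<Prod>j\<in>UNIV. \<integral>\<^sup>+x. ennreal ((?\<Delta> j x)\<^sup>2 * (1 + \<bar>x\<bar>) powr (5/2)) \<partial>lborel)"
      by (rule nn_integral_lborel_vec_prod) measurable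
    also have "\<dots> \<le> (\<Prod>j\<in>(UNIV::'d set). ennreal (C * h powr (2 * \<beta>) * (if j = i then h else 1)))"
      by (intro prod_mono_ennreal C h)
    also have "\<dots> = ennreal (\<Prod>j\<in>(UNIV::'d set). C * h powr (2 * \<beta>) * (if j = i then h else 1))"
      using C(1) h by (intro prod_ennreal) auto
    also have "(\<Prod>j\<in>(UNIV::'d set). C * h powr (2 * \<beta>) * (if j = i then h else 1)) = C ^ CARD('d) * (h powr (2 * \<beta>)) ^ CARD('d) * h"
      by (simp add: prod.distrib prod.delta power_mult_distrib)
    also have "\<dots> = C ^ CARD('d) * h powr (2 * \<beta> * real CARD('d) + 1)"
      using h by (simp add: powr_add powr_power power_mult_distrib mult_ac)
    finally show ?thesis .
  qed
  moreover have "0 \<le> C ^ CARD('d)" using C(1) by simp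
  ultimately show thesis using that by blast
qed

text \<open>The denominator of the chi-square distance. Peetre's inequality gives
  \<open>?w a * ?w b \<le> ?w (a - b)\<close>, so averaging over the errors keeps the weight in
  \<open>x\<close> and leaves the mean of the weight under the error law, which is always
  positive.\<close>

lemma conv_weight_lower:
  obtains \<kappa> where "0 < \<kappa>"
    "\<And>(f :: real ^ 'd \<Rightarrow> real) c x. 0 \<le> c \<Longrightarrow> (\<And>x. c * (\<Prod>j\<in>UNIV. (1 + \<bar>x $ j\<bar>) powr (- (5/2))) \<le> f x) \<Longrightarrow>
      integrable (product_power \<epsilon>) (\<lambda>y. f (x - y)) \<Longrightarrow>
      c * \<kappa> * (\<Prod>j\<in>UNIV. (1 + \<bar>x $ j\<bar>) powr (- (5/2))) \<le> (LINT y|product_power \<epsilon>. f (x - y))"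
proof -
  let ?w = "\<lambda>x::real. (1 + \<bar>x\<bar>) powr (- (5/2))"
  have w1: "?w x \<le> 1" for x by (rule weight_le_1) simp
  have iw: "integrable \<epsilon> ?w" using w1 by (intro integrable_const_bound[of _ 1]) auto
  define \<kappa> where "\<kappa> = (LINT y|\<epsilon>. ?w y)"
  have "0 \<le> \<kappa>" unfolding \<kappa>_def by (intro integral_nonneg_AE) auto
  moreover have "\<kappa> \<noteq> 0"
  proof
    assume "\<kappa> = 0"
    then have "AE y in \<epsilon>. ?w y = 0"
      unfolding \<kappa>_def using iw by (subst (asm) integral_nonneg_eq_0_iff_AE) auto
    then have "AE y in \<epsilon>. False" by eventually_elim (simp add: add_pos_nonneg)
    then show False by simp
  qed
  ultimately have kappa: "0 < \<kappa>" by simp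
  have "c * \<kappa> ^ CARD('d) * (\<Prod>j\<in>UNIV. ?w (x $ j)) \<le> (LINT y|product_power \<epsilon>. f (x - y))"
    if c: "0 \<le> c" and f: "\<And>x. c * (\<Prod>j\<in>UNIV. ?w (x $ j)) \<le> f x"
      and int: "integrable (product_power \<epsilon>) (\<lambda>y. f (x - y))" for f :: "real ^ 'd \<Rightarrow> real" and c x
  proof -
    have ip: "integrable (product_power \<epsilon> :: (real ^ 'd) measure) (\<lambda>y. \<Prod>j\<in>UNIV. ?w (y $ j) :: real)"
      by (rule integrable_product_power_prod[OF sigma_finite_eps sets_eps iw])
    have "c * \<kappa> ^ CARD('d) * (\<Prod>j\<in>UNIV. ?w (x $ j)) = (LINT y|(product_power \<epsilon> :: (real ^ 'd) measure). c * (\<Prod>j\<in>UNIV. ?w (x $ j)) * (\<Prod>j\<in>UNIV. ?w (y $ j)))"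
      by (simp add: \<kappa>_def integral_product_power_prod[OF sigma_finite_eps sets_eps iw])
    also have "\<dots> \<le> (LINT y|product_power \<epsilon>. f (x - y))"
    proof (rule integral_mono)
      show "integrable (product_power \<epsilon> :: (real ^ 'd) measure) (\<lambda>y. c * (\<Prod>j\<in>UNIV. ?w (x $ j)) * (\<Prod>j\<in>UNIV. ?w (y $ j)))"
        using ip by simp
      fix y :: "real ^ 'd"
      have pm: "?w a * ?w b \<le> ?w (a - b)" for a b
      proof -
        have "?w a * ?w b \<le> (?w (a - b) * (1 + \<bar>b\<bar>) powr (5/2)) * ?w b"
          using peetre_minus[of "5/2" a "a - b"] by (intro mult_right_mono) auto
        also have "\<dots> = ?w (a - b) * (1 + \<bar>b\<bar>) powr (5/2 + - (5/2))" by (simp only: powr_add mult.assoc)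
        also have "\<dots> = ?w (a - b)"
        proof -
          have "1 + \<bar>b\<bar> \<noteq> 0" by linarith
          then show ?thesis by simp
        qed
        finally show ?thesis .
      qed
      have "c * (\<Prod>j\<in>UNIV. ?w (x $ j)) * (\<Prod>j\<in>UNIV. ?w (y $ j)) = c * (\<Prod>j\<in>UNIV. ?w (x $ j) * ?w (y $ j))"
        by (simp add: prod.distrib)
      also have "\<dots> \<le> c * (\<Prod>j\<in>UNIV. ?w ((x - y) $ j))"
        unfolding vector_minus_component using c by (intro mult_left_mono prod_mono) (auto intro: pm)
      also have "\<dots> \<le> f (x - y)" by (rule f)
      finally show "c * (\<Prod>j\<in>UNIV. ?w (x $ j)) * (\<Prod>j\<in>UNIV. ?w (y $ j)) \<le> f (x - y)" .
    qed (rule int)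
    finally show ?thesis .
  qed
  moreover have "0 < \<kappa> ^ CARD('d)" using kappa by simp
  ultimately show thesis using that by blast
qed

end

lemma density_in_D_class:
  fixes f :: "real ^ 'd \<Rightarrow> real"
  assumes "integrable lborel f" "\<And>x. 0 \<le> f x" "(\<integral>\<^sup>+x. ennreal (f x) \<partial>lborel) = 1"
    "(\<integral>\<^sup>+x. ennreal (norm x * f x) \<partial>lborel) \<le> ennreal M" "sob \<alpha> f \<le> ennreal (L\<^sup>2)"
  shows "density lborel (\<lambda>x. ennreal (f x)) \<in> D_class \<alpha> L M"
proof -
  have [measurable]: "f \<in> borel_measurable borel" using assms(1) by auto
  have "prob_space (density lborel (\<lambda>x. ennreal (f x)))"
    by (intro prob_spaceI) (simp add: emeasure_density assms(3))
  moreover have "(\<integral>\<^sup>+x. ennreal (norm x) \<partial>density lborel (\<lambda>x. ennreal (f x))) = (\<integral>\<^sup>+x. ennreal (norm x * f x) \<partial>lborel)"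
    using assms(2) by (simp add: nn_integral_density ennreal_mult mult.commute)
  ultimately show ?thesis
    using assms unfolding D_class_def P1_class_def sobolev_class_def sob_def by auto
qed

context smooth_error
begin

text \<open>All constants are fixed before \<open>h\<close>, \<open>A\<close> and \<open>n\<close>,
  so that the rate follows by optimising over the scale afterwards. Of the two conditions that
  couple these parameters, the one on \<open>A\<close> alone keeps the hypotheses in the class, and
  the one with \<open>n\<close> makes neighbours hard to distinguish from the sample.\<close>

lemma risk_lower_bound:
  fixes \<alpha> L M :: real
  assumes nd: "\<exists>\<mu> \<in> D_class \<alpha> L M. \<exists>\<nu> \<in> (D_class \<alpha> L M :: (real ^ 'd) measure set). \<mu> \<noteq> \<nu>"
    and a: "0 \<le> \<alpha>" and M: "0 < M"
  obtains \<gamma> c1 c2 where "0 < \<gamma>" "0 < c1" "0 < c2"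
    "\<And>h A n \<mu>hat. 0 < h \<Longrightarrow> h \<le> 1 \<Longrightarrow> 0 < A \<Longrightarrow> A \<le> \<gamma> * h powr \<alpha> \<Longrightarrow>
      real n * (A\<^sup>2 * h powr (2 * \<beta> * real CARD('d) + 1)) \<le> c1 \<Longrightarrow> is_estimator n \<mu>hat \<Longrightarrow>
      ennreal (c2 * A * h) \<le> (SUP \<mu> \<in> (D_class \<alpha> L M :: (real ^ 'd) measure set). risk n \<epsilon> \<mu>hat \<mu>)"
proof -
  let ?d = "CARD('d)"
  let ?W = "\<lambda>x::real ^ 'd. \<Prod>j\<in>UNIV. (1 + \<bar>x $ j\<bar>) powr (- (5/2))"
  let ?E = "product_power \<epsilon> :: (real ^ 'd) measure"
  have N0: "0 < N" using N beta by (cases N) auto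
  interpret E: prob_space ?E by (rule prob_space_product_eps)
  have sE[measurable_cong]: "sets ?E = sets borel" by (simp add: product_power_def)
  obtain i :: 'd where True by blast
  obtain f :: "real ^ 'd \<Rightarrow> real" and c where f: "integrable lborel f" "\<And>x. 0 \<le> f x" "(\<integral>\<^sup>+x. ennreal (f x) \<partial>lborel) = 1"
    "(\<integral>\<^sup>+x. ennreal (norm x * f x) \<partial>lborel) < ennreal M" "sob \<alpha> f < ennreal (L\<^sup>2)"
    "0 < c" "\<And>x. c * ?W x \<le> f x"
    using base_density[OF nd a M] by blast
  have [measurable]: "f \<in> borel_measurable borel" using f by auto
  obtain S where S: "0 \<le> S" "sob \<alpha> f = ennreal S" "S < L\<^sup>2"
    using f(5) by (cases "sob \<alpha> f") (auto simp: ennreal_less_iff)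
  obtain m1 where m1: "0 \<le> m1" "(\<integral>\<^sup>+x. ennreal (norm x * f x) \<partial>lborel) = ennreal m1" "m1 < M"
    using f(4) by (cases "\<integral>\<^sup>+x. ennreal (norm x * f x) \<partial>lborel") (auto simp: ennreal_less_iff)
  obtain C1 where C1: "0 \<le> C1" "\<And>h T m (x :: real ^ 'd). 0 < h \<Longrightarrow> h \<le> 1 \<Longrightarrow> T \<subseteq> {..<m} \<Longrightarrow> real m * h \<le> 1 \<Longrightarrow>
    \<bar>perturb N i h T x\<bar> \<le> C1 * ?W x"
    by (rule perturb_le[of N i]) blast
  obtain C2 where C2: "0 \<le> C2" "\<And>h T m. 0 < h \<Longrightarrow> h \<le> 1 \<Longrightarrow> T \<subseteq> {..<m} \<Longrightarrow> real m * h \<le> 1 \<Longrightarrow>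
    sob \<alpha> (perturb N i h T :: real ^ 'd \<Rightarrow> real) \<le> ennreal (C2 * h powr (- (2 * \<alpha>)))"
    by (rule sob_perturb_le[OF a, of N i]) blast
  obtain C3 where C3: "0 \<le> C3" "\<And>h k. 0 < h \<Longrightarrow> h \<le> 1 \<Longrightarrow> real k * h \<le> 1 \<Longrightarrow>
    (\<integral>\<^sup>+x. ennreal ((LINT y|?E. perturb N i h {k} (x - y))\<^sup>2 * (\<Prod>j\<in>UNIV. (1 + \<bar>x $ j\<bar>) powr (5/2))) \<partial>(lborel :: (real ^ 'd) measure))
      \<le> ennreal (C3 * h powr (2 * \<beta> * real ?d + 1))"
    by (rule conv_perturb_weight[of i]) blast
  obtain \<kappa> where kappa: "0 < \<kappa>"
    "\<And>(f :: real ^ 'd \<Rightarrow> real) c x. 0 \<le> c \<Longrightarrow> (\<And>x. c * ?W x \<le> f x) \<Longrightarrow>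
      integrable ?E (\<lambda>y. f (x - y)) \<Longrightarrow> c * \<kappa> * ?W x \<le> (LINT y|?E. f (x - y))"
    by (rule conv_weight_lower) blast
  obtain z0 r c5 where t: "0 < r" "r \<le> 1/2" "0 < c5"
    "\<And>h k. 0 < h \<Longrightarrow> \<bar>LINT x|lborel. tent z0 r h k x * bump N (x / h - real k)\<bar> = h\<^sup>2 * c5"
    by (rule bump_tent_integral[of N]) blast
  define R where "R = C1 / c"
  \<comment> \<open>Inflating the functional of the base density by \<open>1 + \<eta>\<close> uses
    at most half of the slack \<open>L\<^sup>2 - S\<close>; the other half is left to the
    perturbation.\<close>
  define \<eta> where "\<eta> = (L\<^sup>2 - S) / (2 * (S + 1))"
  \<comment> \<open>The four bounds serve, in this order, for
    \<open>\<gamma>\<^sup>2 \<le> \<gamma>\<close>, for a perturbation of at most half the base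
    density, for the first moment, and for the Sobolev functional. The added ones keep the
    denominators positive.\<close>
  define \<gamma> where "\<gamma> = min 1 (min (1 / (2 * (R + 1))) (min ((M - m1) / ((m1 + 1) * (R + 1))) ((L\<^sup>2 - S) / (2 * ((1 + 1 / \<eta>) * C2 + 1)))))"
  define \<Lambda> where "\<Lambda> = 2 + real ?d"
  \<comment> \<open>Smoothed hypotheses are at least \<open>c * \<kappa> / 2\<close> times the
    weight, and \<open>C3\<close> bounds the weighted numerator.\<close>
  define K where "K = 2 * C3 / (c * \<kappa>)"
  define c1 where "c1 = 1 / (2 * (K + 1))"
  \<comment> \<open>The 8 is the 4 of Assouad's bound times the 2 lost in
    \<open>1 \<le> 2 * (real m * h)\<close>.\<close>
  define c2 where "c2 = c5 / (2 ^ ?d * (8 * \<Lambda>))"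
  have R: "0 \<le> R" using C1(1) f(6) by (simp add: R_def)
  have eta: "0 < \<eta>" using S by (simp add: \<eta>_def)
  have K: "0 \<le> K" using C3(1) f(6) kappa(1) by (simp add: K_def)
  have L: "0 < \<Lambda>" by (simp add: \<Lambda>_def)
  have gamma: "0 < \<gamma>" using R m1 S eta C2(1) by (auto simp: \<gamma>_def add_pos_nonneg intro!: divide_pos_pos mult_pos_pos add_nonneg_pos)
  have g1: "\<gamma> \<le> 1" by (simp add: \<gamma>_def)
  have gR: "\<gamma> * R \<le> 1/2"
  proof -
    have "\<gamma> * R \<le> 1 / (2 * (R + 1)) * (R + 1)" using R by (intro mult_mono) (auto simp: \<gamma>_def)
    also have "\<dots> = 1/2" using R by (simp add: field_simps)
    finally show ?thesis .
  qed
  have gm: "(1 + \<gamma> * R) * m1 \<le> M"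
  proof -
    have "\<gamma> * (R * m1) \<le> (M - m1) / ((m1 + 1) * (R + 1)) * ((R + 1) * (m1 + 1))"
      using R m1 by (intro mult_mono) (auto simp: \<gamma>_def)
    also have "\<dots> = M - m1" using R m1 by simp
    finally show ?thesis by (simp add: algebra_simps)
  qed
  have gS: "(1 + \<eta>) * S + (1 + 1 / \<eta>) * (\<gamma>\<^sup>2 * C2) \<le> L\<^sup>2"
  proof -
    have "\<eta> * S \<le> (L\<^sup>2 - S) / (2 * (S + 1)) * (S + 1)" unfolding \<eta>_def using S by (intro mult_left_mono) auto
    also have "\<dots> = (L\<^sup>2 - S) / 2" using S by (simp add: field_simps)
    finally have 1: "\<eta> * S \<le> (L\<^sup>2 - S) / 2" .
    have q: "0 \<le> (1 + 1 / \<eta>) * C2" using eta C2(1) by simp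
    have "\<gamma>\<^sup>2 \<le> \<gamma>" using gamma g1 by (simp add: power2_eq_square mult_left_le)
    then have "\<gamma>\<^sup>2 * ((1 + 1 / \<eta>) * C2) \<le> (L\<^sup>2 - S) / (2 * ((1 + 1 / \<eta>) * C2 + 1)) * ((1 + 1 / \<eta>) * C2 + 1)"
      using q S by (intro mult_mono) (auto simp: \<gamma>_def)
    also have "\<dots> = (L\<^sup>2 - S) / 2"
    proof -
      have "v / (2 * (p + 1)) * (p + 1) = v / 2" if "0 \<le> p" for v p :: real using that by (simp add: field_simps)
      from this[OF q] show ?thesis .
    qed
    finally have 2: "\<gamma>\<^sup>2 * ((1 + 1 / \<eta>) * C2) \<le> (L\<^sup>2 - S) / 2" .
    have "(1 + \<eta>) * S + (1 + 1 / \<eta>) * (\<gamma>\<^sup>2 * C2) = S + (\<eta> * S + \<gamma>\<^sup>2 * ((1 + 1 / \<eta>) * C2))" by (simp add: algebra_simps)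
    also have "\<dots> \<le> S + ((L\<^sup>2 - S) / 2 + (L\<^sup>2 - S) / 2)" by (intro add_left_mono add_mono 1 2)
    finally show ?thesis by simp
  qed
  have main: "ennreal (c2 * A * h) \<le> (SUP \<mu> \<in> (D_class \<alpha> L M :: (real ^ 'd) measure set). risk n \<epsilon> \<mu>hat \<mu>)"
    if h: "0 < h" "h \<le> 1" and A: "0 < A" "A \<le> \<gamma> * h powr \<alpha>"
      and n: "real n * (A\<^sup>2 * h powr (2 * \<beta> * real ?d + 1)) \<le> c1" and est: "is_estimator n \<mu>hat"
    for h A n and \<mu>hat :: "(nat \<Rightarrow> real ^ 'd) \<Rightarrow> (real ^ 'd) measure"
  proof -
    \<comment> \<open>The largest number of blocks with \<open>real m * h \<le> 1\<close>. As
      \<open>h \<le> 1\<close>, there is at least one block, and the blocks fill at least half of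
      the unit interval.\<close>
    define m where "m = nat \<lfloor>1 / h\<rfloor>"
    have fl: "1 \<le> \<lfloor>1 / h\<rfloor>" using h by (simp add: le_floor_iff)
    then have "0 \<le> \<lfloor>1 / h\<rfloor>" by linarith
    then have "real m = of_int \<lfloor>1 / h\<rfloor>" unfolding m_def by (rule of_nat_nat)
    then have "real m \<le> 1 / h" "1 / h < real m + 1" "1 \<le> real m" using fl by linarith+
    note mb = this
    have mh: "real m * h \<le> 1" using mb(1) h by (simp add: field_simps)
    have mh2: "1 \<le> 2 * (real m * h)"
    proof -
      have "1 < (real m + 1) * h" using mb(2) h by (simp add: field_simps)
      also have "\<dots> \<le> (real m + real m) * h" using mb(3) h by (intro mult_right_mono) auto
      finally show ?thesis by simp
    qed
    have kh: "real k * h \<le> 1" if "k < m" for k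
    proof -
      have "real k * h \<le> real m * h" using that h by (intro mult_right_mono) auto
      then show ?thesis using mh by (rule order_trans)
    qed
    have hg: "A \<le> \<gamma>"
    proof -
      have "h powr \<alpha> \<le> 1" using h a powr_mono2[of \<alpha> h 1] by simp
      then have "\<gamma> * h powr \<alpha> \<le> \<gamma> * 1" using gamma by (intro mult_left_mono) auto
      then show ?thesis using A by simp
    qed
    have AR: "A * R \<le> \<gamma> * R" using hg R by (intro mult_right_mono)
    let ?P = "\<lambda>T. perturb N i h T :: real ^ 'd \<Rightarrow> real"
    \<comment> \<open>\<open>assouad_bound\<close> asks for nonnegativity at every index set, so
      sets outside \<open>{..<m}\<close> get the density 0.\<close>
    define fT where "fT T x = (if T \<subseteq> {..<m} then f x + A * ?P T x else 0)" for T x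
    have pb: "\<bar>A * ?P T x\<bar> \<le> A * R * f x" if "T \<subseteq> {..<m}" for T x
    proof -
      have "\<bar>?P T x\<bar> \<le> C1 * ?W x" using C1(2)[OF h that mh] .
      also have "\<dots> = R * (c * ?W x)" using f(6) by (simp add: R_def)
      also have "\<dots> \<le> R * f x" using R f(7) by (intro mult_left_mono)
      finally show ?thesis using A by (simp add: abs_mult mult.assoc)
    qed
    have flow: "1/2 * f x \<le> fT T x" and fup: "fT T x \<le> (1 + \<gamma> * R) * f x" if "T \<subseteq> {..<m}" for T x
    proof -
      have "A * R * f x \<le> \<gamma> * R * f x" by (rule mult_right_mono[OF AR f(2)])
      moreover have "\<gamma> * R * f x \<le> 1/2 * f x" by (rule mult_right_mono[OF gR f(2)])
      ultimately have b: "\<bar>A * ?P T x\<bar> \<le> \<gamma> * R * f x" "\<bar>A * ?P T x\<bar> \<le> 1/2 * f x"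
        using pb[OF that, of x] by linarith+
      have e: "fT T x = f x + A * ?P T x" using that by (simp add: fT_def)
      show "1/2 * f x \<le> fT T x" using b(2) unfolding e by linarith
      show "fT T x \<le> (1 + \<gamma> * R) * f x" using b(1) unfolding e distrib_right by linarith
    qed
    have f0: "0 \<le> fT T x" for T x
    proof (cases "T \<subseteq> {..<m}")
      case True
      then show ?thesis using flow[OF True, of x] f(2)[of x] by linarith
    qed (simp add: fT_def)
    have [measurable]: "fT T \<in> borel_measurable borel" for T unfolding fT_def by measurable
    have fi: "integrable lborel (fT T)" for T
      unfolding fT_def using f(1) integrable_perturb[OF h(1), of N i T] by (cases "T \<subseteq> {..<m}") auto
    have f1: "(\<integral>\<^sup>+x. ennreal (fT T x) \<partial>lborel) = 1" if "T \<subseteq> {..<m}" for T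
    proof -
      have "(LINT x|lborel. f x) = 1" using f(1,2,3) by (simp add: nn_integral_eq_integral)
      then have "(LINT x|lborel. fT T x) = 1"
        using that f(1) integrable_perturb[OF h(1), of N i T] integral_perturb[OF h(1) N0, of i T] by (simp add: fT_def)
      then show ?thesis using fi f0 by (simp add: nn_integral_eq_integral)
    qed
    define \<mu>s where "\<mu>s T = density lborel (\<lambda>x. ennreal (fT T x))" for T
    define p where "p T x = (LINT y|?E. fT T (x - y))" for T x
    have cls: "\<mu>s T \<in> D_class \<alpha> L M" if T: "T \<subseteq> {..<m}" for T
      unfolding \<mu>s_def
    proof (rule density_in_D_class[OF fi f0 f1[OF T]])
      have "(\<integral>\<^sup>+x. ennreal (norm x * fT T x) \<partial>lborel) \<le> (\<integral>\<^sup>+x. ennreal (1 + \<gamma> * R) * ennreal (norm x * f x) \<partial>lborel)"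
      proof (intro nn_integral_mono)
        fix x
        have "norm x * fT T x \<le> norm x * ((1 + \<gamma> * R) * f x)" by (intro mult_left_mono fup T) auto
        then show "ennreal (norm x * fT T x) \<le> ennreal (1 + \<gamma> * R) * ennreal (norm x * f x)"
          using gamma R f(2)[of x] by (subst ennreal_mult[symmetric]) (auto intro!: ennreal_leI simp: mult_ac)
      qed
      also have "\<dots> = ennreal ((1 + \<gamma> * R) * m1)"
        using gamma R m1 by (simp add: nn_integral_cmult ennreal_mult)
      also have "\<dots> \<le> ennreal M" using gm by (rule ennreal_leI)
      finally show "(\<integral>\<^sup>+x. ennreal (norm x * fT T x) \<partial>lborel) \<le> ennreal M" .
      have "sob \<alpha> (fT T) = sob \<alpha> (\<lambda>x. f x + A * ?P T x)" using T by (simp add: fT_def[abs_def])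
      also have "\<dots> \<le> ennreal (1 + \<eta>) * sob \<alpha> f + ennreal (1 + 1 / \<eta>) * sob \<alpha> (\<lambda>x. A * ?P T x)"
        using integrable_perturb[OF h(1), of N i T] by (intro sob_add_le f(1) eta) auto
      also have "\<dots> \<le> ennreal (1 + \<eta>) * ennreal S + ennreal (1 + 1 / \<eta>) * (ennreal (A\<^sup>2) * ennreal (C2 * h powr (- (2 * \<alpha>))))"
        unfolding S(2) by (subst sob_cmult, measurable) (intro add_left_mono mult_left_mono C2(2)[OF h T mh]; simp)
      also have "\<dots> = ennreal ((1 + \<eta>) * S + (1 + 1 / \<eta>) * (A\<^sup>2 * (C2 * h powr (- (2 * \<alpha>)))))"
        using eta S(1) C2(1) by (simp add: ennreal_mult[symmetric] ennreal_plus[symmetric] del: ennreal_plus)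
      also have "\<dots> \<le> ennreal (L\<^sup>2)"
      proof (rule ennreal_leI)
        have "A\<^sup>2 \<le> (\<gamma> * h powr \<alpha>)\<^sup>2" using A by (intro power_mono) auto
        also have "\<dots> = \<gamma>\<^sup>2 * h powr (2 * \<alpha>)" using h by (simp add: power_mult_distrib powr_power mult.commute)
        finally have "A\<^sup>2 * (C2 * h powr (- (2 * \<alpha>))) \<le> \<gamma>\<^sup>2 * h powr (2 * \<alpha>) * (C2 * h powr (- (2 * \<alpha>)))"
          using C2(1) by (intro mult_right_mono) auto
        also have "\<dots> = \<gamma>\<^sup>2 * C2 * (h powr (2 * \<alpha>) * h powr (- (2 * \<alpha>)))" by (simp only: mult_ac)
        also have "h powr (2 * \<alpha>) * h powr (- (2 * \<alpha>)) = 1" using h by (simp flip: powr_add)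
        finally have "(1 + 1 / \<eta>) * (A\<^sup>2 * (C2 * h powr (- (2 * \<alpha>)))) \<le> (1 + 1 / \<eta>) * (\<gamma>\<^sup>2 * C2)"
          using eta by (intro mult_left_mono) auto
        then show "(1 + \<eta>) * S + (1 + 1 / \<eta>) * (A\<^sup>2 * (C2 * h powr (- (2 * \<alpha>)))) \<le> L\<^sup>2" using gS by linarith
      qed
      finally show "sob \<alpha> (fT T) \<le> ennreal (L\<^sup>2)" .
    qed
    note cd = convolution_real_density[OF fi f0 f1 E.prob_space_axioms sE, folded \<mu>s_def p_def]
    have pm[measurable]: "p T \<in> borel_measurable borel" for T unfolding p_def by measurable
    have p0: "0 \<le> p T x" for T x unfolding p_def by (intro integral_nonneg_AE AE_I2 f0)
    have pint: "integrable ?E (\<lambda>y. ?P T (x - y))" if "T \<subseteq> {..<m}" for T x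
    proof (rule E.integrable_const_bound[of _ C1])
      have "\<bar>?P T (x - y)\<bar> \<le> C1" for y
      proof -
        have "\<bar>?P T (x - y)\<bar> \<le> C1 * ?W (x - y)" by (rule C1(2)[OF h that mh])
        also have "\<dots> \<le> C1 * 1" using C1(1) by (intro mult_left_mono prod_le_1) (auto intro!: weight_le_1)
        finally show ?thesis by simp
      qed
      then show "AE y in ?E. norm (?P T (x - y)) \<le> C1" by simp
    qed measurable
    \<comment> \<open>The only exceptional points are those at which the base density is not
      integrable along the errors. The perturbations are bounded, so one null set serves all
      \<open>T\<close>.\<close>
    have fae: "AE x in lborel. integrable ?E (\<lambda>y. f (x - y))"
      by (rule convolution_real_density(2)[OF f(1,2,3) E.prob_space_axioms sE])
    have plow: "c * \<kappa> / 2 * ?W x \<le> p T x" and peq: "p T x = (LINT y|?E. f (x - y)) + A * (LINT y|?E. ?P T (x - y))"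
      if T: "T \<subseteq> {..<m}" and x: "integrable ?E (\<lambda>y. f (x - y))" for T x
    proof -
      have ifT: "integrable ?E (\<lambda>y. fT T (x - y))" using T x pint[OF T, of x] by (simp add: fT_def)
      show "p T x = (LINT y|?E. f (x - y)) + A * (LINT y|?E. ?P T (x - y))"
        unfolding p_def fT_def using T x pint[OF T, of x] by simp
      have "c * \<kappa> * ?W x \<le> (LINT y|?E. f (x - y))" using f(6) by (intro kappa(2) f(7) x) auto
      moreover have "(LINT y|?E. 1/2 * f (x - y)) \<le> p T x"
        unfolding p_def using x by (intro integral_mono ifT flow T integrable_mult_right)
      ultimately show "c * \<kappa> / 2 * ?W x \<le> p T x" by simp
    qed
    have W0: "0 < ?W x" for x by (intro prod_pos) (auto simp: add_pos_nonneg)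
    have Winv: "1 / ?W x = (\<Prod>j\<in>UNIV. (1 + \<bar>x $ j\<bar>) powr (5/2))" for x :: "real ^ 'd"
      by (simp add: powr_minus prod_inversef[symmetric] o_def inverse_eq_divide[symmetric])
    have "ennreal (real m * (A * (h\<^sup>2 * c5 / 2 ^ ?d)) / (4 * \<Lambda>)) \<le> (SUP \<mu>\<in>D_class \<alpha> L M. risk n \<epsilon> \<mu>hat \<mu>)"
    proof (rule assouad_bound[where \<mu>s=\<mu>s and p=p and F="test_fun i z0 r h" and B="\<lambda>_. h * r"
          and X="K * (A\<^sup>2 * h powr (2 * \<beta> * real ?d + 1))"])
      show "\<mu>s T \<in> D_class \<alpha> L M" if "T \<subseteq> {..<m}" for T by (rule cls[OF that])
      show "is_estimator n \<mu>hat" by (rule est)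
      show "test_fun i z0 r h k \<in> borel_measurable borel" for k by measurable
      show "\<bar>test_fun i z0 r h k x\<bar> \<le> h * r" for k x using h t by (intro test_fun_bound) auto
      show "(\<Sum>k<m. \<bar>test_fun i z0 r h k x - test_fun i z0 r h k y\<bar>) \<le> \<Lambda> * dist x y" for x y
        unfolding \<Lambda>_def using h t by (intro sum_test_fun_diff_le) auto
      show "0 < \<Lambda>" by (rule L)
      show "p T \<in> borel_measurable borel" for T by (rule pm)
      show "0 \<le> p T x" for T x by (rule p0)
      show "\<mu>s T \<star> ?E = density lborel (\<lambda>x. ennreal (p T x))" if "T \<subseteq> {..<m}" for T by (rule cd(1)[OF that])
      show "(\<integral>\<^sup>+x. ennreal (p T x) \<partial>lborel) = 1" if "T \<subseteq> {..<m}" for T by (rule cd(3)[OF that])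
      show "AE x in lborel. 0 < p T x" if T: "T \<subseteq> {..<m}" for T
        using fae
      proof eventually_elim
        case (elim x)
        have "0 < c * \<kappa> / 2 * ?W x" using f(6) kappa(1) W0 by (intro mult_pos_pos) auto
        also have "\<dots> \<le> p T x" by (rule plow[OF T elim])
        finally show ?case .
      qed
      show "(\<integral>\<^sup>+x. ennreal ((p (insert k T) x - p T x)\<^sup>2 / p T x) \<partial>lborel) \<le> ennreal (K * (A\<^sup>2 * h powr (2 * \<beta> * real ?d + 1)))"
        if T: "T \<subseteq> {..<m}" "k < m" "k \<notin> T" for T k
      proof -
        have T': "insert k T \<subseteq> {..<m}" "{k} \<subseteq> {..<m}" "finite T" using T finite_subset by auto
        let ?\<Delta> = "\<lambda>x. LINT y|?E. ?P {k} (x - y)"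
        let ?q = "2 * A\<^sup>2 / (c * \<kappa>)"
        have q: "0 \<le> ?q" using f(6) kappa(1) by simp
        have "(\<integral>\<^sup>+x. ennreal ((p (insert k T) x - p T x)\<^sup>2 / p T x) \<partial>lborel)
          \<le> (\<integral>\<^sup>+x. ennreal ?q * ennreal ((?\<Delta> x)\<^sup>2 * (\<Prod>j\<in>UNIV. (1 + \<bar>x $ j\<bar>) powr (5/2))) \<partial>lborel)"
        proof (rule nn_integral_mono_AE, use fae in eventually_elim)
          case (elim x)
          have "(LINT y|?E. ?P (insert k T) (x - y)) = (LINT y|?E. ?P {k} (x - y) + ?P T (x - y))"
            by (simp only: perturb_insert[OF T'(3) T(3)])
          also have "\<dots> = ?\<Delta> x + (LINT y|?E. ?P T (x - y))"
            by (intro Bochner_Integration.integral_add pint T' T)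
          finally have "p (insert k T) x - p T x = A * ?\<Delta> x"
            unfolding peq[OF T(1) elim] peq[OF T'(1) elim] by (simp add: algebra_simps)
          then have "(p (insert k T) x - p T x)\<^sup>2 / p T x = A\<^sup>2 * (?\<Delta> x)\<^sup>2 / p T x" by (simp add: power_mult_distrib)
          also have "\<dots> \<le> A\<^sup>2 * (?\<Delta> x)\<^sup>2 / (c * \<kappa> / 2 * ?W x)"
          proof (rule divide_left_mono[OF plow[OF T(1) elim]])
            have w: "0 < c * \<kappa> / 2 * ?W x" using f(6) kappa(1) by (intro mult_pos_pos[OF _ W0]) simp
            show "0 < p T x * (c * \<kappa> / 2 * ?W x)"
              by (rule mult_pos_pos[OF order_less_le_trans[OF w plow[OF T(1) elim]] w])
          qed simp
          also have "\<dots> = ?q * ((?\<Delta> x)\<^sup>2 * (1 / ?W x))" by simp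
          finally have "(p (insert k T) x - p T x)\<^sup>2 / p T x \<le> ?q * ((?\<Delta> x)\<^sup>2 * (\<Prod>j\<in>UNIV. (1 + \<bar>x $ j\<bar>) powr (5/2)))"
            unfolding Winv .
          then show ?case
            using q by (subst ennreal_mult[symmetric]) (auto intro!: ennreal_leI mult_nonneg_nonneg prod_nonneg)
        qed
        also have "\<dots> = ennreal ?q * (\<integral>\<^sup>+x. ennreal ((?\<Delta> x)\<^sup>2 * (\<Prod>j\<in>UNIV. (1 + \<bar>x $ j\<bar>) powr (5/2))) \<partial>lborel)"
          by (rule nn_integral_cmult) measurable
        also have "\<dots> \<le> ennreal ?q * ennreal (C3 * h powr (2 * \<beta> * real ?d + 1))"
          by (intro mult_left_mono C3 h kh T) auto
        also have "\<dots> = ennreal (?q * (C3 * h powr (2 * \<beta> * real ?d + 1)))"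
          using q C3(1) by (intro ennreal_mult[symmetric]) auto
        also have "?q * (C3 * h powr (2 * \<beta> * real ?d + 1)) = K * (A\<^sup>2 * h powr (2 * \<beta> * real ?d + 1))"
          by (simp add: K_def)
        finally show ?thesis .
      qed
      have "real n * (K * (A\<^sup>2 * h powr (2 * \<beta> * real ?d + 1))) = K * (real n * (A\<^sup>2 * h powr (2 * \<beta> * real ?d + 1)))"
        by (simp only: mult_ac)
      also have "\<dots> \<le> K * c1" using K by (intro mult_left_mono n)
      also have "\<dots> \<le> 1/2" using K by (simp add: c1_def field_simps)
      finally show "real n * (K * (A\<^sup>2 * h powr (2 * \<beta> * real ?d + 1))) \<le> 1/2" .
      show "0 \<le> K * (A\<^sup>2 * h powr (2 * \<beta> * real ?d + 1))" using K by simp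
      show "A * (h\<^sup>2 * c5 / 2 ^ ?d) \<le> \<bar>(LINT x|\<mu>s (insert k T). test_fun i z0 r h k x) - (LINT x|\<mu>s T. test_fun i z0 r h k x)\<bar>"
        if T: "T \<subseteq> {..<m}" "k < m" "k \<notin> T" for T k
      proof -
        have T': "insert k T \<subseteq> {..<m}" "finite T" using T finite_subset by auto
        let ?F = "test_fun i z0 r h k :: real ^ 'd \<Rightarrow> real"
        have bF: "\<bar>?F x\<bar> \<le> h * r" for x using h t by (intro test_fun_bound) auto
        have ig: "integrable lborel (\<lambda>x. g x * ?F x)" if g: "integrable lborel g" for g :: "real ^ 'd \<Rightarrow> real"
        proof (rule Bochner_Integration.integrable_bound[OF integrable_mult_right[OF g, of "h * r"]])
          have [measurable]: "g \<in> borel_measurable borel" using g by simp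
          show "(\<lambda>x. g x * ?F x) \<in> borel_measurable lborel" by measurable
          show "AE x in lborel. norm (g x * ?F x) \<le> norm (h * r * g x)"
          proof (rule AE_I2)
            fix x
            have "0 \<le> h * r" using h t by simp
            then show "norm (g x * ?F x) \<le> norm (h * r * g x)"
              using mult_right_mono[OF bF[of x], of "\<bar>g x\<bar>"] h(1) t(1) by (simp add: abs_mult mult.commute)
          qed
        qed
        have int: "(LINT x|\<mu>s T. ?F x) = (LINT x|lborel. fT T x * ?F x)" for T
          unfolding \<mu>s_def using f0 by (simp add: integral_density)
        have "(LINT x|\<mu>s (insert k T). ?F x) - (LINT x|\<mu>s T. ?F x) = (LINT x|lborel. fT (insert k T) x * ?F x - fT T x * ?F x)"
          unfolding int by (intro Bochner_Integration.integral_diff[symmetric] ig fi)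
        also have "\<dots> = (LINT x|lborel. A * (?F x * ?P {k} x))"
        proof (intro Bochner_Integration.integral_cong refl)
          fix x
          have "fT (insert k T) x = fT T x + A * ?P {k} x"
            using T T' perturb_insert[OF T'(2) T(3), of N i h x] by (simp add: fT_def distrib_left)
          then show "fT (insert k T) x * ?F x - fT T x * ?F x = A * (?F x * ?P {k} x)"
            by (simp add: algebra_simps)
        qed
        also have "\<dots> = A * (LINT x|lborel. ?F x * ?P {k} x)" by (rule integral_mult_right_zero)
        finally have eq: "(LINT x|\<mu>s (insert k T). ?F x) - (LINT x|\<mu>s T. ?F x) = A * (LINT x|lborel. ?F x * ?P {k} x)" .
        have "h\<^sup>2 * c5 / 2 ^ ?d \<le> \<bar>LINT x|lborel. ?F x * ?P {k} x\<bar>"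
          using h t by (intro test_fun_perturb_integral) auto
        then have "A * (h\<^sup>2 * c5 / 2 ^ ?d) \<le> A * \<bar>LINT x|lborel. ?F x * ?P {k} x\<bar>"
          using A by (intro mult_left_mono) auto
        then show ?thesis unfolding eq abs_mult using A(1) by (simp only: abs_of_pos)
      qed
      show "0 \<le> A * (h\<^sup>2 * c5 / 2 ^ ?d)" using A h t by simp
    qed
    moreover have "c2 * A * h \<le> real m * (A * (h\<^sup>2 * c5 / 2 ^ ?d)) / (4 * \<Lambda>)"
    proof -
      have "c2 * A * h * 1 \<le> c2 * A * h * (2 * (real m * h))"
        using A h t L by (intro mult_left_mono mh2) (auto simp: c2_def)
      also have "\<dots> = real m * (A * (h\<^sup>2 * c5 / 2 ^ ?d)) / (4 * \<Lambda>)"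
        using L by (simp add: c2_def power2_eq_square field_simps)
      finally show ?thesis by simp
    qed
    ultimately show ?thesis by (blast intro: order_trans ennreal_leI)
  qed
  have "0 < c1" "0 < c2" using K t L by (auto simp: c1_def c2_def)
  with gamma main show thesis using that by blast
qed

end

theorem theorem5p1:
  fixes \<mu>eps :: "real measure" and feps :: "real \<Rightarrow> real"
    and \<beta> \<alpha> L M :: real and dl :: "nat \<Rightarrow> real"
  assumes "prob_space \<mu>eps"
    and "feps \<in> borel_measurable borel" and "\<And>x. 0 \<le> feps x"
    and "\<mu>eps = density lborel (\<lambda>x. ennreal (feps x))"
    and "\<beta> > 0"
    and "\<And>l. l \<le> 2 \<Longrightarrow> dl l > 0"
    and "\<And>l t. l < 2 \<Longrightarrow> nth_deriv l (fourier feps) differentiable (at t)"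
    and "\<And>l t. l \<le> 2 \<Longrightarrow>
           cmod (nth_deriv l (fourier feps) t) \<le> dl l * (1 + \<bar>t\<bar>) powr (- (\<beta> + real l))"
    and "\<alpha> > 0" and "L > 0" and "M > 0"
    and nondegenerate: "\<exists>\<mu> \<in> D_class \<alpha> L M. \<exists>\<nu> \<in> (D_class \<alpha> L M :: (real ^ 'd) measure set). \<mu> \<noteq> \<nu>"
  shows "\<exists>C::real. C > 0 \<and>
    (\<forall>\<mu>hat :: nat \<Rightarrow> (nat \<Rightarrow> real ^ 'd) \<Rightarrow> (real ^ 'd) measure.
       (\<forall>n. is_estimator n (\<mu>hat n)) \<longrightarrow>
       liminf (\<lambda>n. ennreal (psi \<alpha> \<beta> CARD('d) n) *
                   (SUP \<mu> \<in> D_class \<alpha> L M. risk n \<mu>eps (\<mu>hat n) \<mu>)) > ennreal C)"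
proof -
  define F where "F l = nth_deriv l (fourier feps)" for l
  define D where "D = max (dl 0) (max (dl 1) (dl 2))"
  define N where "N = nat \<lceil>\<beta> + 3\<rceil>"
  \<comment> \<open>Differentiability below order 2 makes the iterated
    \<open>vector_derivative\<close> a genuine derivative rather than an unspecified value.\<close>
  have Fd: "(F l has_vector_derivative F (Suc l) t) (at t)" if "l < 2" for l t
    using vector_derivative_works[THEN iffD1, OF assms(7)[OF that, of t]] by (simp add: F_def nth_deriv_def)
  have FD: "cmod (F l t) \<le> D * (1 + \<bar>t\<bar>) powr (- (\<beta> + real l))" if "l \<le> 2" "dl l \<le> D" for l t
    using assms(8)[OF that(1), of t] mult_right_mono[OF that(2), of "(1 + \<bar>t\<bar>) powr (- (\<beta> + real l))"]
    unfolding F_def by simp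
  interpret smooth_error \<mu>eps "F 0" "F 1" "F 2" \<beta> D N
  proof (rule smooth_error.intro[OF assms(1)], unfold_locales)
    show "sets \<mu>eps = sets borel" by (simp add: assms(4))
    show "F 0 t = (LINT y|\<mu>eps. iexp (t * y))" for t
      unfolding assms(4) F_def nth_deriv_def fourier_def using assms(2,3)
      by (subst integral_density) (auto simp: scaleR_conv_of_real mult.commute)
    show "(F 0 has_vector_derivative F 1 t) (at t)" "(F 1 has_vector_derivative F 2 t) (at t)" for t
      using Fd[of 0 t] Fd[of 1 t] by (simp_all add: numeral_2_eq_2)
    show "cmod (F 0 t) \<le> D * (1 + \<bar>t\<bar>) powr (- \<beta>)" "cmod (F 1 t) \<le> D * (1 + \<bar>t\<bar>) powr (- (\<beta> + 1))"
      "cmod (F 2 t) \<le> D * (1 + \<bar>t\<bar>) powr (- (\<beta> + 2))" for t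
      using FD[of 0 t] FD[of 1 t] FD[of 2 t] by (simp_all add: D_def)
    show "0 < \<beta>" by fact
    show "\<beta> + 3 \<le> real N" unfolding N_def by linarith
  qed
  let ?d = "real CARD('d)"
  obtain \<gamma> c1 c2 where g: "0 < \<gamma>" "0 < c1" "0 < c2" and lower:
    "\<And>h A n \<mu>hat. 0 < h \<Longrightarrow> h \<le> 1 \<Longrightarrow> 0 < A \<Longrightarrow> A \<le> \<gamma> * h powr \<alpha> \<Longrightarrow>
      real n * (A\<^sup>2 * h powr (2 * \<beta> * ?d + 1)) \<le> c1 \<Longrightarrow> is_estimator n \<mu>hat \<Longrightarrow>
      ennreal (c2 * A * h) \<le> (SUP \<mu> \<in> (D_class \<alpha> L M :: (real ^ 'd) measure set). risk n \<mu>eps \<mu>hat \<mu>)"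
    using risk_lower_bound[OF nondegenerate] assms(9,11) by (metis less_imp_le)
  \<comment> \<open>In both regimes the choice of scale reduces the two constraints to
    \<open>\<gamma>' \<le> \<gamma>\<close> and \<open>\<gamma>'\<^sup>2 \<le> c1\<close>.\<close>
  define \<gamma>' where "\<gamma>' = min \<gamma> (sqrt c1)"
  have g': "0 < \<gamma>'" "\<gamma>' \<le> \<gamma>" using g by (auto simp: \<gamma>'_def)
  have g2: "\<gamma>'\<^sup>2 \<le> c1"
  proof -
    have "\<gamma>'\<^sup>2 \<le> (sqrt c1)\<^sup>2" using g' by (intro power_mono) (auto simp: \<gamma>'_def)
    then show ?thesis using g by simp
  qed
  have choice: "\<exists>h A. 0 < h \<and> h \<le> 1 \<and> 0 < A \<and> A \<le> \<gamma> * h powr \<alpha> \<and>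
      real n * (A\<^sup>2 * h powr (2 * \<beta> * ?d + 1)) \<le> c1 \<and> psi \<alpha> \<beta> CARD('d) n * (A * h) = \<gamma>'" if n: "1 \<le> n" for n
  proof (cases "1 \<le> 2 * \<beta> * ?d")
    case True
    \<comment> \<open>With \<open>h powr k = 1 / real n\<close> the Sobolev and chi-square
      constraints are tight together up to constants, and \<open>A * h\<close> is of order
      \<open>h powr (\<alpha> + 1)\<close>, the reciprocal of \<open>psi\<close>.\<close>
    define k where "k = 2 * \<alpha> + 2 * \<beta> * ?d + 1"
    have k: "0 < k" using True assms(9) by (simp add: k_def)
    define h where "h = real n powr (- 1 / k)"
    have h: "0 < h" "h \<le> 1" using n k powr_mono[of "- 1 / k" 0 "real n"] by (auto simp: h_def)
    have hp: "h powr q = real n powr (- q / k)" for q by (simp add: h_def powr_powr)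
    let ?A = "\<gamma>' * h powr \<alpha>"
    have "real n * (?A\<^sup>2 * h powr (2 * \<beta> * ?d + 1)) = \<gamma>'\<^sup>2 * (real n powr 1 * h powr (2 * \<alpha> + (2 * \<beta> * ?d + 1)))"
      using h n by (simp add: power_mult_distrib powr_power powr_add mult_ac)
    also have "2 * \<alpha> + (2 * \<beta> * ?d + 1) = k" by (simp add: k_def)
    also have "real n powr 1 * h powr k = 1" using n k unfolding hp by (simp flip: powr_add)
    finally have "real n * (?A\<^sup>2 * h powr (2 * \<beta> * ?d + 1)) \<le> c1" using g2 by simp
    moreover have "psi \<alpha> \<beta> CARD('d) n * (?A * h) = \<gamma>'"
    proof -
      have "psi \<alpha> \<beta> CARD('d) n = real n powr ((\<alpha> + 1) / k)" using True by (simp add: psi_def k_def max_def)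
      moreover have "?A * h = \<gamma>' * h powr (\<alpha> + 1)" using h by (simp add: powr_add)
      ultimately have "psi \<alpha> \<beta> CARD('d) n * (?A * h) = \<gamma>' * (real n powr ((\<alpha> + 1) / k) * real n powr (- (\<alpha> + 1) / k))"
        unfolding hp by simp
      also have "real n powr ((\<alpha> + 1) / k) * real n powr (- (\<alpha> + 1) / k) = 1"
        using n by (simp flip: powr_add add_divide_distrib)
      finally show ?thesis by simp
    qed
    ultimately show ?thesis using h g' by (intro exI[of _ h] exI[of _ ?A]) (auto intro!: mult_right_mono)
  next
    case False
    have s: "0 < sqrt (real n)" "1 \<le> sqrt (real n)" using n by auto
    have "psi \<alpha> \<beta> CARD('d) n = real n powr (1/2)"
    proof -
      have e: "(\<alpha> + 1) / (2 * \<alpha> + 1 + 1) = 1/2" using assms(9) by (simp add: field_simps)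
      have "max (2 * \<beta> * ?d) 1 = 1" using False by simp
      then show ?thesis by (simp only: psi_def e)
    qed
    then have "psi \<alpha> \<beta> CARD('d) n * (\<gamma>' / sqrt (real n) * 1) = \<gamma>'" using s n by (simp add: powr_half_sqrt)
    moreover have "real n * ((\<gamma>' / sqrt (real n))\<^sup>2 * 1 powr (2 * \<beta> * ?d + 1)) \<le> c1"
      using g2 n by (simp add: power_divide)
    moreover have "\<gamma>' / sqrt (real n) \<le> \<gamma> * 1 powr \<alpha>"
    proof -
      have "\<gamma>' / sqrt (real n) \<le> \<gamma>' / 1" using g' s by (intro divide_left_mono) auto
      then show ?thesis using g' by simp
    qed
    ultimately show ?thesis using g' s by (intro exI[of _ 1] exI[of _ "\<gamma>' / sqrt (real n)"]) auto
  qed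
  have bound: "ennreal (c2 * \<gamma>') \<le> ennreal (psi \<alpha> \<beta> CARD('d) n) * (SUP \<mu> \<in> (D_class \<alpha> L M :: (real ^ 'd) measure set). risk n \<mu>eps \<mu>hat \<mu>)"
    if n: "1 \<le> n" and est: "is_estimator n \<mu>hat" for n \<mu>hat
  proof -
    obtain h A where hA: "0 < h" "h \<le> 1" "0 < A" "A \<le> \<gamma> * h powr \<alpha>"
      "real n * (A\<^sup>2 * h powr (2 * \<beta> * ?d + 1)) \<le> c1" "psi \<alpha> \<beta> CARD('d) n * (A * h) = \<gamma>'"
      using choice[OF n] by blast
    have "c2 * \<gamma>' = psi \<alpha> \<beta> CARD('d) n * (c2 * A * h)" unfolding hA(6)[symmetric] by (simp only: mult_ac)
    moreover have "0 \<le> psi \<alpha> \<beta> CARD('d) n" "0 \<le> c2 * A * h" using hA(1,3) g(3) by (auto simp: psi_def)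
    ultimately have "ennreal (c2 * \<gamma>') = ennreal (psi \<alpha> \<beta> CARD('d) n) * ennreal (c2 * A * h)"
      by (simp only: ennreal_mult)
    also have "\<dots> \<le> ennreal (psi \<alpha> \<beta> CARD('d) n) * (SUP \<mu> \<in> D_class \<alpha> L M. risk n \<mu>eps \<mu>hat \<mu>)"
      by (intro mult_left_mono lower[OF hA(1-5) est]) auto
    finally show ?thesis .
  qed
  show ?thesis
  proof (intro exI[of _ "c2 * \<gamma>' / 2"] conjI allI impI)
    show "0 < c2 * \<gamma>' / 2" using g g' by simp
    fix \<mu>hat :: "nat \<Rightarrow> (nat \<Rightarrow> real ^ 'd) \<Rightarrow> (real ^ 'd) measure"
    assume est: "\<forall>n. is_estimator n (\<mu>hat n)"
    \<comment> \<open>Halving the constant makes the final inequality strict. The bound is used from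
      \<open>n = 1\<close> on, since \<open>psi\<close> vanishes at \<open>n = 0\<close>.\<close>
    have "ennreal (c2 * \<gamma>' / 2) < ennreal (c2 * \<gamma>')" using g g' by (intro ennreal_lessI) auto
    also have "\<dots> \<le> liminf (\<lambda>n. ennreal (psi \<alpha> \<beta> CARD('d) n) * (SUP \<mu> \<in> D_class \<alpha> L M. risk n \<mu>eps (\<mu>hat n) \<mu>))"
      by (intro Liminf_bounded eventually_mono[OF eventually_ge_at_top[of 1]] bound est[rule_format])
    finally show "ennreal (c2 * \<gamma>' / 2) < liminf (\<lambda>n. ennreal (psi \<alpha> \<beta> CARD('d) n) * (SUP \<mu> \<in> D_class \<alpha> L M. risk n \<mu>eps (\<mu>hat n) \<mu>))" .
  qed
qed

end
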